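(* Let $n\ge1$, $p>1$, $q=\frac p{p-1}$, and let $g$ be a positive function in $L^p(\mathbb{R}^n)$. Then $$\left(\int_{\mathbb{R}^{n}}g^{p}\,dx\right)^{1+\frac{q}{n}}\le p^{p}\,\gamma_{n,p}^{-1}\left(\int_{\mathbb{R}^{n}}g\,dx\right)^{\frac{pq}{n}}\int_{\mathbb{R}^{n}}|\nabla g|^{p}\,dx,$$ where $$\gamma_{n,p}=n(qe)^{p-1}\pi^{\frac p2}\left[\frac{\Gamma\left(\frac n2+1\right)}{\Gamma\left(\frac nq+1\right)}\right]^{-\frac pn}.$$
   Context: $\Gamma$ is the Euler Gamma function. $\nabla g$ is the (weak) gradient of $g$, assumed to exist so that the right-hand side makes sense; integrals on the right-hand side are allowed to be $+\infty$. *)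

theory Defs
  imports "HOL-Analysis.Analysis"
begin

text \<open>
  Real powers on the extended half-line, with \<open>\<infinity>\<^sup>a = \<infinity>\<close>; only meant for exponents \<open>a > 0\<close>.
\<close>

definition ennreal_powr :: "ennreal \<Rightarrow> real \<Rightarrow> ennreal"
  where "ennreal_powr x a = (if x = \<infinity> then \<infinity> else ennreal (enn2real x powr a))"

definition in_Lp :: "real \<Rightarrow> ('a::euclidean_space \<Rightarrow> real) \<Rightarrow> bool"
  where "in_Lp p f \<longleftrightarrow> f \<in> borel_measurable lebesgue \<and>
           (\<integral>\<^sup>+ x. ennreal (\<bar>f x\<bar> powr p) \<partial>lebesgue) < \<infinity>"

definition partial_deriv :: "'a::euclidean_space \<Rightarrow> ('a \<Rightarrow> real) \<Rightarrow> 'a \<Rightarrow> real"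
  where "partial_deriv b f x = frechet_derivative f (at x) b"

primrec C_k :: "nat \<Rightarrow> ('a::euclidean_space \<Rightarrow> real) \<Rightarrow> bool"
  where
    "C_k 0 f \<longleftrightarrow> continuous_on UNIV f"
  | "C_k (Suc k) f \<longleftrightarrow>
       f differentiable_on UNIV \<and> (\<forall>b\<in>Basis. C_k k (partial_deriv b f))"

definition test_function :: "('a::euclidean_space \<Rightarrow> real) \<Rightarrow> bool"
  where "test_function \<phi> \<longleftrightarrow> (\<forall>k. C_k k \<phi>) \<and> compact (closure {x. \<phi> x \<noteq> 0})"

definition locally_integrable :: "('a::euclidean_space \<Rightarrow> 'b::euclidean_space) \<Rightarrow> bool"
  where "locally_integrable f \<longleftrightarrow> (\<forall>K. compact K \<longrightarrow> f absolutely_integrable_on K)"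

definition weak_gradient :: "('a::euclidean_space \<Rightarrow> real) \<Rightarrow> ('a \<Rightarrow> 'a) \<Rightarrow> bool"
  where "weak_gradient g G \<longleftrightarrow> locally_integrable g \<and> locally_integrable G \<and>
           (\<forall>\<phi>. test_function \<phi> \<longrightarrow> (\<forall>b\<in>Basis.
              (\<integral>x. g x * partial_deriv b \<phi> x \<partial>lebesgue) = - (\<integral>x. (G x \<bullet> b) * \<phi> x \<partial>lebesgue)))"

definition gamma_const :: "nat \<Rightarrow> real \<Rightarrow> real"
  where "gamma_const n p = (let q = p / (p - 1) in
           real n * (q * exp 1) powr (p - 1) * pi powr (p / 2) *
           (Gamma (real n / 2 + 1) / Gamma (real n / q + 1)) powr (- (p / real n)))"

end

theory Submission
  imports Defs
begin

text \<open>
  Since \<open>p\<^sup>p / \<gamma>\<close> is the optimal constant of the Euclidean \<open>L\<^sup>p\<close> logarithmic Sobolev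
  inequality, the Nash inequality is obtained as in the Prekopa-Leindler proof of that inequality.
  With \<open>U = u powr (p / (1 - t))\<close> and \<open>V(y) = exp (- c \<bar>y\<bar> powr q)\<close> the smallest admissible \<open>W\<close> in
  \<open>U(x) powr (1 - t) * V(y) powr t \<le> W(x + t / (1 - t) * y)\<close> is an sup-convolution whose expansion
  in \<open>t\<close> is \<open>u powr p + t K \<bar>\<nabla>u\<bar> powr p + o(t)\<close>, by Young's inequality. Bounding
  \<open>\<integral>U\<close> from below in terms of \<open>\<integral>u\<close> and \<open>\<integral>u powr p\<close> by convexity, comparing the terms of order
  \<open>t\<close> and optimizing in \<open>c\<close> gives the claim for regular compactly supported \<open>u\<close>. For general \<open>g\<close>
  one takes \<open>u = max 0 (g * \<rho> - \<epsilon>)\<close>, which is compactly supported, does not increase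
  \<open>\<integral>g\<close> or \<open>\<integral>\<bar>\<nabla>g\<bar> powr p\<close>, and recovers \<open>\<integral>g powr p\<close> in the limit by Fatou's lemma. If \<open>\<integral>g\<close> is
  infinite one must still exclude \<open>\<nabla>g = 0\<close>, because \<open>\<infinity> * 0 = 0\<close>.
\<close>

section \<open>The Prekopa-Leindler inequality\<close>

text \<open>At t = 0 both sides of the Prekopa-Leindler inequality equal P, the integral of u^p, so
  all the information lies in comparing their slopes there. In logarithmic form the slope of the
  left side would contain the entropy of u^p, as in the logarithmic Sobolev inequality. Jensen's
  inequality bounds that entropy through P and m, the integral of u, and it is applied before t
  tends to 0, so no entropy ever has to be differentiated. The mass of exp (-c |y|^q) supplies the
  Gamma factors of \<open>gamma_const\<close>, the Jacobian (1 - t)^n supplies a summand n, and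
  Young's inequality enters in its exact Legendre form, which keeps the constant.

  The obstacle is uniformity: the expansion in t must hold at all points at once. It is secured by
  cutting V off to a ball, by the compact support of u, and by a Taylor bound for u that is uniform
  in the base point. The cut-off of V is removed afterwards by exhausting its mass.\<close>

lemma emeasure_lborel_affine_real:
  fixes A :: "real set"
  assumes "c > 0" "A \<in> sets borel"
  shows "emeasure lborel ((\<lambda>x. d + c * x) ` A) = ennreal c * emeasure lborel A"
proof -
  have inv: "(\<lambda>x. d + c * x) -` ((\<lambda>x. d + c * x) ` A) = A" using assms by auto
  have im: "(\<lambda>x. d + c * x) ` A = (\<lambda>x. (x - d) / c) -` A"
    using assms by (auto simp: image_iff field_simps intro!: bexI[where x="(_ - d) / c"])
  have m: "(\<lambda>x. d + c * x) ` A \<in> sets borel"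
    unfolding im using assms by (intro measurable_sets_borel[of _ borel]) auto
  have "emeasure lborel ((\<lambda>x. d + c * x) ` A) = 
     emeasure (density (distr lborel borel (\<lambda>x. d + c * x)) (\<lambda>_. ennreal \<bar>c\<bar>)) ((\<lambda>x. d + c * x) ` A)"
    using lborel_real_affine[of c d] assms by simp
  also have "\<dots> = ennreal c * emeasure lborel A"
    using assms m by (simp add: emeasure_density nn_integral_cmult emeasure_distr inv)
  finally show ?thesis .
qed

text \<open>Both \<open>s * min B + A\<close> and \<open>max A + s * B\<close> lie in
  \<open>C\<close>, and they overlap in at most the point \<open>max A + s * min B\<close>.\<close>

lemma emeasure_sumset_compact:
  fixes A B C :: "real set"
  assumes "compact A" "A \<noteq> {}" "compact B" "B \<noteq> {}" "s > 0" and C: "C \<in> sets borel"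
    and sub: "\<And>a b. a \<in> A \<Longrightarrow> b \<in> B \<Longrightarrow> a + s * b \<in> C"
  shows "emeasure lborel A + ennreal s * emeasure lborel B \<le> emeasure lborel C"
proof -
  obtain a where a: "a \<in> A" "\<And>x. x \<in> A \<Longrightarrow> x \<le> a" using compact_attains_sup[of A] assms by blast
  obtain b where b: "b \<in> B" "\<And>x. x \<in> B \<Longrightarrow> b \<le> x" using compact_attains_inf[of B] assms by blast
  have AB[measurable]: "A \<in> sets borel" "B \<in> sets borel" using assms by (auto intro: borel_compact)
  let ?A = "(\<lambda>x. s * b + 1 * x) ` A" and ?B = "(\<lambda>x. a + s * x) ` B"
  have c: "compact ?A" "compact ?B"
    using assms by (auto intro!: compact_continuous_image continuous_intros)
  have "?A \<inter> ?B \<subseteq> {a + s * b}"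
  proof
    fix z assume "z \<in> ?A \<inter> ?B"
    then obtain x y where xy: "x \<in> A" "y \<in> B" "z = s * b + x" "z = a + s * y" by auto
    have "s * b \<le> s * y" using b(2)[OF xy(2)] \<open>s > 0\<close> by simp
    then show "z \<in> {a + s * b}" using a(2)[OF xy(1)] xy by auto
  qed
  then have "emeasure lborel (?A \<inter> ?B) \<le> emeasure lborel {a + s * b}"
    by (intro emeasure_mono) auto
  then have 0: "?A \<inter> ?B \<in> null_sets lborel" using c by (auto simp: null_sets_def intro!: sets.Int borel_compact)
  have "emeasure lborel A + ennreal s * emeasure lborel B = emeasure lborel ?A + emeasure lborel ?B"
    using assms AB by (subst (1 2) emeasure_lborel_affine_real) auto
  also have "\<dots> = emeasure lborel (?A \<union> ?B)"
    using c 0 by (intro emeasure_Un'[symmetric]) (auto intro: borel_compact)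
  also have "\<dots> \<le> emeasure lborel C"
    using sub[OF _ b(1)] sub[OF a(1)] C by (intro emeasure_mono) (auto simp: add_ac)
  finally show ?thesis .
qed

lemma compact_inner_approx:
  fixes A :: "real set"
  assumes "A \<in> sets borel" "bounded A" "A \<noteq> {}" "e > 0"
  obtains K where "compact K" "K \<subseteq> A" "K \<noteq> {}" "emeasure lborel A \<le> emeasure lborel K + ennreal e"
proof -
  obtain T where T: "closed T" "T \<subseteq> A" "A - T \<in> lmeasurable" "emeasure lebesgue (A - T) < ennreal e"
    using sets_lebesgue_inner_closed[of A e] assms by auto
  obtain a where a: "a \<in> A" using assms by auto
  \<comment> \<open>\<open>T\<close> may be empty; the extra point keeps the compact set nonempty,
    as the sum set estimate requires.\<close>
  let ?K = "insert a T"
  have [measurable]: "T \<in> sets borel" "A \<in> sets borel" using T assms by auto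
  have "compact ?K"
    using T a assms(2) bounded_subset by (auto intro!: compact_insert simp: compact_eq_bounded_closed)
  moreover have "emeasure lborel A \<le> emeasure lborel (?K \<union> (A - T))"
    using T by (intro emeasure_mono) auto
  moreover have "\<dots> \<le> emeasure lborel ?K + emeasure lborel (A - T)"
    by (intro emeasure_subadditive) auto
  moreover have "emeasure lborel (A - T) \<le> ennreal e"
    using T(4) by (simp add: less_imp_le)
  ultimately show ?thesis using a T
    by (intro that[of ?K]) (auto intro: order_trans add_left_mono)
qed

text \<open>Inner regularity reduces this one-dimensional Brunn-Minkowski inequality to compact
  sets. The sum set of Borel sets need not be Borel, hence the formulation with a Borel superset
  \<open>C\<close>.\<close>

lemma emeasure_sumset:
  fixes A B C :: "real set"
  assumes A: "A \<in> sets borel" "bounded A" "A \<noteq> {}" and B: "B \<in> sets borel" "bounded B" "B \<noteq> {}"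
    and "s > 0" and C: "C \<in> sets borel"
    and sub: "\<And>a b. a \<in> A \<Longrightarrow> b \<in> B \<Longrightarrow> a + s * b \<in> C"
  shows "emeasure lborel A + ennreal s * emeasure lborel B \<le> emeasure lborel C"
proof (rule ennreal_le_epsilon)
  fix e :: real assume "e > 0"
  define d where "d = e / (1 + s)"
  have d: "d > 0" "d + s * d = e" using \<open>e > 0\<close> \<open>s > 0\<close> by (auto simp: d_def add_pos_pos divide_simps) (auto simp: algebra_simps)
  obtain K where K: "compact K" "K \<subseteq> A" "K \<noteq> {}" "emeasure lborel A \<le> emeasure lborel K + ennreal d"
    using compact_inner_approx[OF A d(1)] by blast
  obtain L where L: "compact L" "L \<subseteq> B" "L \<noteq> {}" "emeasure lborel B \<le> emeasure lborel L + ennreal d"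
    using compact_inner_approx[OF B d(1)] by blast
  have "emeasure lborel A + ennreal s * emeasure lborel B
     \<le> emeasure lborel K + ennreal d + ennreal s * (emeasure lborel L + ennreal d)"
    by (intro add_mono mult_left_mono K L) auto
  also have "\<dots> = emeasure lborel K + ennreal s * emeasure lborel L + ennreal e"
    using d \<open>s > 0\<close> by (simp add: algebra_simps flip: ennreal_mult ennreal_plus)
  also have "\<dots> \<le> emeasure lborel C + ennreal e"
    using K L sub by (intro add_right_mono emeasure_sumset_compact \<open>s > 0\<close> C) auto
  finally show "emeasure lborel A + ennreal s * emeasure lborel B \<le> emeasure lborel C + ennreal e" .
qed

section \<open>Layer-cake representation of integrals\<close>

lemma emeasure_lborel_below:
  "emeasure lborel {l::real. 0 < l \<and> ennreal l < y} = y"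
proof (cases y)
  case (real r)
  then have "{l::real. 0 < l \<and> ennreal l < y} = {0<..<r}" by (auto simp: ennreal_less_iff)
  then show ?thesis using real by simp
next
  case top
  have "ennreal (real k) \<le> emeasure lborel {0::real<..}" for k :: nat
  proof -
    have "ennreal (real k) = emeasure lborel {0<..<real k}" by simp
    also have "\<dots> \<le> emeasure lborel {0::real<..}" by (intro emeasure_mono) auto
    finally show ?thesis .
  qed
  then have "emeasure lborel {0::real<..} = top"
    by (metis ennreal_of_nat_eq_real_of_nat ennreal_Ex_less_of_nat less_le_not_le linorder_not_le top.not_eq_extremum)
  moreover have "{l::real. 0 < l \<and> ennreal l < y} = {0<..}" using top by auto
  ultimately show ?thesis using top by simp
qed

lemma measurable_emeasure_superlevel [measurable]:
  fixes f :: "'a::euclidean_space \<Rightarrow> ennreal"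
  assumes [measurable]: "f \<in> borel_measurable borel"
  shows "(\<lambda>l::real. emeasure lborel {x. ennreal l < f x}) \<in> borel_measurable borel"
proof -
  have "(\<lambda>l::real. emeasure lborel {x. ennreal l < f x})
      = (\<lambda>l. \<integral>\<^sup>+x. (if ennreal l < f x then 1 else 0) \<partial>lborel)"
  proof
    fix l :: real
    have "emeasure lborel {x. ennreal l < f x} = (\<integral>\<^sup>+x. indicator {x. ennreal l < f x} x \<partial>lborel)" by simp
    also have "\<dots> = (\<integral>\<^sup>+x. (if ennreal l < f x then 1 else 0) \<partial>lborel)"
      by (intro nn_integral_cong) (auto simp: indicator_def)
    finally show "emeasure lborel {x. ennreal l < f x} = (\<integral>\<^sup>+x. (if ennreal l < f x then 1 else 0) \<partial>lborel)" .
  qed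
  then show ?thesis by simp
qed

text \<open>Tonelli on the region under the graph, whose fibre over x has length f x. The
  restriction \<open>0 < l\<close> is carried explicitly because the levels are real and
  \<open>ennreal\<close> collapses negative ones to 0.\<close>

lemma layer_cake:
  fixes f :: "'a::euclidean_space \<Rightarrow> ennreal"
  assumes [measurable]: "f \<in> borel_measurable borel"
  shows "(\<integral>\<^sup>+x. f x \<partial>lborel) = (\<integral>\<^sup>+l. (if 0 < l then emeasure lborel {x. ennreal l < f x} else 0) \<partial>lborel)"
proof -
  have "(\<integral>\<^sup>+x. f x \<partial>lborel) = (\<integral>\<^sup>+x. (\<integral>\<^sup>+l. indicator {l. 0 < l \<and> ennreal l < f x} l \<partial>lborel) \<partial>lborel)"
    by (subst nn_integral_indicator) (auto simp: emeasure_lborel_below)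
  also have "\<dots> = (\<integral>\<^sup>+x. (\<integral>\<^sup>+l. (if 0 < l \<and> ennreal l < f x then 1 else 0) \<partial>lborel) \<partial>lborel)"
    by (intro nn_integral_cong) (auto simp: indicator_def)
  also have "\<dots> = (\<integral>\<^sup>+l. (\<integral>\<^sup>+x. (if 0 < l \<and> ennreal l < f x then 1 else 0) \<partial>lborel) \<partial>lborel)"
    by (rule lborel_pair.Fubini') measurable
  also have "\<dots> = (\<integral>\<^sup>+l. (if 0 < l then emeasure lborel {x. ennreal l < f x} else 0) \<partial>lborel)"
  proof (intro nn_integral_cong)
    fix l :: real
    have "(\<integral>\<^sup>+x. (if 0 < l \<and> ennreal l < f x then 1 else 0) \<partial>lborel)
       = (\<integral>\<^sup>+x. (if 0 < l then indicator {x. ennreal l < f x} x else 0) \<partial>lborel)"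
      by (intro nn_integral_cong) (auto simp: indicator_def)
    also have "\<dots> = (if 0 < l then emeasure lborel {x. ennreal l < f x} else 0)"
      by simp
    finally show "(\<integral>\<^sup>+x. (if 0 < l \<and> ennreal l < f x then 1 else 0) \<partial>lborel) = 
       (if 0 < l then emeasure lborel {x. ennreal l < f x} else 0)" .
  qed
  finally show ?thesis .
qed


section \<open>Prekopa-Leindler on the line\<close>

lemma weighted_am_gm:
  fixes a b t :: real
  assumes "0 < t" "t < 1" "0 \<le> a" "0 \<le> b"
  shows "a powr (1 - t) * b powr t \<le> (1 - t) * a + t * b"
proof (cases "a = 0 \<or> b = 0")
  case False
  then show ?thesis using Youngs_inequality_0[of "1 - t" t a b] assms by auto
qed (use assms in auto)

text \<open>Once both suprema are 1, the superlevel sets of \<open>u\<close> and \<open>v\<close> at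
  a level \<open>l < 1\<close> are nonempty and the sum set estimate applies; at levels l >= 1 both
  are empty. Integrating over the levels gives an additive bound, from which the usual geometric
  mean follows.\<close>

lemma prekopa_leindler_real_normalized:
  fixes u v :: "real \<Rightarrow> real" and w :: "real \<Rightarrow> ennreal"
  assumes [measurable]: "u \<in> borel_measurable borel" "v \<in> borel_measurable borel" "w \<in> borel_measurable borel"
    and u: "\<And>x. 0 \<le> u x" "\<And>x. u x \<noteq> 0 \<Longrightarrow> \<bar>x\<bar> \<le> R" "\<And>x. u x \<le> 1" "\<And>l. l < 1 \<Longrightarrow> \<exists>x. l < u x"
    and v: "\<And>x. 0 \<le> v x" "\<And>x. v x \<noteq> 0 \<Longrightarrow> \<bar>x\<bar> \<le> R" "\<And>x. v x \<le> 1" "\<And>l. l < 1 \<Longrightarrow> \<exists>x. l < v x"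
    and t: "0 < t" "t < 1" and "s > 0"
    and w: "\<And>x y. ennreal (u x powr (1 - t) * v y powr t) \<le> w (x + s * y)"
  shows "(\<integral>\<^sup>+x. ennreal (u x) \<partial>lborel) + ennreal s * (\<integral>\<^sup>+x. ennreal (v x) \<partial>lborel) \<le> (\<integral>\<^sup>+x. w x \<partial>lborel)"
proof -
  have bd: "bounded {x. l < f x}" if "\<And>x. f x \<noteq> 0 \<Longrightarrow> \<bar>x\<bar> \<le> R" "0 < l" for l and f :: "real \<Rightarrow> real"
    using that by (intro boundedI[of _ R]) force
  have lev: "emeasure lborel {x. ennreal l < ennreal (u x)} + ennreal s * emeasure lborel {x. ennreal l < ennreal (v x)}
      \<le> emeasure lborel {x. ennreal l < w x}" if l: "0 < l" for l
  proof (cases "l < 1")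
    case True
    have eq: "{x. ennreal l < ennreal (u x)} = {x. l < u x}" "{x. ennreal l < ennreal (v x)} = {x. l < v x}"
      using l by (auto simp: ennreal_less_iff)
    show ?thesis unfolding eq
    proof (rule emeasure_sumset)
      fix a b assume "a \<in> {x. l < u x}" "b \<in> {x. l < v x}"
      then have ab: "l < u a" "l < v b" by auto
      have "l = l powr (1 - t) * l powr t" using l by (simp flip: powr_add)
      also have "\<dots> < u a powr (1 - t) * v b powr t"
        using l t ab by (intro mult_strict_mono powr_less_mono2) auto
      finally have "ennreal l < ennreal (u a powr (1 - t) * v b powr t)" using l by (simp add: ennreal_less_iff)
      then show "a + s * b \<in> {x. ennreal l < w x}" using w[of a b] by auto
    qed (use u(2,4) v(2,4) l True \<open>s > 0\<close> in \<open>auto intro!: bd\<close>)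
  next
    case False
    then have "\<not> l < u x" "\<not> l < v x" for x using u(3)[of x] v(3)[of x] by auto
    then show ?thesis using l by (simp add: ennreal_less_iff)
  qed
  have "(\<integral>\<^sup>+x. ennreal (u x) \<partial>lborel) + ennreal s * (\<integral>\<^sup>+x. ennreal (v x) \<partial>lborel) = 
    (\<integral>\<^sup>+l. (if 0 < l then emeasure lborel {x. ennreal l < ennreal (u x)} else 0) \<partial>lborel) +
    (\<integral>\<^sup>+l. ennreal s * (if 0 < l then emeasure lborel {x. ennreal l < ennreal (v x)} else 0) \<partial>lborel)"
    by (subst (1 2) layer_cake) (auto simp: nn_integral_cmult)
  also have "\<dots> = (\<integral>\<^sup>+l. (if 0 < l then emeasure lborel {x. ennreal l < ennreal (u x)} else 0) +
      ennreal s * (if 0 < l then emeasure lborel {x. ennreal l < ennreal (v x)} else 0) \<partial>lborel)"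
    by (intro nn_integral_add[symmetric]) auto
  also have "\<dots> \<le> (\<integral>\<^sup>+l. (if 0 < l then emeasure lborel {x. ennreal l < w x} else 0) \<partial>lborel)"
    using lev by (intro nn_integral_mono) auto
  also have "\<dots> = (\<integral>\<^sup>+x. w x \<partial>lborel)" by (rule layer_cake[symmetric]) simp
  finally show ?thesis .
qed

lemma nn_integral_bounded_support_finite:
  fixes u :: "real \<Rightarrow> real"
  assumes "\<And>x. u x \<le> M" "\<And>x. u x \<noteq> 0 \<Longrightarrow> \<bar>x\<bar> \<le> R" "R \<ge> 0" "M \<ge> 0"
  shows "(\<integral>\<^sup>+x. ennreal (u x) \<partial>lborel) \<le> ennreal (M * (2 * R))"
proof -
  have "(\<integral>\<^sup>+x. ennreal (u x) \<partial>lborel) \<le> (\<integral>\<^sup>+x. ennreal M * indicator {-R..R} x \<partial>lborel)"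
  proof (intro nn_integral_mono)
    fix x show "ennreal (u x) \<le> ennreal M * indicator {- R..R} x"
      using assms(1,2)[of x] by (cases "u x = 0") (auto simp: indicator_def intro!: ennreal_leI)
  qed
  also have "\<dots> = ennreal (M * (2 * R))"
    using assms by (subst nn_integral_cmult_indicator) (auto simp: ennreal_mult)
  finally show ?thesis .
qed

text \<open>Dividing by the suprema reduces to the normalized case, and weighted AM-GM turns the sum
  into a product. Evaluating \<open>w\<close> at \<open>x + t / (1 - t) * y\<close> instead of
  \<open>(1 - t) * x + t * y\<close> amounts to a dilation, which is the source of the factor
  \<open>1 - t\<close>.\<close>

lemma prekopa_leindler_real:
  fixes u v :: "real \<Rightarrow> real" and w :: "real \<Rightarrow> ennreal"
  assumes [measurable]: "u \<in> borel_measurable borel" "v \<in> borel_measurable borel" "w \<in> borel_measurable borel"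
    and u: "\<And>x. 0 \<le> u x" "\<And>x. u x \<noteq> 0 \<Longrightarrow> \<bar>x\<bar> \<le> R" "\<And>x. u x \<le> M"
    and v: "\<And>x. 0 \<le> v x" "\<And>x. v x \<noteq> 0 \<Longrightarrow> \<bar>x\<bar> \<le> R" "\<And>x. v x \<le> M"
    and t: "0 < t" "t < 1"
    and w: "\<And>x y. ennreal (u x powr (1 - t) * v y powr t) \<le> w (x + t / (1 - t) * y)"
    and R: "R \<ge> 0"
  shows "ennreal (enn2real (\<integral>\<^sup>+x. ennreal (u x) \<partial>lborel) powr (1 - t) * enn2real (\<integral>\<^sup>+x. ennreal (v x) \<partial>lborel) powr t)
     \<le> ennreal (1 - t) * (\<integral>\<^sup>+x. w x \<partial>lborel)"
proof (cases "(\<forall>x. u x = 0) \<or> (\<forall>x. v x = 0)")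
  case True
  then show ?thesis using t by auto
next
  case False
  then obtain x0 y0 where x0: "u x0 \<noteq> 0" and y0: "v y0 \<noteq> 0" by auto
  define s where "s = t / (1 - t)"
  have s: "s > 0" using t by (simp add: s_def)
  have M: "M \<ge> 0" using u(1)[of 0] u(3)[of 0] by linarith
  define a where "a = (SUP x. u x)"
  define b where "b = (SUP x. v x)"
  have bd: "bdd_above (range u)" "bdd_above (range v)" using u(3) v(3) by (auto intro!: bdd_aboveI)
  have a: "u x \<le> a" "v x \<le> b" for x unfolding a_def b_def using bd by (auto intro: cSUP_upper)
  have ab: "a > 0" "b > 0" using a(1)[of x0] a(2)[of y0] u(1)[of x0] v(1)[of y0] x0 y0 by linarith+
  have ex: "\<exists>x. l < u x" if "l < a" for l using that bd unfolding a_def by (simp add: less_cSUP_iff)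
  have ex': "\<exists>x. l < v x" if "l < b" for l using that bd unfolding b_def by (simp add: less_cSUP_iff)
  \<comment> \<open>The factor by which the hypothesis on \<open>w\<close> scales when
    \<open>u\<close> and \<open>v\<close> are divided by \<open>a\<close> and
    \<open>b\<close>.\<close>
  define k where "k = a powr (1 - t) * b powr t"
  have k: "k > 0" using ab by (simp add: k_def)
  define X where "X = enn2real (\<integral>\<^sup>+x. ennreal (u x) \<partial>lborel)"
  define Y where "Y = enn2real (\<integral>\<^sup>+x. ennreal (v x) \<partial>lborel)"
  \<comment> \<open>Boundedness and bounded support make the integral finite, so
    \<open>enn2real\<close> loses nothing.\<close>
  have X: "(\<integral>\<^sup>+x. ennreal (u x) \<partial>lborel) = ennreal X"
    unfolding X_def using nn_integral_bounded_support_finite[of u M R] u R M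
    by (metis ennreal_enn2real_if ennreal_neq_top neq_top_trans)
  have Y: "(\<integral>\<^sup>+x. ennreal (v x) \<partial>lborel) = ennreal Y"
    unfolding Y_def using nn_integral_bounded_support_finite[of v M R] v R M
    by (metis ennreal_enn2real_if ennreal_neq_top neq_top_trans)
  have XY: "X \<ge> 0" "Y \<ge> 0" by (auto simp: X_def Y_def)
  have "(\<integral>\<^sup>+x. ennreal (u x / a) \<partial>lborel) + ennreal s * (\<integral>\<^sup>+x. ennreal (v x / b) \<partial>lborel)
     \<le> (\<integral>\<^sup>+x. ennreal (1 / k) * w x \<partial>lborel)"
  proof (rule prekopa_leindler_real_normalized[where R=R and t=t])
    fix x y
    have "(u x / a) powr (1 - t) * (v y / b) powr t = 1 / k * (u x powr (1 - t) * v y powr t)"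
      using u(1) v(1) ab by (simp add: powr_divide k_def)
    then have "ennreal ((u x / a) powr (1 - t) * (v y / b) powr t)
        = ennreal (1 / k) * ennreal (u x powr (1 - t) * v y powr t)"
      using k by (simp only: ennreal_mult[of "1 / k"] zero_le_divide_1_iff less_imp_le mult_nonneg_nonneg powr_ge_zero)
    also have "\<dots> \<le> ennreal (1 / k) * w (x + s * y)"
      unfolding s_def by (intro mult_left_mono w) auto
    finally show "ennreal ((u x / a) powr (1 - t) * (v y / b) powr t) \<le> ennreal (1 / k) * w (x + s * y)" .
  next
    fix l :: real assume "l < 1"
    then show "\<exists>x. l < u x / a" "\<exists>x. l < v x / b"
      using ex[of "l * a"] ex'[of "l * b"] ab by (auto simp: field_simps)
  qed (use u(1,2) v(1,2) a ab t s in auto)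
  also have "(\<integral>\<^sup>+x. ennreal (u x / a) \<partial>lborel) = ennreal (X / a)"
    using ab u(1) X XY
    by (simp add: divide_inverse ennreal_mult' nn_integral_multc)
  also have "(\<integral>\<^sup>+x. ennreal (v x / b) \<partial>lborel) = ennreal (Y / b)"
    using ab v(1) Y XY
    by (simp add: divide_inverse ennreal_mult' nn_integral_multc)
  also have "(\<integral>\<^sup>+x. ennreal (1 / k) * w x \<partial>lborel) = ennreal (1 / k) * (\<integral>\<^sup>+x. w x \<partial>lborel)"
    by (simp add: nn_integral_cmult)
  finally have le: "ennreal (X / a + s * (Y / b)) \<le> ennreal (1 / k) * (\<integral>\<^sup>+x. w x \<partial>lborel)"
    using XY ab s by (simp add: ennreal_mult del: times_divide_eq_right)
  have "X powr (1 - t) * Y powr t = k * ((X / a) powr (1 - t) * (Y / b) powr t)"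
    using ab XY by (simp add: powr_divide k_def)
  also have "\<dots> \<le> k * ((1 - t) * (X / a) + t * (Y / b))"
    using k t XY ab by (intro mult_left_mono weighted_am_gm) auto
  also have "\<dots> = (1 - t) * (k * (X / a + s * (Y / b)))"
  proof -
    have "(1 - t) * s = t" using t by (simp add: s_def)
    then have eq: "t * (Y / b) = (1 - t) * s * (Y / b)" by simp
    show ?thesis by (simp only: eq distrib_left mult.assoc mult.left_commute[of k])
  qed
  finally have "ennreal (X powr (1 - t) * Y powr t) \<le> ennreal ((1 - t) * (k * (X / a + s * (Y / b))))"
    by (rule ennreal_leI)
  also have "\<dots> = ennreal (1 - t) * (ennreal k * ennreal (X / a + s * (Y / b)))"
    using t k XY ab s by (simp add: ennreal_mult)
  also have "\<dots> \<le> ennreal (1 - t) * (ennreal k * (ennreal (1 / k) * (\<integral>\<^sup>+x. w x \<partial>lborel)))"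
    by (intro mult_left_mono le) auto
  also have "\<dots> = ennreal (1 - t) * (\<integral>\<^sup>+x. w x \<partial>lborel)"
    using k by (simp add: mult.assoc[symmetric] ennreal_mult[symmetric])
  finally show ?thesis by (simp add: X_def Y_def)
qed


text \<open>Induction on the coordinates: with the remaining coordinates fixed, the one-dimensional
  inequality is exactly the hypothesis on the marginals \<open>U\<close>, \<open>V\<close>,
  \<open>W\<close>, and each coordinate contributes one factor \<open>1 - t\<close>. The hypothesis
  concerns extensional functions because these make up the product space. \<open>M\<close> is
  generalized because integrating out a coordinate changes the bound.\<close>

lemma prekopa_leindler_PiM:
  fixes u v :: "('i \<Rightarrow> real) \<Rightarrow> real" and w :: "('i \<Rightarrow> real) \<Rightarrow> ennreal"
  assumes "finite I"
    and "u \<in> borel_measurable (Pi\<^sub>M I (\<lambda>_. lborel))" "v \<in> borel_measurable (Pi\<^sub>M I (\<lambda>_. lborel))"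
      "w \<in> borel_measurable (Pi\<^sub>M I (\<lambda>_. lborel))"
    and "\<And>x. 0 \<le> u x" "\<And>x i. u x \<noteq> 0 \<Longrightarrow> i \<in> I \<Longrightarrow> \<bar>x i\<bar> \<le> R" "\<And>x. u x \<le> M"
    and "\<And>x. 0 \<le> v x" "\<And>x i. v x \<noteq> 0 \<Longrightarrow> i \<in> I \<Longrightarrow> \<bar>x i\<bar> \<le> R" "\<And>x. v x \<le> M"
    and t: "0 < t" "t < 1" and R: "R \<ge> 0"
    and "\<And>x y. x \<in> extensional I \<Longrightarrow> y \<in> extensional I \<Longrightarrow>
       ennreal (u x powr (1 - t) * v y powr t) \<le> w (\<lambda>i\<in>I. x i + t / (1 - t) * y i)"
  shows "ennreal (enn2real (\<integral>\<^sup>+x. ennreal (u x) \<partial>Pi\<^sub>M I (\<lambda>_. lborel)) powr (1 - t)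
          * enn2real (\<integral>\<^sup>+x. ennreal (v x) \<partial>Pi\<^sub>M I (\<lambda>_. lborel)) powr t)
     \<le> ennreal (1 - t) ^ card I * (\<integral>\<^sup>+x. w x \<partial>Pi\<^sub>M I (\<lambda>_. lborel))"
  using assms(1-10,14)
proof (induction I arbitrary: u v w M rule: finite_induct)
  case empty
  interpret product_sigma_finite "\<lambda>_::'i. lborel :: real measure" by standard
  \<comment> \<open>The empty product is a point mass at the everywhere undefined function, so the
    claim is the pointwise hypothesis there.\<close>
  have "w (\<lambda>i\<in>{}. undefined i + t / (1 - t) * undefined i) = w (\<lambda>_. undefined)" by (simp add: restrict_def)
  then show ?case using empty(10)[of "\<lambda>_. undefined" "\<lambda>_. undefined"] empty(4,7)
    by (simp add: nn_integral_empty restrict_def)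
next
  case (insert i I)
  interpret product_sigma_finite "\<lambda>_::'i. lborel :: real measure" by standard
  note [measurable] = insert(4,5,6)
  have M: "M \<ge> 0" using insert(7,9) order_trans by blast
  define U where "U x = enn2real (\<integral>\<^sup>+a. ennreal (u (x(i := a))) \<partial>lborel)" for x
  define V where "V x = enn2real (\<integral>\<^sup>+a. ennreal (v (x(i := a))) \<partial>lborel)" for x
  define W where "W x = ennreal (1 - t) * (\<integral>\<^sup>+a. w (x(i := a)) \<partial>lborel)" for x
  have fin: "(\<integral>\<^sup>+a. ennreal (u (x(i := a))) \<partial>lborel) \<le> ennreal (M * (2 * R))"
    "(\<integral>\<^sup>+a. ennreal (v (x(i := a))) \<partial>lborel) \<le> ennreal (M * (2 * R))" for x
    using insert(8)[of "x(i := a)" i for a] insert(9) insert(11)[of "x(i := a)" i for a] insert(12) M R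
    by (auto simp del: fun_upd_apply simp: fun_upd_same intro!: nn_integral_bounded_support_finite)
  have U: "(\<integral>\<^sup>+a. ennreal (u (x(i := a))) \<partial>lborel) = ennreal (U x)" for x
    unfolding U_def using fin(1)[of x] by (metis ennreal_enn2real_if ennreal_neq_top neq_top_trans)
  have V: "(\<integral>\<^sup>+a. ennreal (v (x(i := a))) \<partial>lborel) = ennreal (V x)" for x
    unfolding V_def using fin(2)[of x] by (metis ennreal_enn2real_if ennreal_neq_top neq_top_trans)
  have UV_le: "U x \<le> M * (2 * R)" "V x \<le> M * (2 * R)" for x
    using fin[of x] M R unfolding U V by auto
  have UV: "U x \<ge> 0" "V x \<ge> 0" for x by (auto simp: U_def V_def)
  have UV_supp: "\<bar>x j\<bar> \<le> R" if j: "j \<in> I" and "U x \<noteq> 0 \<or> V x \<noteq> 0" for x j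
  proof -
    have "\<exists>a. u (x(i := a)) \<noteq> 0 \<or> v (x(i := a)) \<noteq> 0"
    proof (rule ccontr)
      assume "\<not> ?thesis"
      then have "U x = 0" "V x = 0" by (auto simp: U_def V_def)
      then show False using that by auto
    qed
    then obtain a where "u (x(i := a)) \<noteq> 0 \<or> v (x(i := a)) \<noteq> 0" by blast
    then have "\<bar>(x(i := a)) j\<bar> \<le> R" using insert(8)[of "x(i := a)" j] insert(11)[of "x(i := a)" j] j by blast
    then show ?thesis using j insert(2) by (auto simp: fun_upd_def split: if_splits)
  qed
  have upd[measurable]: "(\<lambda>(x, a). x(i := a)) \<in> measurable (Pi\<^sub>M I (\<lambda>_. lborel) \<Otimes>\<^sub>M lborel) (Pi\<^sub>M (insert i I) (\<lambda>_. lborel))"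
    by (rule measurable_add_dim)
  have upd1: "(\<lambda>a. x(i := a)) \<in> measurable lborel (Pi\<^sub>M (insert i I) (\<lambda>_. lborel))" if "x \<in> extensional I" for x
    using measurable_compose[OF measurable_Pair1'[of x "Pi\<^sub>M I (\<lambda>_. lborel)" lborel] upd] that
    by (simp add: space_PiM PiE_def)
  have m1: "(\<lambda>x. \<integral>\<^sup>+a. ennreal (u (x(i := a))) \<partial>lborel) \<in> borel_measurable (Pi\<^sub>M I (\<lambda>_. lborel))"
    using measurable_compose[OF upd, of "\<lambda>x. ennreal (u x)"] lborel.borel_measurable_nn_integral
    by (simp add: split_def)
  have m2: "(\<lambda>x. \<integral>\<^sup>+a. ennreal (v (x(i := a))) \<partial>lborel) \<in> borel_measurable (Pi\<^sub>M I (\<lambda>_. lborel))"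
    using measurable_compose[OF upd, of "\<lambda>x. ennreal (v x)"] lborel.borel_measurable_nn_integral
    by (simp add: split_def)
  have m3: "(\<lambda>x. \<integral>\<^sup>+a. w (x(i := a)) \<partial>lborel) \<in> borel_measurable (Pi\<^sub>M I (\<lambda>_. lborel))"
    using measurable_compose[OF upd, of w] lborel.borel_measurable_nn_integral
    by (simp add: split_def)
  have "ennreal (enn2real (\<integral>\<^sup>+x. ennreal (U x) \<partial>Pi\<^sub>M I (\<lambda>_. lborel)) powr (1 - t)
          * enn2real (\<integral>\<^sup>+x. ennreal (V x) \<partial>Pi\<^sub>M I (\<lambda>_. lborel)) powr t)
     \<le> ennreal (1 - t) ^ card I * (\<integral>\<^sup>+x. W x \<partial>Pi\<^sub>M I (\<lambda>_. lborel))"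
  \<comment> \<open>Integration over an interval of length \<open>2 * R\<close> multiplies the bound
    by that length.\<close>
  proof (rule insert.IH[where M="M * (2 * R)"])
    show "U \<in> borel_measurable (Pi\<^sub>M I (\<lambda>_. lborel))" "V \<in> borel_measurable (Pi\<^sub>M I (\<lambda>_. lborel))"
      "W \<in> borel_measurable (Pi\<^sub>M I (\<lambda>_. lborel))"
      using m1 m2 m3 unfolding U_def V_def W_def by measurable
  next
    fix x y :: "'i \<Rightarrow> real" assume x: "x \<in> extensional I" and y: "y \<in> extensional I"
    let ?z = "\<lambda>j\<in>I. x j + t / (1 - t) * y j"
    have z: "?z \<in> extensional I" by simp
    show "ennreal (U x powr (1 - t) * V y powr t) \<le> W ?z"
      unfolding U_def V_def W_def
    proof (rule prekopa_leindler_real[where M=M and R=R])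
      fix a b
      have ext: "x(i := a) \<in> extensional (insert i I)" "y(i := b) \<in> extensional (insert i I)"
        using x y by (auto simp: extensional_def)
      have "(\<lambda>j\<in>insert i I. (x(i := a)) j + t / (1 - t) * (y(i := b)) j) = ?z(i := a + t / (1 - t) * b)"
        using insert(2) by (auto simp: fun_eq_iff)
      then show "ennreal (u (x(i := a)) powr (1 - t) * v (y(i := b)) powr t) \<le> w (?z(i := a + t / (1 - t) * b))"
        using insert(13)[OF ext] by (simp only:)
    next
      show "(\<lambda>a. u (x(i := a))) \<in> borel_measurable borel"
        using measurable_compose[OF upd1[OF x] insert(4)] by (simp del: fun_upd_apply)
      show "(\<lambda>a. v (y(i := a))) \<in> borel_measurable borel"
        using measurable_compose[OF upd1[OF y] insert(5)] by (simp del: fun_upd_apply)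
      show "(\<lambda>a. w (?z(i := a))) \<in> borel_measurable borel"
        using measurable_compose[OF upd1[OF z] insert(6)] by (simp del: fun_upd_apply)
      show "\<bar>a\<bar> \<le> R" if "u (x(i := a)) \<noteq> 0" for a using insert(8)[OF that, of i] by simp
      show "\<bar>a\<bar> \<le> R" if "v (y(i := a)) \<noteq> 0" for a using insert(11)[OF that, of i] by simp
    qed (use insert(7,9,10,12) t R in auto)
  qed (use UV UV_le UV_supp in auto)
  also have "(\<integral>\<^sup>+x. ennreal (U x) \<partial>Pi\<^sub>M I (\<lambda>_. lborel)) = (\<integral>\<^sup>+x. ennreal (u x) \<partial>Pi\<^sub>M (insert i I) (\<lambda>_. lborel))"
    using insert(1,2) by (subst product_nn_integral_insert) (auto simp: U)
  also have "(\<integral>\<^sup>+x. ennreal (V x) \<partial>Pi\<^sub>M I (\<lambda>_. lborel)) = (\<integral>\<^sup>+x. ennreal (v x) \<partial>Pi\<^sub>M (insert i I) (\<lambda>_. lborel))"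
    using insert(1,2) by (subst product_nn_integral_insert) (auto simp: V)
  also have "(\<integral>\<^sup>+x. W x \<partial>Pi\<^sub>M I (\<lambda>_. lborel)) = ennreal (1 - t) * (\<integral>\<^sup>+x. w x \<partial>Pi\<^sub>M (insert i I) (\<lambda>_. lborel))"
    using insert(1,2) m3 by (subst product_nn_integral_insert) (auto simp: W_def[abs_def] nn_integral_cmult)
  finally show ?case using insert(1,2) by (simp add: mult_ac)
qed

theorem prekopa_leindler:
  fixes u v :: "'a::euclidean_space \<Rightarrow> real" and w :: "'a \<Rightarrow> ennreal"
  assumes [measurable]: "u \<in> borel_measurable borel" "v \<in> borel_measurable borel" "w \<in> borel_measurable borel"
    and u: "\<And>x. 0 \<le> u x" "\<And>x. u x \<noteq> 0 \<Longrightarrow> norm x \<le> R" "\<And>x. u x \<le> M"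
    and v: "\<And>x. 0 \<le> v x" "\<And>x. v x \<noteq> 0 \<Longrightarrow> norm x \<le> R" "\<And>x. v x \<le> M"
    and t: "0 < t" "t < 1" and R: "R \<ge> 0"
    and w: "\<And>x y. ennreal (u x powr (1 - t) * v y powr t) \<le> w (x + (t / (1 - t)) *\<^sub>R y)"
  shows "ennreal (enn2real (\<integral>\<^sup>+x. ennreal (u x) \<partial>lborel) powr (1 - t) * enn2real (\<integral>\<^sup>+x. ennreal (v x) \<partial>lborel) powr t)
     \<le> ennreal (1 - t) ^ DIM('a) * (\<integral>\<^sup>+x. w x \<partial>lborel)"
proof -
  define T :: "('a \<Rightarrow> real) \<Rightarrow> 'a" where "T f = (\<Sum>b\<in>Basis. f b *\<^sub>R b)" for f
  have T[measurable]: "T \<in> measurable (Pi\<^sub>M Basis (\<lambda>_. lborel)) borel" unfolding T_def by measurable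
  have lb: "(lborel :: 'a measure) = distr (Pi\<^sub>M Basis (\<lambda>_. lborel)) borel T"
    unfolding T_def by (rule lborel_eq)
  have nn: "(\<integral>\<^sup>+x. f x \<partial>lborel) = (\<integral>\<^sup>+x. f (T x) \<partial>Pi\<^sub>M Basis (\<lambda>_. lborel))"
    if [measurable]: "f \<in> borel_measurable borel" for f :: "'a \<Rightarrow> ennreal"
    unfolding lb by (rule nn_integral_distr) auto
  have Tb: "\<bar>x b\<bar> \<le> norm (T x)" if "b \<in> Basis" for x b
  proof -
    have "x b = T x \<bullet> b" using that by (simp add: T_def inner_sum_left_Basis)
    then show ?thesis using Basis_le_norm[OF that, of "T x"] by simp
  qed
  have Tadd: "T (\<lambda>b\<in>Basis. x b + c * y b) = T x + c *\<^sub>R T y" for x y c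
    by (simp add: T_def scaleR_add_left sum.distrib scaleR_sum_right)
  have "ennreal (enn2real (\<integral>\<^sup>+x. ennreal (u (T x)) \<partial>Pi\<^sub>M Basis (\<lambda>_. lborel)) powr (1 - t)
          * enn2real (\<integral>\<^sup>+x. ennreal (v (T x)) \<partial>Pi\<^sub>M Basis (\<lambda>_. lborel)) powr t)
     \<le> ennreal (1 - t) ^ DIM('a) * (\<integral>\<^sup>+x. w (T x) \<partial>Pi\<^sub>M Basis (\<lambda>_. lborel))"
  proof (rule prekopa_leindler_PiM[where M=M and R=R])
    fix x y :: "'a \<Rightarrow> real"
    show "ennreal (u (T x) powr (1 - t) * v (T y) powr t) \<le> w (T (\<lambda>b\<in>Basis. x b + t / (1 - t) * y b))"
      unfolding Tadd by (rule w)
  qed (use u v t R order_trans[OF Tb] in auto)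
  then show ?thesis by (simp add: nn)
qed

section \<open>The integral of the extremal density\<close>

lemma nn_integral_exp_atLeast:
  fixes a :: real
  shows "(\<integral>\<^sup>+x. ennreal (exp (- x)) * indicator {a..} x \<partial>lborel) = ennreal (exp (- a))"
proof -
  have "(\<integral>\<^sup>+x. ennreal (exp (- x)) * indicator {a..} x \<partial>lborel) = ennreal (0 - (- exp (- a)))"
  proof (rule nn_integral_FTC_atLeast)
    show "((\<lambda>x::real. - exp (- x)) \<longlongrightarrow> 0) at_top"
      using tendsto_minus[OF filterlim_compose[OF exp_at_bot filterlim_uminus_at_bot_at_top]] by simp
  qed (auto intro!: derivative_eq_intros)
  then show ?thesis by simp
qed

text \<open>Writing exp (-s) as the integral of exp (-l) over l >= s and exchanging integrals leaves
  the volumes of the sublevel sets, which are balls of radius (l / c)^(1 / q). What remains is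
  Euler's integral for Gamma at n / q + 1.\<close>

theorem nn_integral_exp_norm_powr:
  fixes c q :: real
  assumes c: "c > 0" and q: "q > 0"
  shows "(\<integral>\<^sup>+(y::'a::euclidean_space). ennreal (exp (- (c * norm y powr q))) \<partial>lborel) =
     ennreal (c powr (- (DIM('a) / q)) * unit_ball_vol DIM('a) * Gamma (DIM('a) / q + 1))"
    (is "_ = ennreal ?Z")
proof -
  let ?n = "DIM('a)"
  have level: "emeasure lborel {y::'a. c * norm y powr q \<le> l} = ennreal (unit_ball_vol ?n * (l / c) powr (?n / q))"
    if l: "l \<ge> 0" for l
  proof -
    have "c * norm y powr q \<le> l \<longleftrightarrow> norm y \<le> (l / c) powr (1 / q)" for y :: 'a
    proof -
      have "c * norm y powr q \<le> l \<longleftrightarrow> norm y powr q \<le> l / c" using c by (simp add: field_simps)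
      also have "\<dots> \<longleftrightarrow> norm y \<le> (l / c) powr (1 / q)"
      proof
        assume "norm y powr q \<le> l / c"
        then have "(norm y powr q) powr (1 / q) \<le> (l / c) powr (1 / q)" using q by (intro powr_mono2) auto
        then show "norm y \<le> (l / c) powr (1 / q)" using q by (simp add: powr_powr)
      next
        assume "norm y \<le> (l / c) powr (1 / q)"
        then have "norm y powr q \<le> ((l / c) powr (1 / q)) powr q" using q by (intro powr_mono2) auto
        then show "norm y powr q \<le> l / c" using q l c by (simp add: powr_powr)
      qed
      finally show ?thesis .
    qed
    then have "{y::'a. c * norm y powr q \<le> l} = cball 0 ((l / c) powr (1 / q))"
      by (simp only: set_eq_iff mem_Collect_eq mem_cball dist_0_norm simp_thms)
    moreover have "((l / c) powr (1 / q)) ^ ?n = (l / c) powr (?n / q)"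
      using powr_realpow'[of "(l / c) powr (1 / q)" ?n] by (simp add: powr_powr)
    ultimately show ?thesis by (simp only: emeasure_cball powr_ge_zero)
  qed
  have "(\<integral>\<^sup>+(y::'a). ennreal (exp (- (c * norm y powr q))) \<partial>lborel)
     = (\<integral>\<^sup>+(y::'a). (\<integral>\<^sup>+l. ennreal (exp (- l)) * indicator {c * norm y powr q..} l \<partial>lborel) \<partial>lborel)"
    by (simp add: nn_integral_exp_atLeast)
  also have "\<dots> = (\<integral>\<^sup>+(y::'a). (\<integral>\<^sup>+l. (if c * norm y powr q \<le> l then ennreal (exp (- l)) else 0) \<partial>lborel) \<partial>lborel)"
    by (intro nn_integral_cong) (auto simp: indicator_def)
  also have "\<dots> = (\<integral>\<^sup>+l. (\<integral>\<^sup>+(y::'a). (if c * norm y powr q \<le> l then ennreal (exp (- l)) else 0) \<partial>lborel) \<partial>lborel)"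
    by (rule lborel_pair.Fubini') measurable
  \<comment> \<open>The exponent keeps the shape \<open>?n / q + 1 - 1\<close> in order to match
    Euler's integral at \<open>?n / q + 1\<close>.\<close>
  also have "\<dots> = (\<integral>\<^sup>+l. ennreal (c powr (- (?n / q)) * unit_ball_vol ?n) *
      ennreal (indicator {0..} l * l powr (?n / q + 1 - 1) / exp l) \<partial>lborel)"
  proof (intro nn_integral_cong)
    fix l :: real
    have "(\<integral>\<^sup>+(y::'a). (if c * norm y powr q \<le> l then ennreal (exp (- l)) else 0) \<partial>lborel)
       = (\<integral>\<^sup>+(y::'a). ennreal (exp (- l)) * indicator {y. c * norm y powr q \<le> l} y \<partial>lborel)"
      by (intro nn_integral_cong) (auto simp: indicator_def)
    also have "\<dots> = ennreal (exp (- l)) * emeasure lborel {y::'a. c * norm y powr q \<le> l}"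
      by (subst nn_integral_cmult_indicator) auto
    also have "\<dots> = ennreal (c powr (- (?n / q)) * unit_ball_vol ?n) *
      ennreal (indicator {0..} l * l powr (?n / q + 1 - 1) / exp l)"
    proof (cases "l \<ge> 0")
      case True
      then show ?thesis using c
        by (simp add: level powr_divide powr_minus exp_minus divide_simps flip: ennreal_mult)
    next
      case False
      then have "\<not> c * norm y powr q \<le> l" for y :: 'a
        using c by (meson mult_nonneg_nonneg powr_ge_zero less_imp_le order_trans)
      then show ?thesis using False by simp
    qed
    finally show "(\<integral>\<^sup>+(y::'a). (if c * norm y powr q \<le> l then ennreal (exp (- l)) else 0) \<partial>lborel) =
       ennreal (c powr (- (?n / q)) * unit_ball_vol ?n) *
      ennreal (indicator {0..} l * l powr (?n / q + 1 - 1) / exp l)" .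
  qed
  also have "\<dots> = ennreal (c powr (- (?n / q)) * unit_ball_vol ?n) * ennreal (Gamma (?n / q + 1))"
    using q by (subst nn_integral_cmult) (auto simp: Gamma_conv_nn_integral_real add_pos_pos divide_pos_pos)
  also have "\<dots> = ennreal ?Z"
    using q by (simp add: ennreal_mult[symmetric] Gamma_real_pos add_pos_pos less_imp_le)
  finally show ?thesis .
qed

lemma nn_integral_exhaust_cball:
  fixes f :: "'a::euclidean_space \<Rightarrow> ennreal"
  assumes [measurable]: "f \<in> borel_measurable borel" and "y < (\<integral>\<^sup>+x. f x \<partial>lborel)"
  obtains r where "r > 0" "y < (\<integral>\<^sup>+x. f x * indicator (cball 0 r) x \<partial>lborel)"
proof -
  have "(\<integral>\<^sup>+x. f x \<partial>lborel) = (\<integral>\<^sup>+x. (SUP k::nat. f x * indicator (cball 0 (real k)) x) \<partial>lborel)"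
  proof (intro nn_integral_cong antisym)
    fix x :: 'a
    obtain k :: nat where "norm x \<le> real k" using real_arch_simple by blast
    then show "f x \<le> (SUP k::nat. f x * indicator (cball 0 (real k)) x)"
      by (intro SUP_upper2[of k]) auto
    show "(SUP k::nat. f x * indicator (cball 0 (real k)) x) \<le> f x"
      by (intro SUP_least) (auto simp: indicator_def)
  qed
  also have "\<dots> = (SUP k::nat. \<integral>\<^sup>+x. f x * indicator (cball 0 (real k)) x \<partial>lborel)"
    by (intro nn_integral_monotone_convergence_SUP)
       (auto simp: incseq_def le_fun_def indicator_def)
  finally obtain k :: nat where "y < (\<integral>\<^sup>+x. f x * indicator (cball 0 (real k)) x \<partial>lborel)"
    using assms(2) by (auto simp: less_SUP_iff)
  \<comment> \<open>\<open>k\<close> may be 0, so the ball is enlarged to have positive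
    radius.\<close>
  moreover have "\<dots> \<le> (\<integral>\<^sup>+x. f x * indicator (cball 0 (real k + 1)) x \<partial>lborel)"
    by (intro nn_integral_mono) (auto simp: indicator_def)
  ultimately show ?thesis by (intro that[of "real k + 1"]) (auto intro: less_le_trans)
qed

section \<open>The Nash inequality for regular functions\<close>

text \<open>Young's inequality for \<open>x * y powr (p - 1)\<close>, rearranged; this covers x = 0
  and y = 0 without differentiating there. It serves both for upper bounds on increments, with the
  tangent taken at the larger argument, and for Jensen's inequality.\<close>

lemma powr_tangent:
  fixes x y p :: real
  assumes "p > 1" "x \<ge> 0" "y \<ge> 0"
  shows "y powr p + p * y powr (p - 1) * (x - y) \<le> x powr p"
proof -
  define q where "q = p / (p - 1)"
  have q: "q > 1" "1 / p + 1 / q = 1" "(p - 1) * q = p" using assms by (auto simp: q_def divide_simps)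
  have "x * y powr (p - 1) \<le> x powr p / p + (y powr (p - 1)) powr q / q"
    using assms q by (intro Youngs_inequality) auto
  also have "(y powr (p - 1)) powr q / q = y powr p * (1 - 1 / p)"
    using q assms by (simp add: powr_powr) (simp add: q_def field_simps)
  finally have "p * (x * y powr (p - 1)) \<le> p * (x powr p / p + y powr p * (1 - 1 / p))"
    using assms by (intro mult_left_mono) auto
  also have "\<dots> = x powr p + (p - 1) * y powr p" using assms by (simp add: field_simps)
  finally have *: "p * (x * y powr (p - 1)) \<le> x powr p + (p - 1) * y powr p" .
  have "y powr (p - 1) * y = y powr p"
  proof (cases "y = 0")
    case False
    have "y powr (p - 1) * y powr 1 = y powr (p - 1 + 1)" by (rule powr_add[symmetric])
    then show ?thesis using assms by simp
  qed (use assms in auto)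
  then have "p * y powr (p - 1) * (x - y) = p * (x * y powr (p - 1)) - p * y powr p"
    by (simp add: algebra_simps)
  moreover have "(p - 1) * y powr p = p * y powr p - y powr p" by (simp add: left_diff_distrib)
  ultimately show ?thesis using * by linarith
qed

text \<open>The right-hand side is the maximum of the left-hand side over X >= 0, attained at X =
  ((p - 1) D / c)^(p - 1), so no constant is lost here.\<close>

lemma young_conjugate:
  fixes p q c X D :: real
  assumes p: "p > 1" and q: "q = p / (p - 1)" and c: "c > 0" and "X \<ge> 0" "D \<ge> 0"
  shows "p * X * D - c * X powr q \<le> ((p - 1) / c) powr (p - 1) * D powr p"
proof -
  have q1: "q > 1" "1 / p + 1 / q = 1" "p / q = p - 1" using p by (auto simp: q divide_simps)
  \<comment> \<open>Young's inequality is applied to k D and p X / k; \<open>k\<close> is fixed by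
    requiring that the second term (p X / k)^q / q be exactly c X^q.\<close>
  define k where "k = p / (c * q) powr (1 / q)"
  have cq: "c * q > 0" using c q1 by simp
  have k: "k > 0" using cq p q1 c by (simp add: k_def)
  have "(k * D) * (p * X / k) \<le> (k * D) powr p / p + (p * X / k) powr q / q"
    using p q1 k assms by (intro Youngs_inequality) auto
  also have "(k * D) * (p * X / k) = p * X * D" using k by simp
  also have "p * X / k = (c * q) powr (1 / q) * X" using p by (simp add: k_def)
  also have "((c * q) powr (1 / q) * X) powr q / q = c * X powr q"
    using assms cq q1 by (simp add: powr_mult powr_powr)
  also have "(k * D) powr p / p = ((p - 1) / c) powr (p - 1) * D powr p"
  proof -
    have "k powr p = p powr p / (c * q) powr (p - 1)"
      using p cq q1 by (simp add: k_def powr_divide powr_powr)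
    also have "p powr p = p * p powr (p - 1)" using p by (simp add: powr_mult_base)
    finally have "k powr p / p = p powr (p - 1) / (c * q) powr (p - 1)" using p by simp
    also have "\<dots> = (p / (c * q)) powr (p - 1)" using p cq by (simp add: powr_divide)
    also have "p / (c * q) = (p - 1) / c" using p c by (simp add: q)
    finally have "(k powr p / p) * D powr p = ((p - 1) / c) powr (p - 1) * D powr p" by simp
    then show ?thesis using k assms by (simp add: powr_mult)
  qed
  finally show ?thesis by simp
qed

lemma exp_minus_le_quadratic:
  fixes x :: real
  assumes "x \<ge> 0"
  shows "exp (- x) \<le> 1 - x + x\<^sup>2"
proof -
  have "exp (- x) \<le> 1 / (1 + x)"
    using assms exp_ge_add_one_self[of x] by (simp add: exp_minus divide_simps)
  also have "1 \<le> (1 - x + x\<^sup>2) * (1 + x)"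
    using assms by (simp add: algebra_simps power2_eq_square)
  then have "1 / (1 + x) \<le> 1 - x + x\<^sup>2" using assms by (simp add: divide_simps)
  finally show ?thesis .
qed

text \<open>
  The first-order expansion of the sup-convolution, uniform in bounded \<open>u\<close>, \<open>D\<close> and \<open>r\<close>. Restricting
  \<open>r\<close> to \<open>[0, \<rho>]\<close> makes the displacement \<open>t / (1 - t) * r\<close> small, so that no decay of the
  supremum at infinity has to be controlled.
\<close>

lemma hamilton_jacobi_pointwise:
  fixes p q c M L \<rho> e :: real
  assumes p: "p > 1" and q: "q = p / (p - 1)" and c: "c > 0"
    and M: "M \<ge> 0" and L: "L \<ge> 0" and \<rho>: "\<rho> \<ge> 0" and e: "e > 0"
  shows "\<exists>t0>0. t0 \<le> 1 / 2 \<and> (\<forall>t u D r. 0 < t \<longrightarrow> t < t0 \<longrightarrow> 0 \<le> u \<longrightarrow> u \<le> M \<longrightarrow> 0 \<le> D \<longrightarrow> D \<le> L \<longrightarrow> 0 \<le> r \<longrightarrow> r \<le> \<rho> \<longrightarrow>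
      (u + t / (1 - t) * r * D) powr p * exp (- (c * t * r powr q))
        \<le> u powr p + t * (((p - 1) / c) powr (p - 1) * D powr p + e))"
proof -
  have q1: "q > 1" "q * (p - 1) = p" using p by (auto simp: q divide_simps)
  \<comment> \<open>The modulus-of-continuity error enters as 2 p \<rho> L e1 and may use half of
    \<open>e\<close>. The summand 4 keeps the denominator positive when \<rho> L = 0.\<close>
  define e1 where "e1 = e / (4 * p * \<rho> * L + 4)"
  have pos: "4 * p * \<rho> * L \<ge> 0" using p \<rho> L by simp
  then have e1: "e1 > 0" using e by (simp add: e1_def add_nonneg_pos)
  have "(4 * p * \<rho> * L + 4) * e1 = e"
  proof -
    have "4 * p * \<rho> * L + 4 \<noteq> 0" using pos by linarith
    then show ?thesis by (simp add: e1_def)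
  qed
  then have e1': "2 * p * \<rho> * L * e1 \<le> e / 2" using e1 by (simp add: algebra_simps)
  have "uniformly_continuous_on {0..M + 1} (\<lambda>x::real. x powr (p - 1))"
    using p by (intro compact_uniformly_continuous continuous_on_powr' continuous_intros) auto
  then obtain d where d: "d > 0" "\<And>x y. x \<in> {0..M+1} \<Longrightarrow> y \<in> {0..M+1} \<Longrightarrow> dist y x < d \<Longrightarrow>
      dist (y powr (p - 1)) (x powr (p - 1)) < e1"
    using e1 unfolding uniformly_continuous_on_def by metis
  \<comment> \<open>\<open>A\<close> collects the coefficients of t^2: one from the quadratic
    remainder of exp, one from s - t = t s. The entries of \<open>t0\<close> below give s <= 2 t, t
    A <= e / 2, and a displacement effect \<open>a\<close> smaller than both d and 1.\<close>
  define A where "A = M powr p * (c * \<rho> powr q)\<^sup>2 + 2 * p * \<rho> * L * M powr (p - 1)"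
  have A: "A \<ge> 0" using p \<rho> L by (simp add: A_def)
  define t0 where "t0 = Min {1 / 2, e / (2 * (A + 1)), min d 1 / (2 * \<rho> * L + 1)}"
  have t0: "t0 > 0"
    using A e d \<rho> L by (auto simp: t0_def intro!: divide_pos_pos add_nonneg_pos)
  have t0': "t0 \<le> 1 / 2" "t0 \<le> e / (2 * (A + 1))" "t0 \<le> min d 1 / (2 * \<rho> * L + 1)"
    unfolding t0_def by (rule Min_le; simp)+
  note t0 = t0 t0'
  show ?thesis
  proof (intro exI conjI allI impI)
    show "t0 > 0" "t0 \<le> 1 / 2" by (rule t0)+
  next
    fix t u D r :: real
    assume t: "0 < t" "t < t0" and u: "0 \<le> u" "u \<le> M" and D: "0 \<le> D" "D \<le> L" and r: "0 \<le> r" "r \<le> \<rho>"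
    define s where "s = t / (1 - t)"
    have t2: "t < 1 / 2" using t t0 by linarith
    have s: "s \<ge> 0" "s \<le> 2 * t" using t t2 by (auto simp: s_def field_simps)
    have seq: "s = t + t * s" using t2 by (simp add: s_def field_simps)
    define a where "a = s * r * D"
    have rD: "r * D \<le> \<rho> * L" using r D by (intro mult_mono) auto
    have a0: "a \<ge> 0" using s r D by (simp add: a_def)
    have "s * (r * D) \<le> 2 * t * (\<rho> * L)" using s r D t rD by (intro mult_mono) auto
    then have "a \<le> 2 * t * (\<rho> * L)" by (simp add: a_def mult.assoc)
    also have "\<dots> \<le> t * (2 * \<rho> * L + 1)" using t by (simp add: algebra_simps)
    also have "\<dots> < t0 * (2 * \<rho> * L + 1)" using t \<rho> L by (intro mult_strict_right_mono) (auto intro: add_nonneg_pos)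
    also have "\<dots> \<le> min d 1" 
    proof -
      have "2 * \<rho> * L + 1 > 0" using \<rho> L by (intro add_nonneg_pos) auto
      then show ?thesis using t0(4) by (simp add: pos_le_divide_eq)
    qed
    finally have a1: "a < d" "a < 1" by auto
    have uc: "(u + a) powr (p - 1) \<le> u powr (p - 1) + e1"
      using d(2)[of u "u + a"] u a0 a1 M by (auto simp: dist_real_def abs_le_iff)
    have "(u + a) powr p \<le> u powr p + p * a * (u + a) powr (p - 1)"
      using powr_tangent[of p u "u + a"] p u a0 by (simp add: algebra_simps)
    also have "\<dots> \<le> u powr p + p * a * (u powr (p - 1) + e1)"
      using p a0 uc by (intro add_left_mono mult_left_mono) auto
    finally have step1: "(u + a) powr p \<le> u powr p + p * a * (u powr (p - 1) + e1)" .
    define x where "x = c * t * r powr q"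
    have x: "x \<ge> 0" using c t by (simp add: x_def)
    have rq: "r powr q \<le> \<rho> powr q" using r q1 by (intro powr_mono2) auto
    have x2: "x\<^sup>2 \<le> t\<^sup>2 * (c * \<rho> powr q)\<^sup>2"
    proof -
      have "x \<le> t * (c * \<rho> powr q)" using mult_left_mono[OF rq, of "c * t"] c t by (simp add: x_def mult_ac)
      then have "x\<^sup>2 \<le> (t * (c * \<rho> powr q))\<^sup>2" using x by (intro power_mono) auto
      then show ?thesis by (simp add: power_mult_distrib)
    qed
    have "(u + a) powr p * exp (- x) \<le> (u powr p + p * a * (u powr (p - 1) + e1)) * exp (- x)"
      using step1 by (intro mult_right_mono) auto
    also have "\<dots> = u powr p * exp (- x) + p * a * (u powr (p - 1) + e1) * exp (- x)"
      by (simp add: distrib_right)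
    also have "\<dots> \<le> u powr p * (1 - x + x\<^sup>2) + p * a * (u powr (p - 1) + e1) * 1"
      using x p a0 e1 by (intro add_mono mult_left_mono exp_minus_le_quadratic) auto
    \<comment> \<open>Put X = r u^(p - 1). Since q (p - 1) = p, X^q = r^q u^p, so the part linear in
      t is p X D - c X^q, the form that \<open>young_conjugate\<close> bounds.\<close>
    also have "\<dots> = u powr p + t * (p * (r * u powr (p - 1)) * D - c * (r * u powr (p - 1)) powr q)
        + u powr p * x\<^sup>2 + (t * s * p * (r * D) * u powr (p - 1) + s * p * (r * D) * e1)"
    proof -
      have e1: "(r * u powr (p - 1)) powr q = r powr q * u powr p"
        using r u q1 by (simp add: powr_mult powr_powr mult.commute)
      have "p * a * (u powr (p - 1) + e1) = p * (s * (r * D * u powr (p - 1))) + s * p * (r * D) * e1"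
        by (simp add: a_def algebra_simps)
      also have "s * (r * D * u powr (p - 1)) = (t + t * s) * (r * D * u powr (p - 1))"
        using seq by simp
      finally show ?thesis unfolding e1 x_def by (simp add: algebra_simps)
    qed
    also have "\<dots> \<le> u powr p + t * (((p - 1) / c) powr (p - 1) * D powr p)
        + M powr p * (t\<^sup>2 * (c * \<rho> powr q)\<^sup>2) + (t * (2 * t) * p * (\<rho> * L) * M powr (p - 1) + (2 * t) * p * (\<rho> * L) * e1)"
      using p c r D s t u e1 rD x2
      by (intro add_mono mult_left_mono young_conjugate[OF p q c] mult_mono powr_mono2) auto
    also have "\<dots> = u powr p + t * (((p - 1) / c) powr (p - 1) * D powr p) + t * (t * A + 2 * p * \<rho> * L * e1)"
      by (simp add: A_def algebra_simps power2_eq_square)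
    also have "\<dots> \<le> u powr p + t * (((p - 1) / c) powr (p - 1) * D powr p) + t * e"
    proof -
      have "t * A \<le> t0 * (A + 1)" using t A by (intro mult_mono) auto
      also have "\<dots> \<le> e / 2" using t0(3) A by (simp add: field_simps)
      finally show ?thesis using e1' t by (intro add_left_mono mult_left_mono) auto
    qed
    finally show "(u + t / (1 - t) * r * D) powr p * exp (- (c * t * r powr q))
        \<le> u powr p + t * (((p - 1) / c) powr (p - 1) * D powr p + e)"
      by (simp add: a_def s_def x_def algebra_simps)
  qed
qed

lemma integrable_bounded_support:
  fixes f :: "'a::euclidean_space \<Rightarrow> real"
  assumes "f \<in> borel_measurable borel" "\<And>x. \<bar>f x\<bar> \<le> B" "\<And>x. f x \<noteq> 0 \<Longrightarrow> norm x \<le> R"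
  shows "integrable lborel f"
proof (rule Bochner_Integration.integrable_bound)
  have "emeasure lborel (cball (0::'a) R) < \<infinity>" by (rule emeasure_bounded_finite[OF bounded_cball])
  then show "integrable lborel (\<lambda>x::'a. indicator (cball 0 R) x *\<^sub>R B)"
    by (intro integrable_real_indicator[THEN integrable_scaleR_left]) auto
  show "AE x in lborel. norm (f x) \<le> norm (indicator (cball 0 R) x *\<^sub>R B)"
  proof (intro AE_I2)
    fix x show "norm (f x) \<le> norm (indicator (cball 0 R) x *\<^sub>R B)"
      using assms(2)[of x] assms(3)[of x] by (cases "f x = 0") (auto simp: indicator_def)
  qed
qed (use assms in auto)

text \<open>Jensen's inequality for s^(-b) under the probability density u^p / P, applied to u^(1 -
  p), whose mean is m / P. The exponent b = q t / (1 - t) is forced by p + b (p - 1) = p / (1 -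
  t).\<close>

lemma powr_integral_lower:
  fixes u :: "'a::euclidean_space \<Rightarrow> real" and p q t :: real
  assumes p: "p > 1" and q: "q = p / (p - 1)" and t: "0 < t" "t < 1"
    and [measurable]: "u \<in> borel_measurable borel" and u: "\<And>x. 0 \<le> u x" "\<And>x. u x \<le> M" "\<And>x. u x \<noteq> 0 \<Longrightarrow> norm x \<le> R"
    and P: "(\<integral>x. u x powr p \<partial>lborel) > 0"
  shows "(\<integral>x. u x \<partial>lborel) > 0"
    "(\<integral>x. u x powr p \<partial>lborel) * ((\<integral>x. u x \<partial>lborel) / (\<integral>x. u x powr p \<partial>lborel)) powr (- (q * t / (1 - t)))
       \<le> (\<integral>x. u x powr (p / (1 - t)) \<partial>lborel)"
proof -
  define P where "P = (\<integral>x. u x powr p \<partial>lborel)"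
  define m where "m = (\<integral>x. u x \<partial>lborel)"
  have int: "integrable lborel (\<lambda>x. u x powr a)" if "a > 0" for a
    using u that by (intro integrable_bounded_support[where B="M powr a" and R=R]) (auto intro: powr_mono2)
  have int1: "integrable lborel u"
    using u by (intro integrable_bounded_support[where B="M" and R=R]) auto
  show m: "(\<integral>x. u x \<partial>lborel) > 0"
  proof (rule ccontr)
    assume "\<not> ?thesis"
    moreover have "(\<integral>x. u x \<partial>lborel) \<ge> 0" using u by simp
    ultimately have "(\<integral>x. u x \<partial>lborel) = 0" by simp
    then have "AE x in lborel. u x = 0" using integral_nonneg_eq_0_iff_AE[OF int1] u by auto
    then have "(\<integral>x. u x powr p \<partial>lborel) = (\<integral>x. 0 \<partial>(lborel::'a measure))"
      by (intro integral_cong_AE) auto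
    then show False using P by simp
  qed
  define b where "b = q * t / (1 - t)"
  have q1: "q > 1" using p by (simp add: q divide_simps)
  have b: "b > 0" using q1 t by (simp add: b_def)
  have "q * (p - 1) = p" using p by (simp add: q)
  then have "b * (p - 1) = p * t / (1 - t)" by (simp add: b_def mult.assoc[symmetric] mult_ac)
  then have bp: "p + b * (p - 1) = p / (1 - t)" using t by (simp add: field_simps)
  define y where "y = m / P"
  have y: "y > 0" using m P by (simp add: y_def m_def P_def)
  \<comment> \<open>tangent line of the convex function \<open>s \<mapsto> s powr (- b)\<close> at \<open>y\<close>, evaluated at \<open>s = u x powr (1 - p)\<close> and multiplied by \<open>u x powr p\<close>\<close>
  have pt: "y powr (- b) * ((1 + b) * u x powr p - b * u x / y) \<le> u x powr (p / (1 - t))" for x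
  proof (cases "u x = 0")
    case True
    then show ?thesis by simp
  next
    case False
    then have ux: "u x > 0" using u(1)[of x] by linarith
    define z where "z = u x powr (1 - p) / y"
    have z: "z > 0" using ux y by (simp add: z_def)
    have "1 + b - b * z \<le> 1 - b * ln z" using ln_le_minus_one[OF z] b mult_left_mono[of "ln z" "z - 1" b] by (simp add: algebra_simps)
    also have "\<dots> \<le> exp (- (b * ln z))" using exp_ge_add_one_self[of "- (b * ln z)"] by simp
    also have "\<dots> = z powr (- b)" using z by (simp add: powr_def)
    finally have "(y powr (- b) * u x powr p) * (1 + b - b * z) \<le> (y powr (- b) * u x powr p) * z powr (- b)"
      by (intro mult_left_mono) auto
    also have "z powr (- b) = u x powr (b * (p - 1)) / y powr (- b)"
      using ux y by (simp add: z_def powr_divide powr_powr algebra_simps)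
    also have "(y powr (- b) * u x powr p) * (u x powr (b * (p - 1)) / y powr (- b)) = u x powr (p / (1 - t))"
      using y by (simp flip: powr_add bp)
    also have "(y powr (- b) * u x powr p) * (1 + b - b * z) = y powr (- b) * ((1 + b) * u x powr p - b * (u x powr p * u x powr (1 - p)) / y)"
      by (simp add: z_def algebra_simps)
    also have "u x powr p * u x powr (1 - p) = u x" using ux by (simp flip: powr_add)
    finally show ?thesis .
  qed
  have "P * y powr (- b) = y powr (- b) * ((1 + b) * P - b * m / y)"
    using m P by (simp add: y_def m_def P_def field_simps)
  also have "\<dots> = (\<integral>x. y powr (- b) * ((1 + b) * u x powr p - b * u x / y) \<partial>lborel)"
    using int[of p] int1 p by (simp add: P_def m_def)
  also have "\<dots> \<le> (\<integral>x. u x powr (p / (1 - t)) \<partial>lborel)"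
    using int[of p] int1 p t by (intro integral_mono pt int) auto
  finally show "(\<integral>x. u x powr p \<partial>lborel) * ((\<integral>x. u x \<partial>lborel) / (\<integral>x. u x powr p \<partial>lborel)) powr (- (q * t / (1 - t)))
       \<le> (\<integral>x. u x powr (p / (1 - t)) \<partial>lborel)" by (simp add: y_def b_def m_def P_def)
qed

text \<open>
  Here \<open>D\<close> stands for \<open>\<bar>\<nabla>u\<bar>\<close>. Only the one-sided uniform Lipschitz bound is needed, and it survives
  the truncation \<open>max 0 (u - \<epsilon>)\<close>, which differentiability would not.
\<close>

lemma log_sobolev_nash_truncated:
  fixes u D :: "'a::euclidean_space \<Rightarrow> real" and p q c :: real
  assumes p: "p > 1" and q: "q = p / (p - 1)" and c: "c > 0"
    and [measurable]: "u \<in> borel_measurable borel" and u: "\<And>x. 0 \<le> u x" "\<And>x. u x \<le> M" "\<And>x. u x \<noteq> 0 \<Longrightarrow> norm x \<le> R"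
    and [measurable]: "D \<in> borel_measurable borel" and D: "\<And>x. 0 \<le> D x" "\<And>x. D x \<le> L"
    and lip: "\<And>\<eta>. \<eta> > 0 \<Longrightarrow> \<exists>r>0. \<forall>z w. norm w \<le> r \<longrightarrow> u (z + w) \<le> u z + norm w * (D z + \<eta>)"
    and P: "(\<integral>x. u x powr p \<partial>lborel) > 0"
    and N: "(\<integral>\<^sup>+x. ennreal (D x powr p) \<partial>lborel) \<le> ennreal N" "N \<ge> 0"
    and R: "R \<ge> 0" and \<rho>: "\<rho> > 0" and e: "e > 0"
    and Z: "Z > 0" "(\<integral>\<^sup>+(y::'a). ennreal (exp (- (c * norm y powr q))) * indicator (cball 0 \<rho>) y \<partial>lborel) = ennreal Z"
  shows "DIM('a) + (q - 1) * ln (\<integral>x. u x powr p \<partial>lborel) - q * ln (\<integral>x. u x \<partial>lborel) + ln Z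
     \<le> (((p - 1) / c) powr (p - 1) * N + e) / (\<integral>x. u x powr p \<partial>lborel)"
proof -
  define P where "P = (\<integral>x. u x powr p \<partial>lborel)"
  define m where "m = (\<integral>x. u x \<partial>lborel)"
  define K where "K = ((p - 1) / c) powr (p - 1)"
  \<comment> \<open>The displacement t / (1 - t) y will have norm at most 1, so the relevant points
    stay within R + 1. Cutting \<open>W\<close> off there makes its constant error terms
    integrable.\<close>
  define B where "B = cball (0::'a) (R + 1)"
  define \<mu> where "\<mu> = measure lborel B"
  let ?n = "DIM('a)"
  have K: "K \<ge> 0" by (simp add: K_def)
  have P0: "P > 0" using P by (simp add: P_def)
  have M: "M \<ge> 0" using u(1,2) order_trans by blast
  have L: "L \<ge> 0" using D(1,2) order_trans by blast
  have \<mu>: "emeasure lborel B = ennreal \<mu>" "\<mu> \<ge> 0"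
    unfolding \<mu>_def B_def using emeasure_bounded_finite[OF bounded_cball, of "0::'a" "R + 1"]
    by (auto simp: emeasure_eq_ennreal_measure)
  \<comment> \<open>\<open>C * \<eta>\<close> bounds K ((D + \<eta>)^p - D^p), by the tangent at D +
    \<eta> <= L + 1. The errors \<eta> C \<mu> and e' \<mu> take e / 2 each.\<close>
  define C where "C = K * (p * (L + 1) powr (p - 1))"
  have C: "C \<ge> 0" using K p by (simp add: C_def)
  define \<eta> where "\<eta> = min 1 (e / (2 * (C * \<mu> + 1)))"
  have C1: "C * \<mu> + 1 > 0" using C \<mu> by (intro add_nonneg_pos) auto
  have \<eta>: "\<eta> > 0" "\<eta> \<le> 1" "\<eta> \<le> e / (2 * (C * \<mu> + 1))" using e C1 by (auto simp: \<eta>_def)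
  have "\<eta> * (C * \<mu>) \<le> \<eta> * (C * \<mu> + 1)" using \<eta> by (intro mult_left_mono) auto
  also have "\<dots> \<le> e / 2" using \<eta>(3) C1 by (simp add: pos_le_divide_eq mult_ac)
  finally have \<eta>C: "\<eta> * C * \<mu> \<le> e / 2" by (simp add: mult_ac)
  define e' where "e' = e / (2 * (\<mu> + 1))"
  have e': "e' > 0" "e' * \<mu> \<le> e / 2" using e \<mu> by (auto simp: e'_def field_simps)
  obtain r where r: "r > 0" "\<And>z w. norm w \<le> r \<Longrightarrow> u (z + w) \<le> u z + norm w * (D z + \<eta>)"
    using lip[OF \<eta>(1)] by blast
  have L1: "L + 1 \<ge> 0" using L by simp
  obtain t0 where t0: "t0 > 0" "t0 \<le> 1 / 2"
    and HJ: "\<forall>t u D r. 0 < t \<longrightarrow> t < t0 \<longrightarrow> 0 \<le> u \<longrightarrow> u \<le> M \<longrightarrow> 0 \<le> D \<longrightarrow> D \<le> L + 1 \<longrightarrow> 0 \<le> r \<longrightarrow> r \<le> \<rho> \<longrightarrow>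
      (u + t / (1 - t) * r * D) powr p * exp (- (c * t * r powr q))
        \<le> u powr p + t * (((p - 1) / c) powr (p - 1) * D powr p + e')"
    using hamilton_jacobi_pointwise[OF p q c M L1 less_imp_le[OF \<rho>] e'(1)] by (elim exE conjE)
  \<comment> \<open>Halving \<open>t0\<close> gives the strict bound t < t0; the second entry makes
    s \<rho> <= 2 t \<rho> <= min r 1.\<close>
  define t where "t = min (t0 / 2) (min r 1 / (2 * \<rho>))"
  have t: "0 < t" using t0 r \<rho> by (simp add: t_def)
  have "t \<le> t0 / 2" by (simp add: t_def)
  then have "t < t0" "t < 1" using t0 by auto
  note t = t this
  define s where "s = t / (1 - t)"
  have s: "s > 0" using t by (simp add: s_def)
  have t2: "t < 1 / 2" using t t0 by linarith
  have "s \<le> 2 * t" using t t2 by (simp add: s_def field_simps)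
  then have "s * \<rho> \<le> 2 * t * \<rho>" using \<rho> by (intro mult_right_mono) auto
  also have "\<dots> \<le> min r 1"
  proof -
    have "t \<le> min r 1 / (2 * \<rho>)" by (simp add: t_def)
    then show ?thesis using \<rho> by (simp add: pos_le_divide_eq mult_ac)
  qed
  finally have s\<rho>: "s * \<rho> \<le> r" "s * \<rho> \<le> 1" by auto
  define V where "V y = exp (- (c * norm y powr q)) * indicator (cball 0 \<rho>) y" for y :: 'a
  \<comment> \<open>An explicit majorant of the sup-convolution instead of the supremum itself, so
    that measurability is immediate.\<close>
  define W where "W z = ennreal (u z powr p + t * (K * (D z + \<eta>) powr p + e')) * indicator B z" for z
  have [measurable]: "B \<in> sets borel" "cball (0::'a) \<rho> \<in> sets borel" by (auto simp: B_def)
  have [measurable]: "V \<in> borel_measurable borel" unfolding V_def[abs_def] by measurable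
  have [measurable]: "W \<in> borel_measurable borel" unfolding W_def[abs_def] by measurable
  define J where "J = (\<integral>x. u x powr (p / (1 - t)) \<partial>lborel)"
  have J0: "J \<ge> 0" by (simp add: J_def)
  have intp: "integrable lborel (\<lambda>x. u x powr a)" if "a > 0" for a
    using u that by (intro integrable_bounded_support[where B="M powr a" and R=R]) (auto intro: powr_mono2)
  have pt: "p / (1 - t) > 0" using p t by simp
  have "ennreal (enn2real (\<integral>\<^sup>+x. ennreal (u x powr (p / (1 - t))) \<partial>lborel) powr (1 - t) * enn2real (\<integral>\<^sup>+x. ennreal (V x) \<partial>lborel) powr t)
     \<le> ennreal (1 - t) ^ ?n * (\<integral>\<^sup>+x. W x \<partial>lborel)"
  proof (rule prekopa_leindler)
    fix x :: 'a
    have "u x powr (p / (1 - t)) \<le> M powr (p / (1 - t))" using u pt by (intro powr_mono2) auto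
    then show "u x powr (p / (1 - t)) \<le> max (M powr (p / (1 - t))) 1" by simp
    have "V x \<le> 1" using c by (simp add: V_def indicator_def)
    then show "V x \<le> max (M powr (p / (1 - t))) 1" by simp
    show "norm x \<le> max R \<rho>" if "u x powr (p / (1 - t)) \<noteq> 0" using u(3)[of x] that by fastforce
    show "norm x \<le> max R \<rho>" if "V x \<noteq> 0" using that by (auto simp: V_def indicator_def split: if_splits)
  next
    fix x y :: 'a
    define z where "z = x + (t / (1 - t)) *\<^sub>R y"
    show "ennreal ((u x powr (p / (1 - t))) powr (1 - t) * V y powr t) \<le> W (x + (t / (1 - t)) *\<^sub>R y)"
    proof (cases "u x = 0 \<or> norm y > \<rho>")
      case True
      then show ?thesis using pt t by (auto simp: V_def)
    next
      case False
      then have y: "norm y \<le> \<rho>" and x: "norm x \<le> R" using u(3)[of x] by auto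
      have sy: "s * norm y \<le> s * \<rho>" using y s by simp
      have "norm z \<le> norm x + s * norm y" unfolding z_def s_def[symmetric]
        using s norm_triangle_ineq[of x "s *\<^sub>R y"] by simp
      then have "norm z \<le> R + 1" using x sy s\<rho>(2) by linarith
      then have zB: "z \<in> B" by (simp add: B_def)
      \<comment> \<open>The Taylor bound is based at the arrival point \<open>z\<close>, so that
        \<open>D\<close> is evaluated at the argument of \<open>W\<close>.\<close>
      have "u x = u (z + (- s) *\<^sub>R y)" by (simp add: z_def s_def)
      also have "\<dots> \<le> u z + norm ((- s) *\<^sub>R y) * (D z + \<eta>)" 
      proof (rule r)
        have "norm ((- s) *\<^sub>R y) = s * norm y" using s by simp
        then show "norm ((- s) *\<^sub>R y) \<le> r" using sy s\<rho>(1) by linarith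
      qed
      also have "\<dots> = u z + t / (1 - t) * norm y * (D z + \<eta>)" using t by (simp add: s_def)
      finally have "u x powr p \<le> (u z + t / (1 - t) * norm y * (D z + \<eta>)) powr p"
        using u p by (intro powr_mono2) auto
      then have "u x powr p * exp (- (c * t * norm y powr q))
        \<le> (u z + t / (1 - t) * norm y * (D z + \<eta>)) powr p * exp (- (c * t * norm y powr q))"
        by (rule mult_right_mono) auto
      also have "\<dots> \<le> u z powr p + t * (K * (D z + \<eta>) powr p + e')"
        unfolding K_def using t u[of z] D[of z] \<eta> y by (intro HJ[rule_format]) auto
      also have "u x powr p * exp (- (c * t * norm y powr q)) = (u x powr (p / (1 - t))) powr (1 - t) * V y powr t"
        using t y by (simp add: powr_powr V_def powr_def mult_ac)
      finally show ?thesis using zB by (simp add: W_def z_def ennreal_leI)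
    qed
  qed (use t R \<rho> in \<open>auto simp: V_def\<close>)
  also have "(\<integral>\<^sup>+x. ennreal (u x powr (p / (1 - t))) \<partial>lborel) = ennreal J"
    unfolding J_def using intp[OF pt] by (intro nn_integral_eq_integral) auto
  also have "(\<integral>\<^sup>+x. ennreal (V x) \<partial>lborel) = ennreal Z"
    unfolding Z(2)[symmetric] V_def by (intro nn_integral_cong) (auto simp: indicator_def)
  also have "(\<integral>\<^sup>+x. W x \<partial>lborel) \<le> ennreal (P + t * (K * N + e))"
  proof -
    have "(\<integral>\<^sup>+x. W x \<partial>lborel) \<le> (\<integral>\<^sup>+x. ennreal (u x powr p) + ennreal (t * K) * ennreal (D x powr p) + ennreal (t * (\<eta> * C + e')) * indicator B x \<partial>lborel)"
    proof (intro nn_integral_mono)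
      fix x
      have "(D x + \<eta>) powr p \<le> D x powr p + p * (D x + \<eta>) powr (p - 1) * \<eta>"
        using powr_tangent[of p "D x" "D x + \<eta>"] p D[of x] \<eta> by simp
      also have "\<dots> \<le> D x powr p + p * (L + 1) powr (p - 1) * \<eta>"
        using D[of x] \<eta> p by (intro add_left_mono mult_right_mono mult_left_mono powr_mono2) auto
      finally have "t * (K * (D x + \<eta>) powr p + e') \<le> t * (K * (D x powr p + p * (L + 1) powr (p - 1) * \<eta>) + e')"
        using t K by (intro mult_left_mono add_right_mono) auto
      then have "u x powr p + t * (K * (D x + \<eta>) powr p + e') \<le> u x powr p + t * K * D x powr p + t * (\<eta> * C + e')"
        by (simp add: C_def algebra_simps)
      then have "ennreal (u x powr p + t * (K * (D x + \<eta>) powr p + e')) \<le> ennreal (u x powr p + t * K * D x powr p + t * (\<eta> * C + e'))"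
        by (rule ennreal_leI)
      also have "\<dots> = ennreal (u x powr p) + ennreal (t * K) * ennreal (D x powr p) + ennreal (t * (\<eta> * C + e'))"
        using t K \<eta> C e' by (simp add: ennreal_mult)
      finally show "W x \<le> ennreal (u x powr p) + ennreal (t * K) * ennreal (D x powr p) + ennreal (t * (\<eta> * C + e')) * indicator B x"
        by (auto simp: W_def indicator_def)
    qed
    also have "\<dots> = (\<integral>\<^sup>+x. ennreal (u x powr p) \<partial>lborel) + ennreal (t * K) * (\<integral>\<^sup>+x. ennreal (D x powr p) \<partial>lborel) + ennreal (t * (\<eta> * C + e')) * emeasure lborel B"
      by (simp add: nn_integral_add nn_integral_cmult nn_integral_cmult_indicator)
    also have "\<dots> \<le> ennreal P + ennreal (t * K) * ennreal N + ennreal (t * (\<eta> * C + e')) * ennreal \<mu>"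
    proof (intro add_mono mult_left_mono N)
      show "(\<integral>\<^sup>+x. ennreal (u x powr p) \<partial>lborel) \<le> ennreal P"
        unfolding P_def using p by (subst nn_integral_eq_integral[OF intp]) auto
    qed (use \<mu> in auto)
    also have "\<dots> = ennreal (P + t * (K * N) + t * ((\<eta> * C + e') * \<mu>))"
      using P0 t K N \<eta> C e' \<mu> by (simp add: ennreal_mult[symmetric] mult.assoc)
    also have "\<dots> \<le> ennreal (P + t * (K * N + e))"
    proof (rule ennreal_leI)
      have "(\<eta> * C + e') * \<mu> \<le> e" using \<eta>C e' by (simp add: distrib_right)
      then have "t * ((\<eta> * C + e') * \<mu>) \<le> t * e" using t by (intro mult_left_mono) auto
      then show "P + t * (K * N) + t * ((\<eta> * C + e') * \<mu>) \<le> P + t * (K * N + e)" by (simp add: distrib_left)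
    qed
    finally show ?thesis .
  qed
  finally have "ennreal (enn2real (ennreal J) powr (1 - t) * enn2real (ennreal Z) powr t)
      \<le> ennreal (1 - t) ^ ?n * ennreal (P + t * (K * N + e))"
    by (simp add: mult_left_mono)
  also have "\<dots> = ennreal ((1 - t) ^ ?n * (P + t * (K * N + e)))"
    using t P0 K N e by (simp add: ennreal_mult ennreal_power)
  finally have main: "J powr (1 - t) * Z powr t \<le> (1 - t) ^ ?n * (P + t * (K * N + e))"
    using J0 Z t P0 K N e by (simp add: ennreal_le_iff)
  have m0: "m > 0" and JP: "P * (m / P) powr (- (q * t / (1 - t))) \<le> J"
    unfolding m_def P_def J_def using powr_integral_lower[OF p q t(1,3) _ u P] by auto
  have E: "K * N + e > 0" using K N e by (intro add_nonneg_pos) auto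
  have low: "P * (m / P) powr (- (q * t / (1 - t))) > 0" using P0 m0 by simp
  then have J1: "J > 0" using JP by linarith
  \<comment> \<open>From here on everything is in logarithms: the zeroth-order terms ln P of the two
    sides cancel, and what remains is divisible by t.\<close>
  have "ln P - q * t / (1 - t) * (ln m - ln P) = ln (P * (m / P) powr (- (q * t / (1 - t))))"
    using P0 m0 by (simp add: ln_mult ln_powr ln_div)
  also have "\<dots> \<le> ln J" using JP low J1 by simp
  finally have "(1 - t) * (ln P - q * t / (1 - t) * (ln m - ln P)) \<le> (1 - t) * ln J"
    using t by (intro mult_left_mono) auto
  moreover have "(1 - t) * (ln P - q * t / (1 - t) * (ln m - ln P)) = (1 - t) * ln P - q * t * (ln m - ln P)"
    using t by (simp add: right_diff_distrib)
  ultimately have lnJ: "(1 - t) * ln P - q * t * (ln m - ln P) \<le> (1 - t) * ln J" by simp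
  have tE: "t * (K * N + e) > 0" using t E by simp
  have "(1 - t) * ln J + t * ln Z = ln (J powr (1 - t) * Z powr t)"
    using J1 Z by (simp add: ln_mult ln_powr)
  also have "\<dots> \<le> ln ((1 - t) ^ ?n * (P + t * (K * N + e)))"
    using main J1 Z P0 tE t by (subst ln_le_cancel_iff) (auto intro!: mult_pos_pos add_pos_pos)
  also have "\<dots> = ?n * ln (1 - t) + ln (P + t * (K * N + e))"
    using t P0 tE by (simp add: ln_mult ln_realpow add_pos_pos)
  also have "ln (P + t * (K * N + e)) = ln P + ln (1 + t * (K * N + e) / P)"
  proof -
    have "P + t * (K * N + e) = P * (1 + t * (K * N + e) / P)" using P0 by (simp add: field_simps)
    moreover have "1 + t * (K * N + e) / P > 0" using P0 tE by (intro add_pos_pos) auto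
    ultimately show ?thesis using P0 by (simp add: ln_mult)
  qed
  also have "ln (1 + t * (K * N + e) / P) \<le> t * (K * N + e) / P"
    using P0 tE by (intro ln_add_one_self_le_self) auto
  finally have "(1 - t) * ln J + t * ln Z \<le> ?n * ln (1 - t) + (ln P + t * (K * N + e) / P)" by simp
  moreover have "?n * ln (1 - t) \<le> ?n * (- t)"
    using t ln_le_minus_one[of "1 - t"] by (intro mult_left_mono) auto
  ultimately have "t * (?n + (q - 1) * ln P - q * ln m + ln Z) \<le> t * ((K * N + e) / P)"
    using lnJ by (simp add: algebra_simps)
  then have "?n + (q - 1) * ln P - q * ln m + ln Z \<le> (K * N + e) / P"
    using t(1) by (simp only: mult_le_cancel_left_pos)
  then show ?thesis by (simp only: P_def m_def K_def)
qed

text \<open>Removes the cut-off radius and the error \<open>e\<close>. A violation by d > 0 is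
  refuted with a ball carrying more than the fraction exp (-d / 2) of the mass Z and with the error
  d P / 2: the ball costs less than d / 2 and the error exactly d / 2.\<close>

lemma log_sobolev_nash:
  fixes u D :: "'a::euclidean_space \<Rightarrow> real" and p q c :: real
  assumes p: "p > 1" and q: "q = p / (p - 1)" and c: "c > 0"
    and [measurable]: "u \<in> borel_measurable borel" and u: "\<And>x. 0 \<le> u x" "\<And>x. u x \<le> M" "\<And>x. u x \<noteq> 0 \<Longrightarrow> norm x \<le> R"
    and [measurable]: "D \<in> borel_measurable borel" and D: "\<And>x. 0 \<le> D x" "\<And>x. D x \<le> L"
    and lip: "\<And>\<eta>. \<eta> > 0 \<Longrightarrow> \<exists>r>0. \<forall>z w. norm w \<le> r \<longrightarrow> u (z + w) \<le> u z + norm w * (D z + \<eta>)"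
    and P: "(\<integral>x. u x powr p \<partial>lborel) > 0"
    and N: "(\<integral>\<^sup>+x. ennreal (D x powr p) \<partial>lborel) \<le> ennreal N" "N \<ge> 0"
    and R: "R \<ge> 0"
  shows "DIM('a) + (q - 1) * ln (\<integral>x. u x powr p \<partial>lborel) - q * ln (\<integral>x. u x \<partial>lborel)
       + ln (c powr (- (DIM('a) / q)) * unit_ball_vol DIM('a) * Gamma (DIM('a) / q + 1))
     \<le> ((p - 1) / c) powr (p - 1) * N / (\<integral>x. u x powr p \<partial>lborel)"
proof -
  define P where "P = (\<integral>x. u x powr p \<partial>lborel)"
  define Z where "Z = c powr (- (DIM('a) / q)) * unit_ball_vol DIM('a) * Gamma (DIM('a) / q + 1)"
  define A where "A = DIM('a) + (q - 1) * ln P - q * ln (\<integral>x. u x \<partial>lborel)"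
  define K where "K = ((p - 1) / c) powr (p - 1)"
  have P0: "P > 0" using P by (simp add: P_def)
  have q0: "q > 0" using p by (simp add: q)
  have Z0: "Z > 0" using c q0 by (auto simp: Z_def intro!: mult_pos_pos Gamma_real_pos add_pos_pos divide_pos_pos)
  have "A + ln Z \<le> K * N / P"
  proof (rule ccontr)
    assume neg: "\<not> ?thesis"
    define d where "d = A + ln Z - K * N / P"
    have d: "d > 0" using neg by (simp add: d_def)
    have "Z * exp (- d / 2) < Z" using d Z0 by simp
    then have "ennreal (Z * exp (- d / 2)) < (\<integral>\<^sup>+(y::'a). ennreal (exp (- (c * norm y powr q))) \<partial>lborel)"
      unfolding nn_integral_exp_norm_powr[OF c q0] Z_def[symmetric] using Z0 by (simp add: ennreal_less_iff)
    then obtain r where r: "r > 0" "ennreal (Z * exp (- d / 2)) <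
        (\<integral>\<^sup>+(y::'a). ennreal (exp (- (c * norm y powr q))) * indicator (cball 0 r) y \<partial>lborel)" (is "_ < ?I")
      by (rule nn_integral_exhaust_cball[rotated]) auto
    have "?I \<le> (\<integral>\<^sup>+(y::'a). ennreal (exp (- (c * norm y powr q))) \<partial>lborel)"
      by (intro nn_integral_mono) (auto simp: indicator_def)
    also have "\<dots> < top" by (subst nn_integral_exp_norm_powr[OF c q0]) auto
    finally have "?I < top" .
    then obtain Y where Y: "?I = ennreal Y" "Y \<ge> 0" by (cases ?I) auto
    have "Z * exp (- d / 2) < Y" using r(2) Z0 unfolding Y(1) by (simp add: ennreal_less_iff)
    moreover have "Z * exp (- d / 2) > 0" using Z0 by simp
    ultimately have Y0: "Y > 0" and "ln (Z * exp (- d / 2)) < ln Y" by auto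
    then have lnY: "ln Z - d / 2 < ln Y" using Z0 by (simp add: ln_mult)
    have "A + ln Y \<le> (K * N + d * P / 2) / P"
      unfolding A_def P_def K_def
    proof (rule log_sobolev_nash_truncated[OF p q c _ u _ D lip P N R r(1) _ Y0 Y(1)])
      show "0 < d * (\<integral>x. u x powr p \<partial>lborel) / 2" using d P by simp
    qed auto
    also have "\<dots> = K * N / P + d / 2" using P0 by (simp add: add_divide_distrib)
    finally show False using lnY by (simp add: d_def field_simps)
  qed
  then show ?thesis by (simp only: A_def Z_def P_def K_def)
qed

text \<open>Up to constants the upper bound, as a function of k, is k N / P - (n / p) ln k, minimal
  at k = n P / (p N); this is why N > 0 is assumed. The gradient term then becomes the constant n /
  p, and the dependence on N survives through ln k.\<close>

theorem nash_regular:
  fixes u D :: "'a::euclidean_space \<Rightarrow> real" and p q :: real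
  assumes p: "p > 1" and q: "q = p / (p - 1)"
    and [measurable]: "u \<in> borel_measurable borel" and u: "\<And>x. 0 \<le> u x" "\<And>x. u x \<le> M" "\<And>x. u x \<noteq> 0 \<Longrightarrow> norm x \<le> R"
    and [measurable]: "D \<in> borel_measurable borel" and D: "\<And>x. 0 \<le> D x" "\<And>x. D x \<le> L"
    and lip: "\<And>\<eta>. \<eta> > 0 \<Longrightarrow> \<exists>r>0. \<forall>z w. norm w \<le> r \<longrightarrow> u (z + w) \<le> u z + norm w * (D z + \<eta>)"
    and P: "(\<integral>x. u x powr p \<partial>lborel) > 0"
    and N: "(\<integral>\<^sup>+x. ennreal (D x powr p) \<partial>lborel) \<le> ennreal N" "N > 0"
    and R: "R \<ge> 0"
  shows "(\<integral>x. u x powr p \<partial>lborel) powr (1 + q / DIM('a))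
     \<le> p powr p * inverse (gamma_const DIM('a) p) * (\<integral>x. u x \<partial>lborel) powr (p * q / DIM('a)) * N"
proof -
  define P where "P = (\<integral>x. u x powr p \<partial>lborel)"
  define m where "m = (\<integral>x. u x \<partial>lborel)"
  define n where "n = real DIM('a)"
  have n: "n > 0" by (simp add: n_def)
  have P0: "P > 0" using P by (simp add: P_def)
  have m0: "m > 0" unfolding m_def using powr_integral_lower(1)[OF p q _ _ _ u P, of "1 / 2"] by auto
  have q0: "q > 0" using p by (simp add: q)
  \<comment> \<open>the optimal \<open>c\<close> is the one for which \<open>((p - 1) / c) powr (p - 1) = k\<close>\<close>
  define k where "k = n * P / (p * N)"
  define c where "c = (p - 1) * k powr (- 1 / (p - 1))"
  have k: "k > 0" using n P0 p N by (simp add: k_def)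
  have c: "c > 0" using p k by (simp add: c_def)
  have "(p - 1) / c = k powr (1 / (p - 1))" using p k by (simp add: c_def powr_minus divide_simps)
  then have Kk: "((p - 1) / c) powr (p - 1) = k" using p k by (simp add: powr_powr)
  define G1 where "G1 = Gamma (n / 2 + 1)"
  define G2 where "G2 = Gamma (n / q + 1)"
  have G: "G1 > 0" "G2 > 0" using n q0 by (auto simp: G1_def G2_def intro!: Gamma_real_pos add_pos_pos divide_pos_pos)
  have "n + (q - 1) * ln P - q * ln m + ln (c powr (- (n / q)) * unit_ball_vol n * G2) \<le> k * N / P"
    using log_sobolev_nash[OF p q c _ u _ D lip P N(1) _ R] N(2)
    by (simp add: Kk n_def P_def m_def G2_def)
  also have "k * N / P = n / p" using P0 N by (simp add: k_def)
  also have "ln (c powr (- (n / q)) * unit_ball_vol n * G2) = - (n / q) * ln c + (n / 2 * ln pi - ln G1) + ln G2"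
    using c G n by (simp add: ln_mult ln_powr unit_ball_vol_def ln_div flip: G1_def)
  also have "ln c = ln (p - 1) - ln k / (p - 1)"
    using p k by (simp add: c_def ln_mult ln_powr)
  also have "ln k = ln n + ln P - (ln p + ln N)"
    using n P0 p N by (simp add: k_def ln_mult ln_div)
  \<comment> \<open>The factor p / n normalizes the coefficient of ln N to -1.\<close>
  finally have "p / n * (n + (q - 1) * ln P - q * ln m +
      (- (n / q) * (ln (p - 1) - (ln n + ln P - (ln p + ln N)) / (p - 1)) + (n / 2 * ln pi - ln G1) + ln G2)) \<le> p / n * (n / p)"
    using p n by (intro mult_left_mono) auto
  also have "p / n * (n / p) = 1" using p n by simp
  also have "p / n * (n + (q - 1) * ln P - q * ln m +
      (- (n / q) * (ln (p - 1) - (ln n + ln P - (ln p + ln N)) / (p - 1)) + (n / 2 * ln pi - ln G1) + ln G2))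
     = p + q / n * ln P - p * q / n * ln m - (p - 1) * ln (p - 1) + (ln n + ln P - (ln p + ln N)) + (p / 2 * ln pi - p / n * (ln G1 - ln G2))"
  proof -
    have "p / n * ((q - 1) * ln P) = q / n * ln P" using p by (simp add: q field_simps)
    moreover have dist: "- (p - 1) * (a - b / (p - 1)) = - (p - 1) * a + b" for a b
    proof -
      have eq: "(p - 1) * (b / (p - 1)) = b" using p by simp
      show ?thesis by (simp only: right_diff_distrib mult_minus_left eq diff_minus_eq_add)
    qed
    have "p / n * (n / q) = p - 1" using n p q0 by (simp add: q)
    then have "p / n * (- (n / q) * (ln (p - 1) - (ln n + ln P - (ln p + ln N)) / (p - 1)))
       = - (p - 1) * (ln (p - 1) - (ln n + ln P - (ln p + ln N)) / (p - 1))"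
      by (metis mult.assoc mult_minus_left mult_minus_right)
    then have "p / n * (- (n / q) * (ln (p - 1) - (ln n + ln P - (ln p + ln N)) / (p - 1)))
       = - (p - 1) * ln (p - 1) + (ln n + ln P - (ln p + ln N))"
      unfolding dist .
    moreover have "p / n * n = p" using n by simp
    moreover have "p / n * (n / 2 * ln pi) = p / 2 * ln pi" using n by simp
    moreover have "p / n * (q * ln m) = p * q / n * ln m" by simp
    moreover have "p / n * (x + y - z + (- (n / q) * w + (v - g1) + g2)) =
      p / n * x + p / n * y - p / n * z + (p / n * (- (n / q) * w) + (p / n * v - p / n * (g1 - g2)))" for x y z w v g1 g2
      by (simp only: distrib_left right_diff_distrib)
    ultimately show ?thesis by (simp only:)
  qed
  finally have key: "(1 + q / n) * ln P \<le> 1 - p + p * q / n * ln m + (p - 1) * ln (p - 1) - ln n + ln p + ln N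
      - p / 2 * ln pi + p / n * (ln G1 - ln G2)"
    by (simp add: algebra_simps)
  have qe: "q * exp 1 > 0" using q0 by simp
  have g: "gamma_const DIM('a) p = n * (q * exp 1) powr (p - 1) * pi powr (p / 2) * (G1 / G2) powr (- (p / n))"
    by (simp add: gamma_const_def Let_def n_def G1_def G2_def q)
  have g0: "gamma_const DIM('a) p > 0" unfolding g using n qe G by (intro mult_pos_pos) auto
  have lng: "ln (gamma_const DIM('a) p) = ln n + (p - 1) * (ln p - ln (p - 1) + 1) + p / 2 * ln pi - p / n * (ln G1 - ln G2)"
  proof -
    have "ln q = ln p - ln (p - 1)" using p by (simp add: q ln_div)
    then show ?thesis unfolding g using n q0 G by (simp add: ln_mult ln_powr ln_div)
  qed
  have r0: "p powr p * inverse (gamma_const DIM('a) p) * m powr (p * q / n) * N > 0"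
    using p g0 m0 N by simp
  have "ln (P powr (1 + q / n)) = (1 + q / n) * ln P" using P0 by (simp add: ln_powr)
  also have "\<dots> \<le> p * ln p - ln (gamma_const DIM('a) p) + p * q / n * ln m + ln N"
    using key by (simp add: lng algebra_simps)
  also have "\<dots> = ln (p powr p * inverse (gamma_const DIM('a) p) * m powr (p * q / n) * N)"
    using p g0 m0 N by (simp add: ln_mult ln_powr ln_inverse)
  finally have "ln (P powr (1 + q / n)) \<le> ln (p powr p * inverse (gamma_const DIM('a) p) * m powr (p * q / n) * N)" .
  moreover have "P powr (1 + q / n) > 0" using P0 by simp
  ultimately have "P powr (1 + q / n) \<le> p powr p * inverse (gamma_const DIM('a) p) * m powr (p * q / n) * N"
    using r0 ln_le_cancel_iff by blast
  then show ?thesis by (simp only: P_def m_def n_def)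
qed

section \<open>Mollifiers\<close>

text \<open>One-variable counterpart of \<open>C_k\<close>. The derivative is quantified
  existentially, so that closure proofs can exhibit it directly.\<close>

primrec smooth_upto :: "nat \<Rightarrow> (real \<Rightarrow> real) \<Rightarrow> bool" where
  "smooth_upto 0 f \<longleftrightarrow> continuous_on UNIV f"
| "smooth_upto (Suc k) f \<longleftrightarrow> (\<exists>f'. (\<forall>x. (f has_real_derivative f' x) (at x)) \<and> smooth_upto k f')"

lemma smooth_upto_continuous: "smooth_upto k f \<Longrightarrow> continuous_on UNIV f"
  by (cases k) (auto intro!: continuous_at_imp_continuous_on intro: DERIV_isCont)

lemma smooth_upto_SucD: "smooth_upto (Suc k) f \<Longrightarrow> smooth_upto k f"
proof (induction k arbitrary: f)
  case 0
  then show ?case using smooth_upto_continuous[of "Suc 0" f] by simp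
next
  case (Suc k)
  then obtain f' where f': "\<forall>x. (f has_real_derivative f' x) (at x)" "smooth_upto (Suc k) f'" by auto
  then show ?case using Suc.IH[OF f'(2)] by auto
qed

lemma smooth_upto_add: "smooth_upto k f \<Longrightarrow> smooth_upto k g \<Longrightarrow> smooth_upto k (\<lambda>x. f x + g x)"
proof (induction k arbitrary: f g)
  case (Suc k)
  then obtain f' g' where "\<forall>x. (f has_real_derivative f' x) (at x)" "smooth_upto k f'"
    "\<forall>x. (g has_real_derivative g' x) (at x)" "smooth_upto k g'" by auto
  then show ?case using Suc.IH[of f' g']
    by (auto intro!: exI[of _ "\<lambda>x. f' x + g' x"] derivative_intros)
qed (auto intro: continuous_on_add)

lemma smooth_upto_mult: "smooth_upto k f \<Longrightarrow> smooth_upto k g \<Longrightarrow> smooth_upto k (\<lambda>x. f x * g x)"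
proof (induction k arbitrary: f g)
  case (Suc k)
  from Suc.prems obtain f' g' where *: "\<forall>x. (f has_real_derivative f' x) (at x)" "smooth_upto k f'"
    "\<forall>x. (g has_real_derivative g' x) (at x)" "smooth_upto k g'" by auto
  have "smooth_upto k (\<lambda>x. f' x * g x + f x * g' x)"
    using * smooth_upto_SucD[OF Suc.prems(1)] smooth_upto_SucD[OF Suc.prems(2)]
    by (intro smooth_upto_add Suc.IH)
  moreover have "((\<lambda>x. f x * g x) has_real_derivative f' x * g x + f x * g' x) (at x)" for x
    using DERIV_mult[of f "f' x" x UNIV g "g' x"] * by (simp add: mult.commute)
  ultimately show ?case by (auto intro!: exI[of _ "\<lambda>x. f' x * g x + f x * g' x"])
qed (auto intro: continuous_on_mult)

lemma smooth_upto_const: "smooth_upto k (\<lambda>_. c)"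
proof (induction k arbitrary: c)
  case (Suc k)
  then show ?case by (auto intro!: exI[of _ "\<lambda>_. 0"])
qed simp

lemma smooth_upto_affine: "smooth_upto k f \<Longrightarrow> smooth_upto k (\<lambda>x. f (a * x + b))"
proof (induction k arbitrary: f)
  case 0
  then show ?case by (auto intro!: continuous_on_compose2[of UNIV f] continuous_intros)
next
  case (Suc k)
  then obtain f' where *: "\<forall>x. (f has_real_derivative f' x) (at x)" "smooth_upto k f'" by auto
  have "((\<lambda>x. f (a * x + b)) has_real_derivative f' (a * x + b) * a) (at x)" for x
    using * by (intro DERIV_chain2[of f]) (auto intro!: derivative_eq_intros)
  then show ?case using smooth_upto_mult[OF Suc.IH[OF *(2)] smooth_upto_const[of k a]]
    by (auto intro!: exI[of _ "\<lambda>x. f' (a * x + b) * a"])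
qed

text \<open>The polynomial parameter makes this family of flat functions closed under differentiation.\<close>

definition flat_exp :: "real poly \<Rightarrow> real \<Rightarrow> real" where
  "flat_exp P t = (if t > 0 then poly P (1 / t) * exp (- (1 / t)) else 0)"

lemma poly_mult_exp_tendsto_0: "((\<lambda>x::real. poly P x * exp (- x)) \<longlongrightarrow> 0) at_top"
proof -
  have "((\<lambda>x::real. \<Sum>i\<le>degree P. coeff P i * (x ^ i / exp x)) \<longlongrightarrow> (\<Sum>i\<le>degree P. coeff P i * 0)) at_top"
    by (intro tendsto_intros tendsto_power_div_exp_0)
  then show ?thesis by (simp add: poly_altdef sum_distrib_right exp_minus divide_inverse mult.assoc)
qed

text \<open>With s = 1 / t one has d/dt = -s^2 d/ds, which turns P(s) exp (-s) into s^2 (P - P')(s)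
  exp (-s). At 0 the difference quotient from the right is s P(s) exp (-s), of the same kind, and
  tends to 0.\<close>

lemma flat_exp_has_derivative:
  "(flat_exp P has_real_derivative flat_exp ([:0, 0, 1:] * (P - pderiv P)) t) (at t)"
proof -
  consider "t > 0" | "t < 0" | "t = 0" by linarith
  then show ?thesis
  proof cases
    case 1
    have "((\<lambda>t. poly P (1 / t) * exp (- (1 / t))) has_real_derivative
        flat_exp ([:0, 0, 1:] * (P - pderiv P)) t) (at t)"
      using 1 by (auto intro!: derivative_eq_intros simp: flat_exp_def field_simps power2_eq_square)
    then show ?thesis
      by (rule has_field_derivative_transform_within_open[where S="{0<..}"]) (use 1 in \<open>auto simp: flat_exp_def\<close>)
  next
    case 2
    have "((\<lambda>t. 0) has_real_derivative flat_exp ([:0, 0, 1:] * (P - pderiv P)) t) (at t)"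
      using 2 by (auto simp: flat_exp_def)
    then show ?thesis
      by (rule has_field_derivative_transform_within_open[where S="{..<0}"]) (use 2 in \<open>auto simp: flat_exp_def\<close>)
  next
    case 3
    have "((\<lambda>h. flat_exp P h / h) \<longlongrightarrow> 0) (at_right 0)"
    proof -
      have "((\<lambda>h::real. poly ([:0, 1:] * P) (inverse h) * exp (- inverse h)) \<longlongrightarrow> 0) (at_right 0)"
        using filterlim_compose[OF poly_mult_exp_tendsto_0 filterlim_inverse_at_top_right] .
      then show ?thesis
        by (rule Lim_transform_eventually)
           (auto simp: eventually_at_right_less flat_exp_def divide_inverse mult_ac intro!: eventually_at_rightI[of 0 1])
    qed
    moreover have "((\<lambda>h. flat_exp P h / h) \<longlongrightarrow> 0) (at_left 0)"
      by (rule tendsto_eventually) (auto simp: flat_exp_def intro!: eventually_at_leftI[of "-1" 0])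
    ultimately have "((\<lambda>h. flat_exp P h / h) \<longlongrightarrow> 0) (at 0)" by (simp add: filterlim_at_split)
    then show ?thesis using 3 by (simp add: DERIV_def flat_exp_def)
  qed
qed

lemma flat_exp_smooth: "smooth_upto k (flat_exp P)"
proof (induction k arbitrary: P)
  case 0
  then show ?case
    by (auto intro!: continuous_at_imp_continuous_on DERIV_isCont[OF flat_exp_has_derivative])
next
  case (Suc k)
  then show ?case using flat_exp_has_derivative by auto
qed

definition bump :: "real \<Rightarrow> real \<Rightarrow> real" where
  "bump e t = flat_exp 1 (e - t) * flat_exp 1 (e + t)"

lemma bump_smooth: "smooth_upto k (bump e)"
  using smooth_upto_mult[OF smooth_upto_affine[OF flat_exp_smooth, of k "1::real poly" "-1" e] smooth_upto_affine[OF flat_exp_smooth, of k "1::real poly" "1" e]]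
  by (simp add: bump_def[abs_def] add.commute)

lemma bump_nonneg: "bump e t \<ge> 0"
  by (simp add: bump_def flat_exp_def)

lemma bump_pos: "e > 0 \<Longrightarrow> bump e 0 > 0"
  by (simp add: bump_def flat_exp_def)

lemma bump_support: "bump e t \<noteq> 0 \<Longrightarrow> \<bar>t\<bar> \<le> e"
  by (auto simp: bump_def flat_exp_def split: if_splits)

text \<open>Each partial derivative replaces a single factor by its derivative, so it is again a
  scaled product of coordinate functions. The function update keeps this shape visible for the
  induction on the order of differentiability.\<close>

lemma has_derivative_prod_coords:
  fixes u u' :: "'a::euclidean_space \<Rightarrow> real \<Rightarrow> real"
  assumes "\<And>b t. b \<in> Basis \<Longrightarrow> (u b has_real_derivative u' b t) (at t)"
  shows "((\<lambda>x. a * (\<Prod>b\<in>Basis. u b (x \<bullet> b))) has_derivative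
    (\<lambda>h. (\<Sum>b\<in>Basis. (a * (\<Prod>j\<in>Basis. (u(b := u' b)) j (x \<bullet> j))) *\<^sub>R b) \<bullet> h)) (at x)"
proof -
  have "((\<lambda>x. u b (x \<bullet> b)) has_derivative (\<lambda>h. u' b (x \<bullet> b) * (h \<bullet> b))) (at x)" if "b \<in> Basis" for b
  proof -
    have "((\<lambda>x. x \<bullet> b) has_derivative (\<lambda>h. h \<bullet> b)) (at x)" by (auto intro!: derivative_eq_intros)
    then show ?thesis
      using has_derivative_compose[of "\<lambda>x. x \<bullet> b" "\<lambda>h. h \<bullet> b" x UNIV "u b" "\<lambda>h. u' b (x \<bullet> b) * h"] assms[OF that, of "x \<bullet> b"]
      by (simp add: has_field_derivative_def)
  qed
  then have "((\<lambda>x. a * (\<Prod>b\<in>Basis. u b (x \<bullet> b))) has_derivative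
    (\<lambda>h. a * (\<Sum>b\<in>Basis. (u' b (x \<bullet> b) * (h \<bullet> b)) * (\<Prod>j\<in>Basis - {b}. u j (x \<bullet> j))))) (at x)"
    by (intro has_derivative_mult_right has_derivative_prod) auto
  moreover have "a * (\<Sum>b\<in>Basis. (u' b (x \<bullet> b) * (h \<bullet> b)) * (\<Prod>j\<in>Basis - {b}. u j (x \<bullet> j)))
     = (\<Sum>b\<in>Basis. (a * (\<Prod>j\<in>Basis. (u(b := u' b)) j (x \<bullet> j))) *\<^sub>R b) \<bullet> h" for h
    unfolding inner_sum_left sum_distrib_left
  proof (intro sum.cong refl)
    fix b :: 'a assume b: "b \<in> Basis"
    have "(\<Prod>j\<in>Basis. (u(b := u' b)) j (x \<bullet> j)) = u' b (x \<bullet> b) * (\<Prod>j\<in>Basis - {b}. u j (x \<bullet> j))"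
      using b by (subst prod.remove[of _ b]) (auto intro!: prod.cong)
    then show "a * (u' b (x \<bullet> b) * (h \<bullet> b) * (\<Prod>j\<in>Basis - {b}. u j (x \<bullet> j))) =
         ((a * (\<Prod>j\<in>Basis. (u(b := u' b)) j (x \<bullet> j))) *\<^sub>R b) \<bullet> h"
      by (simp add: mult_ac inner_commute)
  qed
  ultimately show ?thesis by simp
qed

lemma C_k_prod_coords:
  fixes u :: "'a::euclidean_space \<Rightarrow> real \<Rightarrow> real"
  assumes "\<And>b. b \<in> Basis \<Longrightarrow> smooth_upto k (u b)"
  shows "C_k k (\<lambda>x. a * (\<Prod>b\<in>Basis. u b (x \<bullet> b)))"
  using assms
proof (induction k arbitrary: u)
  case 0
  have "continuous_on UNIV (\<lambda>x. u b (x \<bullet> b))" if "b \<in> Basis" for b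
    using 0[OF that] unfolding smooth_upto.simps
    by (rule continuous_on_compose2) (auto intro!: continuous_intros)
  then show ?case unfolding C_k.simps by (intro continuous_on_mult continuous_on_prod continuous_on_const)
next
  case (Suc k)
  have "\<forall>b. \<exists>f'. b \<in> Basis \<longrightarrow> (\<forall>x. (u b has_real_derivative f' x) (at x)) \<and> smooth_upto k f'"
  proof
    fix b
    show "\<exists>f'. b \<in> Basis \<longrightarrow> (\<forall>x. (u b has_real_derivative f' x) (at x)) \<and> smooth_upto k f'"
      using Suc.prems[of b] unfolding smooth_upto.simps by blast
  qed
  from choice[OF this] obtain u' where "\<forall>b. b \<in> Basis \<longrightarrow> (\<forall>x. (u b has_real_derivative u' b x) (at x)) \<and> smooth_upto k (u' b)" ..
  then have u': "\<And>b x. b \<in> Basis \<Longrightarrow> (u b has_real_derivative u' b x) (at x)"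
    "\<And>b. b \<in> Basis \<Longrightarrow> smooth_upto k (u' b)" by auto
  note D = has_derivative_prod_coords[of u u', OF u'(1)]
  have pd: "partial_deriv b (\<lambda>x. a * (\<Prod>b\<in>Basis. u b (x \<bullet> b))) = (\<lambda>x. a * (\<Prod>j\<in>Basis. (u(b := u' b)) j (x \<bullet> j)))"
    if b: "b \<in> Basis" for b
  proof
    fix x
    have "(\<Sum>i\<in>Basis. (a * (\<Prod>j\<in>Basis. (u(i := u' i)) j (x \<bullet> j))) *\<^sub>R i) \<bullet> b = a * (\<Prod>j\<in>Basis. (u(b := u' b)) j (x \<bullet> j))"
      using b by (simp add: inner_sum_left_Basis del: fun_upd_apply)
    then show "partial_deriv b (\<lambda>x. a * (\<Prod>b\<in>Basis. u b (x \<bullet> b))) x = a * (\<Prod>j\<in>Basis. (u(b := u' b)) j (x \<bullet> j))"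
      unfolding partial_deriv_def using fun_cong[OF frechet_derivative_at[OF D[of a x]], of b] by simp
  qed
  have "C_k k (\<lambda>x. a * (\<Prod>j\<in>Basis. (u(b := u' b)) j (x \<bullet> j)))" if "b \<in> Basis" for b
    using u'(2)[OF that] Suc.prems smooth_upto_SucD by (intro Suc.IH) auto
  then show ?case using D pd by (auto simp: differentiable_on_def differentiable_def simp del: fun_upd_apply)
qed

lemma emeasure_open_pos:
  fixes U :: "'a::euclidean_space set"
  assumes "open U" "x \<in> U"
  shows "emeasure lborel U > 0"
proof -
  obtain r where r: "r > 0" "cball x r \<subseteq> U" using assms open_contains_cball by blast
  have "0 < emeasure lborel (cball x r)" using r by (simp add: emeasure_cball)
  also have "\<dots> \<le> emeasure lborel U" using r assms by (intro emeasure_mono) auto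
  finally show ?thesis .
qed

text \<open>A normalized product of one-variable bumps. The last property concerns the reflected
  translates, since these are the functions against which the weak gradient is tested.\<close>

theorem mollifier_exists:
  fixes \<delta> :: real
  assumes \<delta>: "\<delta> > 0"
  obtains \<rho> :: "'a::euclidean_space \<Rightarrow> real" and \<rho>' :: "'a \<Rightarrow> 'a"
  where "\<And>x. \<rho> x \<ge> 0" "\<And>x. norm x > \<delta> \<Longrightarrow> \<rho> x = 0" "(\<integral>\<^sup>+x. ennreal (\<rho> x) \<partial>lborel) = 1"
    "\<And>x. (\<rho> has_derivative (\<lambda>h. \<rho>' x \<bullet> h)) (at x)" "continuous_on UNIV \<rho>'"
    "\<And>x. norm x > \<delta> \<Longrightarrow> \<rho>' x = 0" "\<And>x. test_function (\<lambda>y. \<rho> (x - y))"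
proof -
  \<comment> \<open>The cube of half side \<open>e\<close> lies in the ball of radius \<delta>,
    since the norm is at most the sum of the absolute values of the coordinates.\<close>
  define e where "e = \<delta> / DIM('a)"
  have e: "e > 0" using \<delta> by (simp add: e_def)
  obtain f' where f': "\<And>x. (bump e has_real_derivative f' x) (at x)" "smooth_upto 0 f'"
    using bump_smooth[of "Suc 0" e] by auto
  define \<beta> where "\<beta> x = (\<Prod>b\<in>Basis. bump e (x \<bullet> b))" for x :: 'a
  have \<beta>0: "\<beta> x \<ge> 0" for x by (simp add: \<beta>_def bump_nonneg prod_nonneg)
  have \<beta>supp: "\<beta> x = 0" if "norm x > \<delta>" for x
  proof (rule ccontr)
    assume "\<beta> x \<noteq> 0"
    then have "\<bar>x \<bullet> b\<bar> \<le> e" if "b \<in> Basis" for b using that bump_support[of e "x \<bullet> b"] by (auto simp: \<beta>_def)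
    then have "(\<Sum>b\<in>Basis. \<bar>x \<bullet> b\<bar>) \<le> (\<Sum>b\<in>(Basis::'a set). e)" by (intro sum_mono)
    then have "norm x \<le> \<delta>" using norm_le_l1[of x] by (simp add: e_def)
    then show False using that by simp
  qed
  have cont: "continuous_on UNIV \<beta>" unfolding \<beta>_def
    using smooth_upto_continuous[OF bump_smooth[of 0 e]]
    by (auto intro!: continuous_intros continuous_on_compose2[of UNIV "bump e"])
  then have [measurable]: "\<beta> \<in> borel_measurable borel" by (rule borel_measurable_continuous_onI)
  have "compact (\<beta> ` cball 0 \<delta>)" using cont by (intro compact_continuous_image) (auto intro: continuous_on_subset)
  then obtain B where "\<forall>y\<in>\<beta> ` cball 0 \<delta>. norm y \<le> B" using compact_imp_bounded bounded_iff by metis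
  then have B: "\<beta> x \<le> B" if "x \<in> cball 0 \<delta>" for x using that by (metis image_eqI abs_le_D1 real_norm_def)
  have "(\<integral>\<^sup>+x. ennreal (\<beta> x) \<partial>lborel) \<le> (\<integral>\<^sup>+x. ennreal B * indicator (cball (0::'a) \<delta>) x \<partial>lborel)"
  proof (intro nn_integral_mono)
    fix x show "ennreal (\<beta> x) \<le> ennreal B * indicator (cball (0::'a) \<delta>) x"
      using B[of x] \<beta>supp[of x] by (cases "norm x \<le> \<delta>") (auto intro: ennreal_leI)
  qed
  also have "\<dots> < top"
    by (simp add: nn_integral_cmult_indicator emeasure_cball ennreal_mult_less_top \<delta> less_imp_le)
  finally have fin: "(\<integral>\<^sup>+x. ennreal (\<beta> x) \<partial>lborel) < top" .
  have "{x. \<beta> x > 0} \<noteq> {}" using bump_pos[OF e] by (auto simp: \<beta>_def intro!: exI[of _ 0] prod_pos)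
  moreover have "open {x. \<beta> x > 0}" using cont by (intro open_Collect_less) auto
  ultimately have "emeasure lborel {x. \<beta> x > 0} > 0" using emeasure_open_pos by blast
  then have "(\<integral>\<^sup>+x. ennreal (\<beta> x) \<partial>lborel) \<noteq> 0"
    by (subst nn_integral_0_iff) (auto simp: ennreal_eq_0_iff not_le)
  with fin obtain I where I: "(\<integral>\<^sup>+x. ennreal (\<beta> x) \<partial>lborel) = ennreal I" "I > 0"
    by (cases "\<integral>\<^sup>+x. ennreal (\<beta> x) \<partial>lborel") (auto simp: zero_less_iff_neq_zero less_le)
  define a where "a = 1 / I"
  have a: "a > 0" using I by (simp add: a_def)
  define \<rho> where "\<rho> x = a * \<beta> x" for x
  define \<rho>' where "\<rho>' x = (\<Sum>b\<in>Basis. (a * (\<Prod>j\<in>Basis. ((\<lambda>_. bump e)(b := f')) j (x \<bullet> j))) *\<^sub>R b)" for x :: 'a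
  have D: "(\<rho> has_derivative (\<lambda>h. \<rho>' x \<bullet> h)) (at x)" for x
    unfolding \<rho>_def[abs_def] \<beta>_def \<rho>'_def using has_derivative_prod_coords[of "\<lambda>_. bump e" "\<lambda>_. f'"] f' by simp
  show ?thesis
  proof (rule that[of \<rho> \<rho>'])
    show "\<rho> x \<ge> 0" for x using a \<beta>0 by (simp add: \<rho>_def)
    show s: "\<rho> x = 0" if "norm x > \<delta>" for x using that \<beta>supp by (simp add: \<rho>_def)
    show "(\<integral>\<^sup>+x. ennreal (\<rho> x) \<partial>lborel) = 1"
      using a \<beta>0 I by (simp add: \<rho>_def ennreal_mult nn_integral_cmult) (simp add: a_def flip: ennreal_mult)
    show "(\<rho> has_derivative (\<lambda>h. \<rho>' x \<bullet> h)) (at x)" for x by (rule D)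
    show "continuous_on UNIV \<rho>'" unfolding \<rho>'_def
      using smooth_upto_continuous[OF bump_smooth[of 0 e]] f'(2)
      by (auto intro!: continuous_intros continuous_on_compose2[of UNIV "bump e"] continuous_on_compose2[of UNIV "f'"])
    show "\<rho>' x = 0" if "norm x > \<delta>" for x
    proof -
      have "open {x::'a. norm x > \<delta>}" by (intro open_Collect_less continuous_intros)
      then have "((\<lambda>_. 0) has_derivative (\<lambda>h. \<rho>' x \<bullet> h)) (at x)"
        using that s by (intro has_derivative_transform_within_open[OF D[of x]]) auto
      then have "(\<lambda>h. \<rho>' x \<bullet> h) = (\<lambda>h. 0)" by (rule has_derivative_unique) simp
      then show ?thesis by (metis inner_eq_zero_iff)
    qed
    show "test_function (\<lambda>y. \<rho> (x - y))" for x
      unfolding test_function_def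
    proof (intro conjI allI)
      fix k
      have "smooth_upto k (\<lambda>t. bump e (x \<bullet> b - t))" for b
        using smooth_upto_affine[OF bump_smooth, of k e "-1" "x \<bullet> b"] by simp
      then have "C_k k (\<lambda>y. a * (\<Prod>b\<in>Basis. (\<lambda>t. bump e (x \<bullet> b - t)) (y \<bullet> b)))"
        by (intro C_k_prod_coords) auto
      then show "C_k k (\<lambda>y. \<rho> (x - y))" by (simp add: \<rho>_def \<beta>_def inner_diff_left)
    next
      have "{y. \<rho> (x - y) \<noteq> 0} \<subseteq> cball x \<delta>" using s by (force simp: dist_norm not_less)
      then show "compact (closure {y. \<rho> (x - y) \<noteq> 0})"
        using bounded_subset[OF bounded_cball] by (simp add: compact_closure)
    qed
  qed
qed

section \<open>Mollification of weak gradients\<close>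

lemma nn_integral_lborel_translate:
  fixes f :: "'a::euclidean_space \<Rightarrow> ennreal"
  assumes [measurable]: "f \<in> borel_measurable borel"
  shows "(\<integral>\<^sup>+x. f (x - a) \<partial>lborel) = (\<integral>\<^sup>+x. f x \<partial>lborel)"
proof -
  have "(\<integral>\<^sup>+x. f x \<partial>lborel) = (\<integral>\<^sup>+x. f x \<partial>distr lborel borel ((+) (- a)))" by (simp add: lborel_distr_plus)
  also have "\<dots> = (\<integral>\<^sup>+x. f (x - a) \<partial>lborel)" by (subst nn_integral_distr) auto
  finally show ?thesis ..
qed

lemma nn_integral_lborel_reflect:
  fixes f :: "'a::euclidean_space \<Rightarrow> ennreal"
  assumes [measurable]: "f \<in> borel_measurable borel"
  shows "(\<integral>\<^sup>+x. f (a - x) \<partial>lborel) = (\<integral>\<^sup>+x. f x \<partial>lborel)"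
  by (subst (2) lborel_affine[of "-1" a]) (auto simp: nn_integral_density nn_integral_distr)

text \<open>The version of \<open>locally_integrable\<close> used for Borel representatives: it
  refers to \<open>lborel\<close>, to which Tonelli's theorem is applied, and tests on
  balls.\<close>

definition loc_int :: "('a::euclidean_space \<Rightarrow> 'b::euclidean_space) \<Rightarrow> bool" where
  "loc_int f \<longleftrightarrow> (\<forall>x r. integrable lborel (\<lambda>y. indicator (cball x r) y *\<^sub>R f y))"

lemma loc_int_dominated:
  fixes f :: "'a::euclidean_space \<Rightarrow> 'b::euclidean_space" and k :: "'a \<Rightarrow> 'c::euclidean_space"
  assumes "loc_int f" "k \<in> borel_measurable borel"
    and "\<And>y. norm (k y) \<le> C * norm (f y)" "\<And>y. y \<notin> cball x r \<Longrightarrow> k y = 0"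
  shows "integrable lborel k"
proof (rule Bochner_Integration.integrable_bound)
  show "integrable lborel (\<lambda>y. C *\<^sub>R (indicator (cball x r) y *\<^sub>R f y))"
    using assms(1) by (intro integrable_scaleR_right) (auto simp: loc_int_def)
  show "AE y in lborel. norm (k y) \<le> norm (C *\<^sub>R (indicator (cball x r) y *\<^sub>R f y))"
  proof (intro AE_I2)
    fix y
    have "norm (k y) \<le> \<bar>C\<bar> * norm (f y)"
      using assms(3)[of y] by (meson abs_ge_self mult_right_mono norm_ge_zero order_trans)
    then show "norm (k y) \<le> norm (C *\<^sub>R (indicator (cball x r) y *\<^sub>R f y))"
      using assms(4)[of y] by (cases "y \<in> cball x r") auto
  qed
qed (use assms in auto)

lemma continuous_compact_support_bounded:
  fixes f :: "'a::euclidean_space \<Rightarrow> 'b::euclidean_space"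
  assumes "continuous_on UNIV f" "\<And>x. norm x > d \<Longrightarrow> f x = 0"
  obtains B where "B > 0" "\<And>x. norm (f x) \<le> B"
proof -
  have "compact (f ` cball 0 d)"
    using assms by (intro compact_continuous_image) (auto intro: continuous_on_subset)
  then obtain B where B: "B > 0" "\<forall>y\<in>f ` cball 0 d. norm y \<le> B"
    using compact_imp_bounded bounded_pos by metis
  show ?thesis
  proof (rule that[OF B(1)])
    fix x show "norm (f x) \<le> B" using B assms(2)[of x] by (cases "norm x > d") auto
  qed
qed

lemma continuous_compact_support_uniform:
  fixes f :: "'a::euclidean_space \<Rightarrow> 'b::euclidean_space"
  assumes "continuous_on UNIV f" "\<And>x. norm x > d \<Longrightarrow> f x = 0" and e: "e > 0"
  obtains r where "r > 0" "r \<le> 1" "\<And>x y. norm (x - y) \<le> r \<Longrightarrow> norm (f x - f y) \<le> e"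
proof -
  \<comment> \<open>If one of two points at distance at most 1 lies outside the ball of radius d +
    1, both lie outside the ball of radius d, where f vanishes.\<close>
  have "uniformly_continuous_on (cball 0 (d + 1)) f"
    using assms by (intro compact_uniformly_continuous) (auto intro: continuous_on_subset)
  then obtain r where r: "r > 0" "\<And>x y. x \<in> cball 0 (d + 1) \<Longrightarrow> y \<in> cball 0 (d + 1) \<Longrightarrow> dist y x < r \<Longrightarrow> dist (f y) (f x) < e"
    using e unfolding uniformly_continuous_on_def by metis
  show ?thesis
  proof (rule that[of "min (r / 2) 1"])
    fix x y :: 'a assume "norm (x - y) \<le> min (r / 2) 1"
    then have xy: "dist x y < r" "norm (x - y) \<le> 1" using r by (auto simp: dist_norm)
    show "norm (f x - f y) \<le> e"
    proof (cases "x \<in> cball 0 (d + 1) \<and> y \<in> cball 0 (d + 1)")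
      case True
      then show ?thesis using r(2)[of y x] xy by (auto simp: dist_norm)
    next
      case False
      then have "norm x > d + 1 \<or> norm y > d + 1" by auto
      then have "norm x > d" "norm y > d"
        using xy(2) norm_triangle_ineq3[of x y] by linarith+
      then show ?thesis using assms by simp
    qed
  qed (use r in auto)
qed

text \<open>The mass is a nonnegative integral so that it feeds directly into Tonelli arguments;
  \<delta> <= 1 lets fixed enlargements of balls, by 1 or to radius 2, absorb the support of the
  kernel.\<close>

locale mollifier =
  fixes \<rho> :: "'a::euclidean_space \<Rightarrow> real" and \<rho>' :: "'a \<Rightarrow> 'a" and \<delta> :: real
  assumes delta: "0 < \<delta>" "\<delta> \<le> 1"
    and nonneg: "\<rho> x \<ge> 0"
    and supp: "norm x > \<delta> \<Longrightarrow> \<rho> x = 0"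
    and mass: "(\<integral>\<^sup>+x. ennreal (\<rho> x) \<partial>lborel) = 1"
    and deriv: "(\<rho> has_derivative (\<lambda>h. \<rho>' x \<bullet> h)) (at x)"
    and cont': "continuous_on UNIV \<rho>'"
    and supp': "norm x > \<delta> \<Longrightarrow> \<rho>' x = 0"
    and test: "test_function (\<lambda>y. \<rho> (x - y))"
begin

definition smear :: "('a \<Rightarrow> 'b::euclidean_space) \<Rightarrow> 'a \<Rightarrow> 'b" where
  "smear f x = (\<integral>y. \<rho> (x - y) *\<^sub>R f y \<partial>lborel)"

lemma cont: "continuous_on UNIV \<rho>"
  using deriv by (auto intro!: continuous_at_imp_continuous_on has_derivative_continuous)

lemma meas [measurable]: "\<rho> \<in> borel_measurable borel" "\<rho>' \<in> borel_measurable borel"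
  using cont cont' by (auto intro: borel_measurable_continuous_onI)

lemma integrable_smear:
  assumes "loc_int f" and [measurable]: "f \<in> borel_measurable borel"
  shows "integrable lborel (\<lambda>y. \<rho> (x - y) *\<^sub>R f y)"
proof -
  obtain B where B: "B > 0" "\<And>x. norm (\<rho> x) \<le> B"
    using continuous_compact_support_bounded[OF cont supp] by blast
  show ?thesis
    by (rule loc_int_dominated[OF assms(1), where C=B and x=x and r=\<delta>])
       (use B supp in \<open>auto simp: dist_norm intro: mult_right_mono\<close>)
qed

lemma integrable_smear':
  fixes g :: "'a \<Rightarrow> real"
  assumes "loc_int g" and [measurable]: "g \<in> borel_measurable borel"
  shows "integrable lborel (\<lambda>y. g y *\<^sub>R \<rho>' (x - y))"
proof -
  obtain B where B: "B > 0" "\<And>x. norm (\<rho>' x) \<le> B"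
    using continuous_compact_support_bounded[OF cont' supp'] by blast
  show ?thesis
    by (rule loc_int_dominated[OF assms(1), where C=B and x=x and r=\<delta>])
       (use B supp' in \<open>auto simp: dist_norm mult.commute[of B] intro: mult_left_mono\<close>)
qed

lemma measurable_smear [measurable]:
  assumes [measurable]: "f \<in> borel_measurable borel"
  shows "smear f \<in> borel_measurable borel"
  unfolding smear_def[abs_def] by measurable

lemma smear_eq_nn_integral:
  fixes f :: "'a \<Rightarrow> real"
  assumes "loc_int f" and [measurable]: "f \<in> borel_measurable borel" and "\<And>x. f x \<ge> 0"
  shows "ennreal (smear f x) = (\<integral>\<^sup>+y. ennreal (\<rho> (x - y) * f y) \<partial>lborel)"
  unfolding smear_def using integrable_smear[OF assms(1,2), of x] assms(3) nonneg
  by (subst nn_integral_eq_integral) auto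

lemma smear_nonneg:
  fixes f :: "'a \<Rightarrow> real"
  assumes "\<And>x. f x \<ge> 0"
  shows "smear f x \<ge> 0"
  unfolding smear_def using assms nonneg by (intro integral_nonneg_AE) auto

lemma nn_integral_kernel_1: "(\<integral>\<^sup>+y. ennreal (\<rho> (x - y)) \<partial>lborel) = 1"
  using nn_integral_lborel_reflect[of "\<lambda>y. ennreal (\<rho> y)" x] mass by simp

lemma nn_integral_kernel_2: "(\<integral>\<^sup>+x. ennreal (\<rho> (x - y)) \<partial>lborel) = 1"
  using nn_integral_lborel_translate[of "\<lambda>y. ennreal (\<rho> y)" y] mass by simp

text \<open>Tonelli and the unit mass of the kernel in its first variable. This yields the
  preservation of mass and, after Jensen, the contraction in L^p, infinite integrals
  included.\<close>

lemma nn_integral_smear_mass: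
  fixes F :: "'a \<Rightarrow> ennreal"
  assumes [measurable]: "F \<in> borel_measurable borel"
  shows "(\<integral>\<^sup>+x. (\<integral>\<^sup>+y. ennreal (\<rho> (x - y)) * F y \<partial>lborel) \<partial>lborel) = (\<integral>\<^sup>+y. F y \<partial>lborel)"
proof -
  have "(\<integral>\<^sup>+x. (\<integral>\<^sup>+y. ennreal (\<rho> (x - y)) * F y \<partial>lborel) \<partial>lborel)
      = (\<integral>\<^sup>+y. (\<integral>\<^sup>+x. ennreal (\<rho> (x - y)) * F y \<partial>lborel) \<partial>lborel)"
    by (rule lborel_pair.Fubini') measurable
  also have "\<dots> = (\<integral>\<^sup>+y. F y \<partial>lborel)"
    by (simp add: nn_integral_multc nn_integral_kernel_2)
  finally show ?thesis .
qed

lemma integral_kernel_1: "(\<integral>y. \<rho> (x - y) \<partial>lborel) = 1" "integrable lborel (\<lambda>y. \<rho> (x - y))"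
proof -
  show i: "integrable lborel (\<lambda>y. \<rho> (x - y))"
    using nn_integral_kernel_1[of x] nonneg by (intro integrableI_nonneg) auto
  have "ennreal (\<integral>y. \<rho> (x - y) \<partial>lborel) = 1"
    using nn_integral_eq_integral[OF i] nonneg nn_integral_kernel_1[of x] by simp
  then show "(\<integral>y. \<rho> (x - y) \<partial>lborel) = 1" by simp
qed

lemma nn_integral_smear:
  fixes f :: "'a \<Rightarrow> real"
  assumes "loc_int f" and [measurable]: "f \<in> borel_measurable borel" and "\<And>x. f x \<ge> 0"
  shows "(\<integral>\<^sup>+x. ennreal (smear f x) \<partial>lborel) = (\<integral>\<^sup>+x. ennreal (f x) \<partial>lborel)"
  using nn_integral_smear_mass[of "\<lambda>x. ennreal (f x)"]
  by (simp add: smear_eq_nn_integral[OF assms] ennreal_mult nonneg assms(3))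

lemma smear_powr_le:
  fixes f :: "'a \<Rightarrow> real"
  assumes "loc_int f" and [measurable]: "f \<in> borel_measurable borel" and f: "\<And>x. f x \<ge> 0" and p: "p > 1"
  shows "(\<integral>\<^sup>+x. ennreal (smear f x powr p) \<partial>lborel) \<le> (\<integral>\<^sup>+x. ennreal (f x powr p) \<partial>lborel)"
proof -
  have "ennreal (smear f x powr p) \<le> (\<integral>\<^sup>+y. ennreal (\<rho> (x - y)) * ennreal (f y powr p) \<partial>lborel)" for x
  \<comment> \<open>The Bochner integral of a non-integrable function is 0, so the tangent argument
    requires integrability; in the other case the right-hand side is infinite.\<close>
  proof (cases "integrable lborel (\<lambda>y. \<rho> (x - y) * f y powr p)")
    case True
    define a where "a = smear f x"
    have a: "a \<ge> 0" using smear_nonneg[OF f] by (simp add: a_def)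
    have i: "integrable lborel (\<lambda>y. \<rho> (x - y) * f y)" using integrable_smear[OF assms(1,2), of x] by simp
    \<comment> \<open>Jensen's inequality, by integrating the tangent line of \<open>s \<mapsto> s powr p\<close> at \<open>a\<close>\<close>
    have "a powr p = (\<integral>y. (a powr p - p * a powr (p - 1) * a) * \<rho> (x - y) + p * a powr (p - 1) * (\<rho> (x - y) * f y) \<partial>lborel)"
      using i integral_kernel_1[of x] by (simp add: a_def smear_def)
    also have "\<dots> \<le> (\<integral>y. \<rho> (x - y) * f y powr p \<partial>lborel)"
    proof (intro integral_mono True)
      fix y
      show "(a powr p - p * a powr (p - 1) * a) * \<rho> (x - y) + p * a powr (p - 1) * (\<rho> (x - y) * f y) \<le> \<rho> (x - y) * f y powr p"
        using mult_left_mono[OF powr_tangent[OF p f[of y] a] nonneg[of "x - y"]] by (simp add: algebra_simps)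
    qed (use i integral_kernel_1[of x] in simp)
    finally have "ennreal (a powr p) \<le> ennreal (\<integral>y. \<rho> (x - y) * f y powr p \<partial>lborel)" by (rule ennreal_leI)
    also have "\<dots> = (\<integral>\<^sup>+y. ennreal (\<rho> (x - y) * f y powr p) \<partial>lborel)"
      using True nonneg by (intro nn_integral_eq_integral[symmetric]) auto
    finally show ?thesis by (simp add: a_def ennreal_mult nonneg)
  next
    case False
    have "(\<integral>\<^sup>+y. ennreal (\<rho> (x - y) * f y powr p) \<partial>lborel) = top"
    proof (rule ccontr)
      assume "(\<integral>\<^sup>+y. ennreal (\<rho> (x - y) * f y powr p) \<partial>lborel) \<noteq> top"
      then have "integrable lborel (\<lambda>y. \<rho> (x - y) * f y powr p)"
        using nonneg by (intro integrableI_nonneg) (auto simp: less_top)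
      then show False using False by simp
    qed
    then show ?thesis by (simp add: ennreal_mult nonneg)
  qed
  then have "(\<integral>\<^sup>+x. ennreal (smear f x powr p) \<partial>lborel)
      \<le> (\<integral>\<^sup>+x. (\<integral>\<^sup>+y. ennreal (\<rho> (x - y)) * ennreal (f y powr p) \<partial>lborel) \<partial>lborel)"
    by (intro nn_integral_mono) auto
  also have "\<dots> = (\<integral>\<^sup>+x. ennreal (f x powr p) \<partial>lborel)"
    by (rule nn_integral_smear_mass) measurable
  finally show ?thesis .
qed

lemma smear_norm_powr_le:
  fixes G :: "'a \<Rightarrow> 'b::euclidean_space"
  assumes G: "loc_int G" and [measurable]: "G \<in> borel_measurable borel" and p: "p > 1"
  shows "(\<integral>\<^sup>+x. ennreal (norm (smear G x) powr p) \<partial>lborel) \<le> (\<integral>\<^sup>+x. ennreal (norm (G x) powr p) \<partial>lborel)"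
proof -
  have l: "loc_int (\<lambda>x. norm (G x))"
    unfolding loc_int_def
  proof (intro allI)
    fix x r
    have "integrable lborel (\<lambda>y. norm (indicator (cball x r) y *\<^sub>R G y))"
      using G unfolding loc_int_def by (intro integrable_norm) auto
    then show "integrable lborel (\<lambda>y. indicator (cball x r) y *\<^sub>R norm (G y))" by (simp add: abs_indicator)
  qed
  have "norm (smear G x) \<le> smear (\<lambda>x. norm (G x)) x" for x
    unfolding smear_def using integral_norm_bound[of lborel "\<lambda>y. \<rho> (x - y) *\<^sub>R G y"] nonneg by simp
  then have "(\<integral>\<^sup>+x. ennreal (norm (smear G x) powr p) \<partial>lborel) \<le> (\<integral>\<^sup>+x. ennreal (smear (\<lambda>x. norm (G x)) x powr p) \<partial>lborel)"
    using p by (intro nn_integral_mono ennreal_leI powr_mono2) auto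
  also have "\<dots> \<le> (\<integral>\<^sup>+x. ennreal (norm (G x) powr p) \<partial>lborel)"
    using l p by (intro smear_powr_le) auto
  finally show ?thesis .
qed

text \<open>The remainder is uniform in the base point \<open>v\<close> because \<rho>' is uniformly
  continuous; this is what allows it to be integrated against g.\<close>

lemma kernel_taylor:
  assumes "\<eta> > 0"
  obtains r where "r > 0" "r \<le> 1" "\<And>v w. norm w \<le> r \<Longrightarrow> \<bar>\<rho> (v + w) - \<rho> v - \<rho>' v \<bullet> w\<bar> \<le> \<eta> * norm w"
proof -
  obtain r where r: "r > 0" "r \<le> 1" "\<And>x y. norm (x - y) \<le> r \<Longrightarrow> norm (\<rho>' x - \<rho>' y) \<le> \<eta>"
    using continuous_compact_support_uniform[OF cont' supp' assms] by blast
  show ?thesis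
  proof (rule that[OF r(1,2)])
    fix v w :: 'a assume w: "norm w \<le> r"
    have "norm (\<rho> (v + w) - \<rho> v - \<rho>' v \<bullet> (v + w - v)) \<le> norm (v + w - v) * \<eta>"
    proof (rule differentiable_bound_linearization[where S="cball v r" and f'="\<lambda>x h. \<rho>' x \<bullet> h"])
      fix t :: real assume t: "t \<in> {0..1}"
      have "t * norm w \<le> 1 * r" using t w by (intro mult_mono) auto
      then show "v + t *\<^sub>R (v + w - v) \<in> cball v r" using t by (simp add: dist_norm)
    next
      fix x assume "x \<in> cball v r"
      then have x: "norm (\<rho>' x - \<rho>' v) \<le> \<eta>" by (intro r) (simp add: dist_norm norm_minus_commute)
      show "onorm ((\<lambda>h. \<rho>' x \<bullet> h) - (\<lambda>h. \<rho>' v \<bullet> h)) \<le> \<eta>"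
      proof (rule onorm_bound)
        fix h
        have "norm ((\<rho>' x - \<rho>' v) \<bullet> h) \<le> norm (\<rho>' x - \<rho>' v) * norm h" by (simp add: Cauchy_Schwarz_ineq2)
        also have "\<dots> \<le> \<eta> * norm h" using x by (intro mult_right_mono) auto
        finally show "norm (((\<lambda>h. \<rho>' x \<bullet> h) - (\<lambda>h. \<rho>' v \<bullet> h)) h) \<le> \<eta> * norm h" by (simp add: inner_diff_left)
      qed (use assms in simp)
    next
      show "((\<lambda>x. \<rho> x) has_derivative (\<lambda>h. \<rho>' x \<bullet> h)) (at x within cball v r)" for x
        using deriv by (rule has_derivative_at_withinI)
    qed (use r in auto)
    then show "\<bar>\<rho> (v + w) - \<rho> v - \<rho>' v \<bullet> w\<bar> \<le> \<eta> * norm w" by (simp add: mult.commute)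
  qed
qed

text \<open>The test function y \<mapsto> \<rho> (x - y) has gradient -\<rho>' (x - y), which
  cancels the sign of the integration by parts. The right-hand side is the formal gradient of
  \<open>smear g\<close>, so smearing commutes with differentiation.\<close>

lemma smear_gradient:
  fixes g :: "'a \<Rightarrow> real" and G :: "'a \<Rightarrow> 'a"
  assumes g: "loc_int g" and [measurable]: "g \<in> borel_measurable borel"
    and G: "loc_int G" and [measurable]: "G \<in> borel_measurable borel"
    and weak: "\<And>\<phi> b. test_function \<phi> \<Longrightarrow> b \<in> Basis \<Longrightarrow>
       (\<integral>y. g y * partial_deriv b \<phi> y \<partial>lborel) = - (\<integral>y. (G y \<bullet> b) * \<phi> y \<partial>lborel)"
  shows "smear G x = (\<integral>y. g y *\<^sub>R \<rho>' (x - y) \<partial>lborel)"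
proof (rule euclidean_eqI)
  fix b :: 'a assume b: "b \<in> Basis"
  have pd: "partial_deriv b (\<lambda>y. \<rho> (x - y)) y = - (\<rho>' (x - y) \<bullet> b)" for y
  proof -
    have "((\<lambda>y. x - y) has_derivative (\<lambda>h. - h)) (at y)" by (auto intro!: derivative_eq_intros)
    then have "((\<lambda>y. \<rho> (x - y)) has_derivative (\<lambda>h. \<rho>' (x - y) \<bullet> (- h))) (at y)"
      by (rule has_derivative_compose[OF _ deriv])
    from fun_cong[OF frechet_derivative_at[OF this], of b] show ?thesis
      by (simp add: partial_deriv_def)
  qed
  have "smear G x \<bullet> b = (\<integral>y. (\<rho> (x - y) *\<^sub>R G y) \<bullet> b \<partial>lborel)"
    unfolding smear_def using integrable_smear[OF G, of x] by (intro integral_inner_left[symmetric]) simp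
  also have "\<dots> = (\<integral>y. (G y \<bullet> b) * \<rho> (x - y) \<partial>lborel)" by (simp add: mult.commute)
  also have "\<dots> = - (\<integral>y. g y * partial_deriv b (\<lambda>y. \<rho> (x - y)) y \<partial>lborel)"
    using weak[OF test b] by simp
  also have "\<dots> = (\<integral>y. (g y *\<^sub>R \<rho>' (x - y)) \<bullet> b \<partial>lborel)" by (simp add: pd)
  also have "\<dots> = (\<integral>y. g y *\<^sub>R \<rho>' (x - y) \<partial>lborel) \<bullet> b"
    using integrable_smear'[OF g, of x] by (intro integral_inner_left) simp
  finally show "smear G x \<bullet> b = (\<integral>y. g y *\<^sub>R \<rho>' (x - y) \<partial>lborel) \<bullet> b" .
qed

text \<open>The kernel estimate integrated against g. Since norm w <= 1 and \<delta> <= 1, only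
  points within distance 2 of z contribute. The bound therefore involves local mass only and stays
  meaningful when g has infinite integral.\<close>

lemma smear_taylor:
  fixes g :: "'a \<Rightarrow> real" and G :: "'a \<Rightarrow> 'a"
  assumes g: "loc_int g" and [measurable]: "g \<in> borel_measurable borel" and g0: "\<And>x. g x \<ge> 0"
    and grad: "\<And>x. smear G x = (\<integral>y. g y *\<^sub>R \<rho>' (x - y) \<partial>lborel)"
    and r: "0 < r" "r \<le> 1" and \<rho>: "\<And>v w. norm w \<le> r \<Longrightarrow> \<bar>\<rho> (v + w) - \<rho> v - \<rho>' v \<bullet> w\<bar> \<le> \<eta> * norm w"
    and w: "norm w \<le> r"
  shows "\<bar>smear g (z + w) - smear g z - smear G z \<bullet> w\<bar> \<le> \<eta> * norm w * (\<integral>y. indicator (cball z 2) y *\<^sub>R g y \<partial>lborel)"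
proof -
  note i1 = integrable_smear[OF g, of "z + w", simplified] integrable_smear[OF g, of z, simplified]
  have i2: "integrable lborel (\<lambda>y. (g y *\<^sub>R \<rho>' (z - y)) \<bullet> w)"
    using integrable_smear'[OF g, of z] by (intro integrable_inner_left) auto
  have e: "smear G z \<bullet> w = (\<integral>y. (g y *\<^sub>R \<rho>' (z - y)) \<bullet> w \<partial>lborel)"
    unfolding grad using integrable_smear'[OF g, of z] by (intro integral_inner_left[symmetric]) auto
  have "smear g (z + w) - smear g z - smear G z \<bullet> w
      = (\<integral>y. \<rho> (z + w - y) * g y - \<rho> (z - y) * g y - (g y *\<^sub>R \<rho>' (z - y)) \<bullet> w \<partial>lborel)"
    unfolding e unfolding smear_def using i1 i2 by simp
  also have "\<bar>\<dots>\<bar> \<le> (\<integral>y. \<eta> * norm w * (indicator (cball z 2) y *\<^sub>R g y) \<partial>lborel)"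
  proof (rule integral_abs_bound_integral)
    show "integrable lborel (\<lambda>y. \<eta> * norm w * (indicator (cball z 2) y *\<^sub>R g y))"
      using g unfolding loc_int_def by (intro integrable_mult_right) auto
    show "integrable lborel (\<lambda>y. \<rho> (z + w - y) * g y - \<rho> (z - y) * g y - (g y *\<^sub>R \<rho>' (z - y)) \<bullet> w)"
      using i1 i2 by auto
  next
    fix y
    show "\<bar>\<rho> (z + w - y) * g y - \<rho> (z - y) * g y - (g y *\<^sub>R \<rho>' (z - y)) \<bullet> w\<bar> \<le> \<eta> * norm w * (indicator (cball z 2) y *\<^sub>R g y)"
    proof (cases "y \<in> cball z 2")
      case True
      have "\<rho> (z + w - y) * g y - \<rho> (z - y) * g y - (g y *\<^sub>R \<rho>' (z - y)) \<bullet> w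
          = (\<rho> ((z - y) + w) - \<rho> (z - y) - \<rho>' (z - y) \<bullet> w) * g y"
        by (simp add: algebra_simps)
      then have "\<bar>\<rho> (z + w - y) * g y - \<rho> (z - y) * g y - (g y *\<^sub>R \<rho>' (z - y)) \<bullet> w\<bar>
          = \<bar>\<rho> ((z - y) + w) - \<rho> (z - y) - \<rho>' (z - y) \<bullet> w\<bar> * g y"
        by (simp only: abs_mult abs_of_nonneg[OF g0])
      also have "\<dots> \<le> \<eta> * norm w * g y" using g0 w by (intro mult_right_mono \<rho>) auto
      finally show ?thesis using True by simp
    next
      case False
      then have n: "norm (z - y) > 2" by (simp add: dist_norm)
      then have "norm (z + w - y) > 1"
        using norm_triangle_ineq4[of "z + w - y" w] w r by (simp add: algebra_simps)
      then have "\<rho> (z + w - y) = 0" "\<rho> (z - y) = 0" "\<rho>' (z - y) = 0"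
        using n delta supp supp' by (metis order_le_less_trans, simp, simp)
      then show ?thesis using False by simp
    qed
  qed
  finally show ?thesis by simp
qed

end

section \<open>Almost everywhere convergence of mollifications\<close>

lemma L1_approx_continuous:
  fixes f :: "'a::euclidean_space \<Rightarrow> real"
  assumes f: "integrable lborel f" and e: "e > 0"
  obtains h d where "continuous_on UNIV h" "\<And>x. norm x > d \<Longrightarrow> h x = 0" "(\<integral>x. \<bar>f x - h x\<bar> \<partial>lborel) \<le> e"
proof -
  have [measurable]: "f \<in> borel_measurable borel" using f by auto
  have "f measurable_on UNIV"
    by (rule lebesgue_measurable_imp_measurable_on_real) (auto intro: measurable_completion)
  then obtain N g where N: "negligible N" and g: "\<And>n. continuous_on UNIV (g n)"
    and lim: "\<And>x. x \<notin> N \<Longrightarrow> (\<lambda>n. g n x) \<longlonglongrightarrow> f x"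
    unfolding measurable_on_def by auto
  have AElim: "AE x in lborel. (\<lambda>n. g n x) \<longlonglongrightarrow> f x"
  proof -
    have "AE x in lebesgue. x \<notin> N" using N by (intro AE_not_in) (simp add: negligible_iff_null_sets)
    then have "AE x in lborel. x \<notin> N" by (simp add: AE_completion_iff)
    then show ?thesis by eventually_elim (rule lim)
  qed
  have [measurable]: "g n \<in> borel_measurable borel" for n using g by (rule borel_measurable_continuous_onI)
  \<comment> \<open>Truncates the value to [-k, k] and multiplies by a continuous spatial cut-off,
    so it preserves continuity and creates compact support. It also provides the majorants for two
    dominated convergences: k tends to infinity for f, then the continuous approximants
    \<open>g n\<close> converge with k fixed.\<close>
  define cut where "cut k y x = max 0 (min 1 (k + 1 - norm x)) * max (- k) (min k y)" for k y :: real and x :: 'a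
  have "(\<lambda>k. \<integral>x. \<bar>f x - cut (real k) (f x) x\<bar> \<partial>lborel) \<longlonglongrightarrow> (\<integral>x. 0 \<partial>(lborel::'a measure))"
  proof (rule integral_dominated_convergence)
    show "integrable lborel (\<lambda>x. 2 * \<bar>f x\<bar>)" using f by simp
    show "AE x in lborel. (\<lambda>k. \<bar>f x - cut (real k) (f x) x\<bar>) \<longlonglongrightarrow> 0"
    proof (intro AE_I2 tendsto_eventually)
      fix x
      obtain K where K: "norm x + \<bar>f x\<bar> \<le> real K" using real_arch_simple by blast
      show "\<forall>\<^sub>F k in sequentially. \<bar>f x - cut (real k) (f x) x\<bar> = 0"
      proof (rule eventually_sequentiallyI)
        fix k assume "K \<le> k"
        then have "norm x + \<bar>f x\<bar> \<le> real k" using K by (meson of_nat_le_iff order_trans)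
        then have "norm x \<le> real k" "\<bar>f x\<bar> \<le> real k" using norm_ge_zero[of x] by linarith+
        then show "\<bar>f x - cut (real k) (f x) x\<bar> = 0" by (auto simp: cut_def)
      qed
    qed
  next
    fix k :: nat
    show "AE x in lborel. norm \<bar>f x - cut (real k) (f x) x\<bar> \<le> 2 * \<bar>f x\<bar>"
    proof (intro AE_I2)
      fix x
      have "\<bar>cut (real k) (f x) x\<bar> \<le> 1 * \<bar>f x\<bar>" unfolding cut_def abs_mult by (intro mult_mono) auto
      then show "norm \<bar>f x - cut (real k) (f x) x\<bar> \<le> 2 * \<bar>f x\<bar>" by simp
    qed
  qed (auto simp: cut_def[abs_def])
  then have "\<forall>\<^sub>F k in sequentially. (\<integral>x. \<bar>f x - cut (real k) (f x) x\<bar> \<partial>lborel) < e / 2"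
    using e by (intro order_tendstoD) auto
  then obtain k :: nat where k: "(\<integral>x. \<bar>f x - cut (real k) (f x) x\<bar> \<partial>lborel) < e / 2"
    by (auto simp: eventually_sequentially)
  have ib: "integrable lborel (\<lambda>x. indicator (cball (0::'a) (real k + 1)) x *\<^sub>R (2 * real k) :: real)"
    using emeasure_bounded_finite[OF bounded_cball, of "0::'a" "real k + 1"]
    by (intro integrable_real_indicator[THEN integrable_scaleR_left]) auto
  have bd: "\<bar>cut (real k) y x\<bar> \<le> indicator (cball 0 (real k + 1)) x *\<^sub>R real k" for y x
  proof (cases "norm x > real k + 1")
    case True
    then show ?thesis by (simp add: cut_def)
  next
    case False
    have "\<bar>cut (real k) y x\<bar> \<le> 1 * real k" unfolding cut_def abs_mult by (intro mult_mono) auto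
    then show ?thesis using False by simp
  qed
  have "(\<lambda>n. \<integral>x. \<bar>cut (real k) (f x) x - cut (real k) (g n x) x\<bar> \<partial>lborel) \<longlonglongrightarrow> (\<integral>x. 0 \<partial>(lborel::'a measure))"
  proof (rule integral_dominated_convergence[OF _ _ ib])
    show "AE x in lborel. (\<lambda>n. \<bar>cut (real k) (f x) x - cut (real k) (g n x) x\<bar>) \<longlonglongrightarrow> 0"
      using AElim
    proof eventually_elim
      case (elim x)
      then have "(\<lambda>n. \<bar>cut (real k) (f x) x - cut (real k) (g n x) x\<bar>) \<longlonglongrightarrow> \<bar>cut (real k) (f x) x - cut (real k) (f x) x\<bar>"
        unfolding cut_def by (intro tendsto_intros)
      then show ?case by simp
    qed
  next
    fix n
    show "AE x in lborel. norm \<bar>cut (real k) (f x) x - cut (real k) (g n x) x\<bar> \<le> indicator (cball 0 (real k + 1)) x *\<^sub>R (2 * real k)"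
    proof (intro AE_I2)
      fix x
      show "norm \<bar>cut (real k) (f x) x - cut (real k) (g n x) x\<bar> \<le> indicator (cball 0 (real k + 1)) x *\<^sub>R (2 * real k)"
        using bd[of "f x" x] bd[of "g n x" x] by (simp add: abs_le_iff)
    qed
  qed (auto simp: cut_def[abs_def])
  then have "\<forall>\<^sub>F n in sequentially. (\<integral>x. \<bar>cut (real k) (f x) x - cut (real k) (g n x) x\<bar> \<partial>lborel) < e / 2"
    using e by (intro order_tendstoD) auto
  then obtain n where n: "(\<integral>x. \<bar>cut (real k) (f x) x - cut (real k) (g n x) x\<bar> \<partial>lborel) < e / 2"
    by (auto simp: eventually_sequentially)
  have ic: "integrable lborel (\<lambda>x. cut (real k) (y x) x)" if [measurable]: "y \<in> borel_measurable borel" for y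
  proof (rule integrable_bounded_support[where B="real k" and R="real k + 1"])
    show "\<bar>cut (real k) (y x) x\<bar> \<le> real k" for x using bd[of "y x" x] by (cases "norm x \<le> real k + 1") auto
    show "norm x \<le> real k + 1" if "cut (real k) (y x) x \<noteq> 0" for x using bd[of "y x" x] that by (cases "norm x \<le> real k + 1") auto
  qed (simp add: cut_def[abs_def])
  show ?thesis
  proof (rule that)
    show "continuous_on UNIV (\<lambda>x. cut (real k) (g n x) x)"
      unfolding cut_def by (intro continuous_intros g)
    show "cut (real k) (g n x) x = 0" if "norm x > real k + 1" for x using that by (simp add: cut_def)
    have "(\<integral>x. \<bar>f x - cut (real k) (g n x) x\<bar> \<partial>lborel)
       \<le> (\<integral>x. \<bar>f x - cut (real k) (f x) x\<bar> + \<bar>cut (real k) (f x) x - cut (real k) (g n x) x\<bar> \<partial>lborel)"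
      using f ic[of f] ic[of "g n"] by (intro integral_mono) auto
    also have "\<dots> \<le> e" using f ic[of f] ic[of "g n"] k n by (subst Bochner_Integration.integral_add) auto
    finally show "(\<integral>x. \<bar>f x - cut (real k) (g n x) x\<bar> \<partial>lborel) \<le> e" .
  qed
qed

lemma loc_int_integrable: "integrable lborel f \<Longrightarrow> loc_int f"
  unfolding loc_int_def by (auto intro!: integrable_mult_indicator)

context mollifier
begin

lemma integrable_smear_fun:
  fixes f :: "'a \<Rightarrow> real"
  assumes f: "integrable lborel f"
  shows "integrable lborel (smear f)" "(\<integral>x. \<bar>smear f x\<bar> \<partial>lborel) \<le> (\<integral>x. \<bar>f x\<bar> \<partial>lborel)"
proof -
  have [measurable]: "f \<in> borel_measurable borel" using f by auto
  have l: "loc_int (\<lambda>x. \<bar>f x\<bar>)" using f by (intro loc_int_integrable) auto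
  have le: "\<bar>smear f x\<bar> \<le> smear (\<lambda>x. \<bar>f x\<bar>) x" for x
    unfolding smear_def using integral_abs_bound[of lborel "\<lambda>y. \<rho> (x - y) * f y"] nonneg by (simp add: abs_mult)
  have "(\<integral>\<^sup>+x. ennreal \<bar>smear f x\<bar> \<partial>lborel) \<le> (\<integral>\<^sup>+x. ennreal (smear (\<lambda>x. \<bar>f x\<bar>) x) \<partial>lborel)"
    using le by (intro nn_integral_mono ennreal_leI)
  also have "\<dots> = (\<integral>\<^sup>+x. ennreal \<bar>f x\<bar> \<partial>lborel)" using l by (intro nn_integral_smear) auto
  also have "\<dots> = ennreal (\<integral>x. \<bar>f x\<bar> \<partial>lborel)" using f by (intro nn_integral_eq_integral) auto
  finally have *: "(\<integral>\<^sup>+x. ennreal \<bar>smear f x\<bar> \<partial>lborel) \<le> ennreal (\<integral>x. \<bar>f x\<bar> \<partial>lborel)" .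
  show i: "integrable lborel (smear f)"
    using * by (intro integrableI_bounded) (auto simp: le_less_trans[OF _ ennreal_less_top])
  have "ennreal (\<integral>x. \<bar>smear f x\<bar> \<partial>lborel) \<le> ennreal (\<integral>x. \<bar>f x\<bar> \<partial>lborel)"
    using * i by (subst nn_integral_eq_integral[symmetric]) auto
  then show "(\<integral>x. \<bar>smear f x\<bar> \<partial>lborel) \<le> (\<integral>x. \<bar>f x\<bar> \<partial>lborel)" by (simp add: ennreal_le_iff)
qed

text \<open>Three-term splitting through h: smearing contracts the L1 norm, so the two terms with f
  - h cost e each, while smear h - h is at most e' on the ball of radius d + 1 and vanishes
  outside.\<close>

lemma smear_L1_error:
  fixes f h :: "'a \<Rightarrow> real"
  assumes f: "integrable lborel f" and h: "continuous_on UNIV h" "\<And>x. norm x > d \<Longrightarrow> h x = 0"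
    and fh: "(\<integral>x. \<bar>f x - h x\<bar> \<partial>lborel) \<le> e"
    and mod: "\<And>x y. norm (x - y) \<le> \<delta> \<Longrightarrow> norm (h x - h y) \<le> e'" and e': "e' \<ge> 0"
  shows "(\<integral>x. \<bar>smear f x - f x\<bar> \<partial>lborel) \<le> 2 * e + e' * measure lborel (cball (0::'a) (d + 1))"
proof -
  have [measurable]: "f \<in> borel_measurable borel" using f by auto
  have [measurable]: "h \<in> borel_measurable borel" using h(1) by (rule borel_measurable_continuous_onI)
  obtain B where B: "B > 0" "\<And>x. norm (h x) \<le> B"
    using continuous_compact_support_bounded[OF h] by blast
  have ih: "integrable lborel h"
    using B h(2) by (intro integrable_bounded_support[where B=B and R=d]) (auto simp: not_less[symmetric])
  note if' = integrable_smear[OF loc_int_integrable[OF f], simplified]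
  note ih' = integrable_smear[OF loc_int_integrable[OF ih], simplified]
  have diff: "smear (\<lambda>x. f x - h x) x = smear f x - smear h x" for x
    unfolding smear_def using if'[of x] ih'[of x] by (simp add: right_diff_distrib)
  have ib: "integrable lborel (\<lambda>x. indicator (cball (0::'a) (d + 1)) x *\<^sub>R e' :: real)"
    using emeasure_bounded_finite[OF bounded_cball, of "0::'a" "d + 1"]
    by (intro integrable_real_indicator[THEN integrable_scaleR_left]) auto
  have pt: "\<bar>smear h x - h x\<bar> \<le> indicator (cball 0 (d + 1)) x *\<^sub>R e'" for x
  proof -
    have eq: "smear h x - h x = (\<integral>y. \<rho> (x - y) * (h y - h x) \<partial>lborel)"
      unfolding smear_def using ih'[of x] integral_kernel_1[of x] by (simp add: right_diff_distrib)
    show ?thesis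
    proof (cases "x \<in> cball 0 (d + 1)")
      case True
      have i: "integrable lborel (\<lambda>y. \<rho> (x - y) * (h y - h x))"
        using ih'[of x] integral_kernel_1[of x] by (simp add: right_diff_distrib)
      have "\<bar>smear h x - h x\<bar> \<le> (\<integral>y. \<rho> (x - y) * e' \<partial>lborel)"
        unfolding eq
      proof (rule integral_abs_bound_integral[OF i])
        fix y
        have "\<rho> (x - y) * \<bar>h y - h x\<bar> \<le> \<rho> (x - y) * e'"
        proof (cases "norm (x - y) \<le> \<delta>")
          case True
          then show ?thesis using mod[of y x] nonneg by (intro mult_left_mono) (auto simp: norm_minus_commute)
        qed (simp add: supp)
        then show "\<bar>\<rho> (x - y) * (h y - h x)\<bar> \<le> \<rho> (x - y) * e'" using nonneg by (simp add: abs_mult)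
      qed (use integral_kernel_1[of x] in simp)
      then show ?thesis using True integral_kernel_1[of x] by simp
    next
      case False
      then have x: "norm x > d + 1" by simp
      have z: "\<rho> (x - y) * (h y - h x) = 0" for y
      proof (cases "norm (x - y) > \<delta>")
        case False
        then have "norm y > d" using x delta norm_triangle_ineq3[of x y] by linarith
        then show ?thesis using h(2)[of y] h(2)[of x] x by simp
      qed (simp add: supp)
      show ?thesis using False unfolding eq z by simp
    qed
  qed
  have i1: "integrable lborel (\<lambda>x. \<bar>smear (\<lambda>x. f x - h x) x\<bar>)" using integrable_smear_fun(1)[of "\<lambda>x. f x - h x"] f ih by auto
  have i2: "integrable lborel (\<lambda>x. \<bar>f x - h x\<bar>)" using f ih by auto
  have "(\<integral>x. \<bar>smear f x - f x\<bar> \<partial>lborel)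
     \<le> (\<integral>x. \<bar>smear (\<lambda>x. f x - h x) x\<bar> + (indicator (cball 0 (d + 1)) x *\<^sub>R e' + \<bar>f x - h x\<bar>) \<partial>lborel)"
  proof (intro integral_mono)
    show "integrable lborel (\<lambda>x. \<bar>smear f x - f x\<bar>)" using integrable_smear_fun(1)[OF f] f by auto
    show "integrable lborel (\<lambda>x. \<bar>smear (\<lambda>x. f x - h x) x\<bar> + (indicator (cball 0 (d + 1)) x *\<^sub>R e' + \<bar>f x - h x\<bar>))"
      using i1 i2 ib by auto
    show "\<bar>smear f x - f x\<bar> \<le> \<bar>smear (\<lambda>x. f x - h x) x\<bar> + (indicator (cball 0 (d + 1)) x *\<^sub>R e' + \<bar>f x - h x\<bar>)" for x
      using pt[of x] unfolding diff by linarith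
  qed
  also have "\<dots> = (\<integral>x. \<bar>smear (\<lambda>x. f x - h x) x\<bar> \<partial>lborel) + ((\<integral>x. indicator (cball (0::'a) (d + 1)) x *\<^sub>R e' \<partial>lborel) + (\<integral>x. \<bar>f x - h x\<bar> \<partial>lborel))"
    using i1 i2 ib by (subst Bochner_Integration.integral_add) (auto simp: Bochner_Integration.integral_add)
  also have "(\<integral>x. indicator (cball (0::'a) (d + 1)) x *\<^sub>R e' \<partial>lborel) = measure lborel (cball (0::'a) (d + 1)) * e'"
    using emeasure_bounded_finite[OF bounded_cball, of "0::'a" "d + 1"] by simp
  also have "(\<integral>x. \<bar>smear (\<lambda>x. f x - h x) x\<bar> \<partial>lborel) \<le> e"
    using integrable_smear_fun(2)[of "\<lambda>x. f x - h x"] f ih fh by simp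
  finally show ?thesis using fh by (simp add: mult.commute)
qed

end

text \<open>Kernels of shrinking support give convergence in L1, and a subsequence converges almost
  everywhere; hence the kernels are chosen depending on f.\<close>

theorem mollifier_sequence:
  fixes f :: "'a::euclidean_space \<Rightarrow> real"
  assumes f: "integrable lborel f"
  obtains \<rho> :: "nat \<Rightarrow> 'a \<Rightarrow> real" and \<rho>' :: "nat \<Rightarrow> 'a \<Rightarrow> 'a" and \<delta> :: "nat \<Rightarrow> real"
  where "\<And>k. mollifier (\<rho> k) (\<rho>' k) (\<delta> k)" "AE x in lborel. (\<lambda>k. mollifier.smear (\<rho> k) f x) \<longlonglongrightarrow> f x"
proof -
  have "\<exists>\<rho> \<rho>'. mollifier (\<rho> :: 'a \<Rightarrow> real) \<rho>' (1 / real (Suc k))" for k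
  proof -
    have d: "1 / real (Suc k) > 0" by simp
    show ?thesis
    proof (rule mollifier_exists[OF d])
      fix \<rho> :: "'a \<Rightarrow> real" and \<rho>'
      assume "\<And>x. \<rho> x \<ge> 0" "\<And>x. norm x > 1 / real (Suc k) \<Longrightarrow> \<rho> x = 0" "(\<integral>\<^sup>+x. ennreal (\<rho> x) \<partial>lborel) = 1"
        "\<And>x. (\<rho> has_derivative (\<lambda>h. \<rho>' x \<bullet> h)) (at x)" "continuous_on UNIV \<rho>'"
        "\<And>x. norm x > 1 / real (Suc k) \<Longrightarrow> \<rho>' x = 0" "\<And>x. test_function (\<lambda>y. \<rho> (x - y))"
      then have "mollifier \<rho> \<rho>' (1 / real (Suc k))" by unfold_locales auto
      then show ?thesis by blast
    qed
  qed
  then obtain \<rho> \<rho>' where m: "\<And>k. mollifier (\<rho> k :: 'a \<Rightarrow> real) (\<rho>' k) (1 / real (Suc k))" by metis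
  have "(\<lambda>k. \<integral>x. norm (mollifier.smear (\<rho> k) f x - f x) \<partial>lborel) \<longlonglongrightarrow> 0"
  proof (rule LIMSEQ_I)
    fix \<epsilon> :: real assume \<epsilon>: "\<epsilon> > 0"
    then have "\<epsilon> / 8 > 0" by simp
    from L1_approx_continuous[OF f this] obtain h d where h: "continuous_on UNIV h" "\<And>x. norm x > d \<Longrightarrow> h x = 0"
      "(\<integral>x. \<bar>f x - h x\<bar> \<partial>lborel) \<le> \<epsilon> / 8" by metis
    define V where "V = measure lborel (cball (0::'a) (d + 1))"
    have V: "V \<ge> 0" by (simp add: V_def)
    define e' where "e' = \<epsilon> / (4 * (V + 1))"
    have e': "e' > 0" "e' * V \<le> \<epsilon> / 4" using \<epsilon> V by (auto simp: e'_def field_simps)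
    obtain r where r: "r > 0" "\<And>x y. norm (x - y) \<le> r \<Longrightarrow> norm (h x - h y) \<le> e'"
      using continuous_compact_support_uniform[OF h(1,2) e'(1)] by metis
    obtain K where K: "1 / real (Suc K) < r" using r(1) nat_approx_posE by blast
    show "\<exists>K. \<forall>k\<ge>K. norm ((\<integral>x. norm (mollifier.smear (\<rho> k) f x - f x) \<partial>lborel) - 0) < \<epsilon>"
    proof (intro exI allI impI)
      fix k assume "k \<ge> K"
      then have "1 / real (Suc k) \<le> 1 / real (Suc K)" by (simp add: frac_le)
      then have k: "1 / real (Suc k) \<le> r" using K by linarith
      have "(\<integral>x. \<bar>mollifier.smear (\<rho> k) f x - f x\<bar> \<partial>lborel) \<le> 2 * (\<epsilon> / 8) + e' * V"
        unfolding V_def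
        by (rule mollifier.smear_L1_error[OF m f h(1,2,3)]) (use r(2) k e' in auto)
      also have "\<dots> < \<epsilon>" using e' \<epsilon> by simp
      finally show "norm ((\<integral>x. norm (mollifier.smear (\<rho> k) f x - f x) \<partial>lborel) - 0) < \<epsilon>" by simp
    qed
  qed
  then obtain s where s: "AE x in lborel. (\<lambda>k. mollifier.smear (\<rho> (s k)) f x - f x) \<longlonglongrightarrow> 0"
    using tendsto_L1_AE_subseq[of lborel "\<lambda>k x. mollifier.smear (\<rho> k) f x - f x"]
      mollifier.integrable_smear_fun(1)[OF m f] f by auto
  show ?thesis
  proof (rule that[of "\<lambda>k. \<rho> (s k)" "\<lambda>k. \<rho>' (s k)" "\<lambda>k. 1 / real (Suc (s k))"])
    show "AE x in lborel. (\<lambda>k. mollifier.smear (\<rho> (s k)) f x) \<longlonglongrightarrow> f x"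
      using s by eventually_elim (simp add: LIM_zero_iff)
  qed (rule m)
qed

section \<open>Passage to the limit\<close>

lemma gamma_const_pos:
  assumes "p > 1" "n > 0"
  shows "gamma_const n p > 0"
proof -
  define q where "q = p / (p - 1)"
  have q: "q > 0" using assms by (simp add: q_def)
  have "Gamma (real n / 2 + 1) / Gamma (real n / q + 1) > 0"
    using assms q by (intro divide_pos_pos Gamma_real_pos add_pos_pos) auto
  moreover define G where "G = Gamma (real n / 2 + 1) / Gamma (real n / q + 1)"
  ultimately have "G \<noteq> 0" by (metis less_irrefl)
  then show ?thesis
    unfolding gamma_const_def Let_def q_def[symmetric] G_def[symmetric] using assms q by (intro mult_pos_pos) auto
qed

context mollifier
begin

text \<open>Beyond radius r + 1 the kernel sees only the part of g outside the ball of radius r, so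
  \<open>smear g\<close> is at most that tail mass times a bound B of the kernel. This gives the
  truncation in \<open>nash_smear\<close> its bounded support.\<close>

lemma smear_vanishes_at_infinity:
  fixes g :: "'a \<Rightarrow> real"
  assumes g: "integrable lborel g" and g0: "\<And>x. g x \<ge> 0" and e: "e > 0"
  obtains R where "R > 0" "\<And>x. norm x > R \<Longrightarrow> smear g x \<le> e"
proof -
  have [measurable]: "g \<in> borel_measurable borel" using g by auto
  obtain B where B: "B > 0" "\<And>x. norm (\<rho> x) \<le> B"
    using continuous_compact_support_bounded[OF cont supp] by blast
  have B': "\<rho> x \<le> B" for x using B(2)[of x] by simp
  define I where "I = (\<integral>x. g x \<partial>lborel)"
  have I: "(\<integral>\<^sup>+x. ennreal (g x) \<partial>lborel) = ennreal I"
    unfolding I_def using g g0 by (intro nn_integral_eq_integral) auto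
  have I0: "I \<ge> 0" unfolding I_def using g0 by simp
  have inn: "integrable lborel (\<lambda>x. g x * indicator (cball 0 r) x)" for r
    using integrable_mult_indicator[OF _ g, of "cball 0 r"] by (simp add: mult.commute)
  have "\<exists>r>0. I - e / B < (\<integral>x. g x * indicator (cball 0 r) x \<partial>lborel)"
  \<comment> \<open>\<open>ennreal\<close> maps negative numbers to 0, so the comparison in the
    extended half-line is reserved for a nonnegative left side.\<close>
  proof (cases "I - e / B < 0")
    case True
    have "0 \<le> (\<integral>x. g x * indicator (cball 0 1) x \<partial>lborel)" using g0 by (intro integral_nonneg_AE) auto
    then show ?thesis using True by (intro exI[of _ 1]) auto
  next
    case False
    then have "ennreal (I - e / B) < (\<integral>\<^sup>+x. ennreal (g x) \<partial>lborel)"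
      unfolding I using divide_pos_pos[OF e B(1)] by (intro ennreal_lessI) linarith+
    then obtain r where r: "r > 0" "ennreal (I - e / B) < (\<integral>\<^sup>+x. ennreal (g x) * indicator (cball 0 r) x \<partial>lborel)"
      by (rule nn_integral_exhaust_cball[rotated]) auto
    note r(2)
    also have "(\<integral>\<^sup>+x. ennreal (g x) * indicator (cball 0 r) x \<partial>lborel) = (\<integral>\<^sup>+x. ennreal (g x * indicator (cball 0 r) x) \<partial>lborel)"
      by (intro nn_integral_cong) (auto simp: indicator_def)
    also have "\<dots> = ennreal (\<integral>x. g x * indicator (cball 0 r) x \<partial>lborel)"
      using inn g0 by (intro nn_integral_eq_integral) auto
    finally have "I - e / B < (\<integral>x. g x * indicator (cball 0 r) x \<partial>lborel)"
      using False by (simp add: ennreal_less_iff)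
    then show ?thesis using r by blast
  qed
  then obtain r where r: "r > 0" "I - e / B < (\<integral>x. g x * indicator (cball 0 r) x \<partial>lborel)" by blast
  show ?thesis
  proof (rule that[of "r + 1"])
    fix x :: 'a assume x: "norm x > r + 1"
    have "smear g x \<le> (\<integral>y. B * (g y - g y * indicator (cball 0 r) y) \<partial>lborel)"
      unfolding smear_def
    proof (rule integral_mono)
      show "integrable lborel (\<lambda>y. \<rho> (x - y) *\<^sub>R g y)" using loc_int_integrable[OF g] by (rule integrable_smear) simp
      show "integrable lborel (\<lambda>y. B * (g y - g y * indicator (cball 0 r) y))" using g inn[of r] by auto
      fix y
      show "\<rho> (x - y) *\<^sub>R g y \<le> B * (g y - g y * indicator (cball 0 r) y)"
      proof (cases "norm y \<le> r")
        case True
        then have "norm (x - y) > \<delta>" using x delta norm_triangle_ineq2[of x y] by linarith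
        then show ?thesis using True supp by simp
      next
        case False
        then show ?thesis using B' g0 by (simp add: mult_right_mono)
      qed
    qed
    also have "\<dots> = B * (I - (\<integral>x. g x * indicator (cball 0 r) x \<partial>lborel))"
      using g inn[of r] by (simp add: I_def)
    also have "\<dots> \<le> B * (e / B)" using r B by (intro mult_left_mono) auto
    finally show "smear g x \<le> e" using B by simp
  qed (use r in auto)
qed

text \<open>Applies \<open>nash_regular\<close> to the truncation of \<open>smear g\<close>, with
  the norm of \<open>smear G\<close> as \<open>D\<close>. The result is solved for the integral,
  because Fatou's lemma needs a bound on the integral itself and not on a power of it.\<close>

lemma nash_smear:
  fixes g :: "'a \<Rightarrow> real" and G :: "'a \<Rightarrow> 'a" and p q :: real
  assumes p: "p > 1" and q: "q = p / (p - 1)"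
    and g: "integrable lborel g" and g0: "\<And>x. g x \<ge> 0"
    and G: "loc_int G" and [measurable]: "G \<in> borel_measurable borel"
    and weak: "\<And>\<phi> b. test_function \<phi> \<Longrightarrow> b \<in> Basis \<Longrightarrow>
       (\<integral>y. g y * partial_deriv b \<phi> y \<partial>lborel) = - (\<integral>y. (G y \<bullet> b) * \<phi> y \<partial>lborel)"
    and N: "(\<integral>\<^sup>+x. ennreal (norm (G x) powr p) \<partial>lborel) \<le> ennreal N" "N > 0"
    and c: "c > 0"
  shows "(\<integral>\<^sup>+x. ennreal (max 0 (smear g x - c) powr p) \<partial>lborel)
     \<le> ennreal ((p powr p * inverse (gamma_const DIM('a) p) * (\<integral>x. g x \<partial>lborel) powr (p * q / DIM('a)) * N) powr (1 / (1 + q / DIM('a))))"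
proof -
  have gm[measurable]: "g \<in> borel_measurable borel" using g by auto
  note gl = loc_int_integrable[OF g]
  define u where "u x = max 0 (smear g x - c)" for x
  define D where "D x = norm (smear G x)" for x
  define I where "I = (\<integral>x. g x \<partial>lborel)"
  have I0: "I \<ge> 0" unfolding I_def using g0 by simp
  have q0: "q > 0" using p by (simp add: q)
  have um[measurable]: "u \<in> borel_measurable borel" unfolding u_def[abs_def] by measurable
  have Dm[measurable]: "D \<in> borel_measurable borel" unfolding D_def[abs_def] by measurable
  obtain R where R: "R > 0" "\<And>x. norm x > R \<Longrightarrow> smear g x \<le> c"
    using smear_vanishes_at_infinity[OF g g0 c] by blast
  obtain B where B: "B > 0" "\<And>x. norm (\<rho> x) \<le> B"
    using continuous_compact_support_bounded[OF cont supp] by blast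
  obtain B' where B': "B' > 0" "\<And>x. norm (\<rho>' x) \<le> B'"
    using continuous_compact_support_bounded[OF cont' supp'] by blast
  have u0: "u x \<ge> 0" for x by (simp add: u_def)
  have uM: "u x \<le> B * I" for x
  proof -
    have "smear g x \<le> (\<integral>y. B * g y \<partial>lborel)"
      unfolding smear_def
    proof (rule integral_mono)
      show "integrable lborel (\<lambda>y. \<rho> (x - y) *\<^sub>R g y)" using gl by (rule integrable_smear) simp
      show "integrable lborel (\<lambda>y. B * g y)" using g by simp
      show "\<rho> (x - y) *\<^sub>R g y \<le> B * g y" for y using B(2)[of "x - y"] g0 by (auto intro!: mult_right_mono)
    qed
    then have "smear g x \<le> B * I" by (simp add: I_def)
    moreover have "0 \<le> B * I" using B I0 by simp
    ultimately show ?thesis using c by (auto simp: u_def)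
  qed
  have uR: "u x \<noteq> 0 \<Longrightarrow> norm x \<le> R" for x using R(2)[of x] by (fastforce simp: u_def)
  have grad: "smear G x = (\<integral>y. g y *\<^sub>R \<rho>' (x - y) \<partial>lborel)" for x
    using gl gm G \<open>G \<in> borel_measurable borel\<close> weak by (rule smear_gradient)
  have DL: "D x \<le> B' * I" for x
  proof -
    have "D x \<le> (\<integral>y. norm (g y *\<^sub>R \<rho>' (x - y)) \<partial>lborel)" unfolding D_def grad by (rule integral_norm_bound)
    also have "\<dots> \<le> (\<integral>y. B' * g y \<partial>lborel)"
    proof (rule integral_mono)
      show "integrable lborel (\<lambda>y. norm (g y *\<^sub>R \<rho>' (x - y)))" using integrable_smear'[OF gl gm] by (rule integrable_norm)
      show "integrable lborel (\<lambda>y. B' * g y)" using g by simp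
      show "norm (g y *\<^sub>R \<rho>' (x - y)) \<le> B' * g y" for y
        using mult_right_mono[OF B'(2)[of "x - y"] g0[of y]] g0[of y] by (simp add: mult.commute)
    qed
    finally show ?thesis by (simp add: I_def)
  qed
  have lip: "\<exists>r>0. \<forall>z w. norm w \<le> r \<longrightarrow> u (z + w) \<le> u z + norm w * (D z + \<eta>)" if \<eta>: "\<eta> > 0" for \<eta>
  proof -
    \<comment> \<open>Integration against g multiplies the kernel error by at most the mass
      \<open>I\<close>, which leaves at most \<eta>.\<close>
    define \<eta>' where "\<eta>' = \<eta> / (I + 1)"
    have \<eta>': "\<eta>' > 0" "\<eta>' * I \<le> \<eta>" using \<eta> I0 by (auto simp: \<eta>'_def field_simps)
    obtain r where r: "r > 0" "r \<le> 1" "\<And>v w. norm w \<le> r \<Longrightarrow> \<bar>\<rho> (v + w) - \<rho> v - \<rho>' v \<bullet> w\<bar> \<le> \<eta>' * norm w"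
      using kernel_taylor[OF \<eta>'(1)] by blast
    show ?thesis
    proof (intro exI[of _ r] conjI allI impI r(1))
      fix z w :: 'a assume w: "norm w \<le> r"
      have "(\<integral>y. indicator (cball z 2) y *\<^sub>R g y \<partial>lborel) \<le> I"
        unfolding I_def using gl g g0 by (intro integral_mono) (auto simp: loc_int_def indicator_def)
      then have "\<eta>' * norm w * (\<integral>y. indicator (cball z 2) y *\<^sub>R g y \<partial>lborel) \<le> \<eta>' * norm w * I"
        using \<eta>' by (intro mult_left_mono) auto
      also have "\<dots> \<le> \<eta> * norm w" using mult_right_mono[OF \<eta>'(2), of "norm w"] by (simp add: mult_ac)
      finally have "smear g (z + w) - smear g z - smear G z \<bullet> w \<le> \<eta> * norm w"
        using smear_taylor[OF gl gm g0 grad r w, of z] by linarith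
      moreover have "smear G z \<bullet> w \<le> D z * norm w" unfolding D_def by (rule norm_cauchy_schwarz)
      ultimately have *: "smear g (z + w) \<le> smear g z + norm w * (D z + \<eta>)" by (simp add: algebra_simps)
      have "norm w * (D z + \<eta>) \<ge> 0" using \<eta> by (simp add: D_def)
      then show "u (z + w) \<le> u z + norm w * (D z + \<eta>)" using * unfolding u_def by linarith
    qed
  qed
  have DN: "(\<integral>\<^sup>+x. ennreal (D x powr p) \<partial>lborel) \<le> ennreal N"
    unfolding D_def using order_trans[OF smear_norm_powr_le[OF G _ p] N(1)] by simp
  have iu: "integrable lborel (\<lambda>x. u x powr p)"
    using u0 uM uR p by (intro integrable_bounded_support[where B="(B * I) powr p" and R=R]) (auto intro!: powr_mono2)
  have iu1: "integrable lborel u"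
    using u0 uM uR by (intro integrable_bounded_support[where B="B * I" and R=R]) auto
  define C where "C = p powr p * inverse (gamma_const DIM('a) p)"
  have C: "C > 0" using gamma_const_pos[OF p, of "DIM('a)"] p by (simp add: C_def)
  define e where "e = 1 + q / DIM('a)"
  have e: "e > 0" using q0 by (simp add: e_def add_pos_pos)
  have "(\<integral>x. u x powr p \<partial>lborel) \<le> (C * I powr (p * q / DIM('a)) * N) powr (1 / e)"
  proof (cases "(\<integral>x. u x powr p \<partial>lborel) > 0")
    case True
    have "(\<integral>x. u x powr p \<partial>lborel) powr e \<le> C * (\<integral>x. u x \<partial>lborel) powr (p * q / DIM('a)) * N"
      unfolding e_def C_def
      by (rule nash_regular[OF p q um u0 uM uR Dm _ DL lip True DN N(2)]) (use R in \<open>auto simp: D_def\<close>)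
    also have "\<dots> \<le> C * I powr (p * q / DIM('a)) * N"
    proof -
      have "(\<integral>x. u x \<partial>lborel) \<le> (\<integral>x. smear g x \<partial>lborel)"
      proof (intro integral_mono iu1 integrable_smear_fun(1) g)
        show "u x \<le> smear g x" for x using smear_nonneg[of g x, OF g0] c by (simp add: u_def)
      qed
      also have "\<dots> \<le> (\<integral>x. \<bar>smear g x\<bar> \<partial>lborel)" using integrable_smear_fun(1)[OF g] by (intro integral_mono) auto
      also have "\<dots> \<le> I" using integrable_smear_fun(2)[OF g] g0 by (simp add: I_def)
      finally show ?thesis using C N p q0 u0 by (intro mult_right_mono mult_left_mono powr_mono2) auto
    qed
    finally have "((\<integral>x. u x powr p \<partial>lborel) powr e) powr (1 / e) \<le> (C * I powr (p * q / DIM('a)) * N) powr (1 / e)"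
      using e by (intro powr_mono2) auto
    then show ?thesis using e True by (simp add: powr_powr)
  next
    case False
    have "0 \<le> (C * I powr (p * q / DIM('a)) * N) powr (1 / e)" by simp
    then show ?thesis using False by linarith
  qed
  then have "ennreal (\<integral>x. u x powr p \<partial>lborel) \<le> ennreal ((C * I powr (p * q / DIM('a)) * N) powr (1 / e))"
    by (rule ennreal_leI)
  moreover have "(\<integral>\<^sup>+x. ennreal (u x powr p) \<partial>lborel) = ennreal (\<integral>x. u x powr p \<partial>lborel)"
    using iu by (intro nn_integral_eq_integral) auto
  ultimately show ?thesis by (simp add: u_def I_def C_def e_def)
qed

end

lemma nash_integrable:
  fixes g :: "'a::euclidean_space \<Rightarrow> real" and G :: "'a \<Rightarrow> 'a" and p q P N :: real
  assumes p: "p > 1" and q: "q = p / (p - 1)"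
    and g: "integrable lborel g" and g0: "\<And>x. g x \<ge> 0"
    and G: "loc_int G" "G \<in> borel_measurable borel"
    and weak: "\<And>\<phi> b. test_function \<phi> \<Longrightarrow> b \<in> Basis \<Longrightarrow>
       (\<integral>y. g y * partial_deriv b \<phi> y \<partial>lborel) = - (\<integral>y. (G y \<bullet> b) * \<phi> y \<partial>lborel)"
    and N: "(\<integral>\<^sup>+x. ennreal (norm (G x) powr p) \<partial>lborel) = ennreal N" "N \<ge> 0"
    and P: "(\<integral>\<^sup>+x. ennreal (g x powr p) \<partial>lborel) = ennreal P" "P \<ge> 0"
  shows "P powr (1 + q / DIM('a)) \<le> p powr p * inverse (gamma_const DIM('a) p) * (\<integral>x. g x \<partial>lborel) powr (p * q / DIM('a)) * N"
proof -
  have gm[measurable]: "g \<in> borel_measurable borel" using g by auto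
  define A where "A = p powr p * inverse (gamma_const DIM('a) p) * (\<integral>x. g x \<partial>lborel) powr (p * q / DIM('a))"
  define e where "e = 1 + q / DIM('a)"
  have q0: "q > 0" using p by (simp add: q)
  have e: "e > 0" using q0 by (simp add: e_def add_pos_pos)
  have A: "A \<ge> 0" using gamma_const_pos[OF p, of "DIM('a)"] by (simp add: A_def)
  obtain \<rho> \<rho>' \<delta> where m: "\<And>k. mollifier (\<rho> k) (\<rho>' k) (\<delta> k)"
    and lim: "AE x in lborel. (\<lambda>k. mollifier.smear (\<rho> k) g x) \<longlonglongrightarrow> g x"
    using mollifier_sequence[OF g] by blast
  define u where "u k x = max 0 (mollifier.smear (\<rho> k) g x - 1 / real (Suc k))" for k x
  have um[measurable]: "u k \<in> borel_measurable borel" for k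
    unfolding u_def[abs_def] using mollifier.measurable_smear[OF m gm, of k] by measurable
  \<comment> \<open>\<open>nash_smear\<close> asks for a positive bound while \<open>N\<close> may
    be 0 here, so \<open>N\<close> is first replaced by any larger \<open>M\<close>.\<close>
  have bound: "P powr e \<le> A * M" if M: "M > N" for M
  proof -
    have le: "(\<integral>\<^sup>+x. ennreal (u k x powr p) \<partial>lborel) \<le> ennreal ((A * M) powr (1 / e))" for k
      unfolding u_def A_def e_def
      by (rule mollifier.nash_smear[OF m p q g g0 G weak]) (use N M in \<open>auto intro: ennreal_leI\<close>)
    have "ennreal P = (\<integral>\<^sup>+x. liminf (\<lambda>k. ennreal (u k x powr p)) \<partial>lborel)"
      unfolding P(1)[symmetric]
    proof (intro nn_integral_cong_AE)
      show "AE x in lborel. ennreal (g x powr p) = liminf (\<lambda>k. ennreal (u k x powr p))"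
        using lim
      proof eventually_elim
        case (elim x)
        have "(\<lambda>k. u k x) \<longlonglongrightarrow> max 0 (g x - 0)"
          unfolding u_def by (intro tendsto_intros elim LIMSEQ_Suc[OF lim_1_over_n])
        then have "(\<lambda>k. u k x) \<longlonglongrightarrow> g x" using g0[of x] by simp
        then have "(\<lambda>k. u k x powr p) \<longlonglongrightarrow> g x powr p"
          using p by (intro tendsto_powr') (auto simp: u_def)
        then have "(\<lambda>k. ennreal (u k x powr p)) \<longlonglongrightarrow> ennreal (g x powr p)" by (rule tendsto_ennrealI)
        then show ?case by (intro lim_imp_Liminf[symmetric]) auto
      qed
    qed
    also have "\<dots> \<le> liminf (\<lambda>k. \<integral>\<^sup>+x. ennreal (u k x powr p) \<partial>lborel)"
      by (rule nn_integral_liminf) measurable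
    also have "\<dots> \<le> ennreal ((A * M) powr (1 / e))"
      using le by (intro Liminf_le) auto
    finally have "P \<le> (A * M) powr (1 / e)" by (simp add: ennreal_le_iff)
    then have "P powr e \<le> ((A * M) powr (1 / e)) powr e" using P e by (intro powr_mono2) auto
    also have "\<dots> = A * M" using e A M N by (simp add: powr_powr)
    finally show ?thesis .
  qed
  have "P powr e \<le> A * N"
  proof (rule field_le_epsilon)
    fix \<epsilon> :: real assume \<epsilon>: "\<epsilon> > 0"
    have "P powr e \<le> A * (N + \<epsilon> / (A + 1))" using \<epsilon> A by (intro bound) (auto intro!: divide_pos_pos)
    also have "\<dots> \<le> A * N + \<epsilon>" using \<epsilon> A by (simp add: field_simps)
    finally show "P powr e \<le> A * N + \<epsilon>" .
  qed
  then show ?thesis by (simp add: A_def e_def)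
qed

text \<open>The mollified function has zero derivative, hence is a constant c. By Jensen c^p has
  finite integral over the whole space, so c = 0, and smearing preserves mass. As g is only locally
  integrable, the derivative comes from the local form of the Taylor bound.\<close>

lemma weak_gradient_zero_not_Lp:
  fixes g :: "'a::euclidean_space \<Rightarrow> real" and G :: "'a \<Rightarrow> 'a" and p :: real
  assumes p: "p > 1"
    and g: "loc_int g" and gm[measurable]: "g \<in> borel_measurable borel" and g0: "\<And>x. g x \<ge> 0"
    and G: "loc_int G" and Gm[measurable]: "G \<in> borel_measurable borel"
    and weak: "\<And>\<phi> b. test_function \<phi> \<Longrightarrow> b \<in> Basis \<Longrightarrow>
       (\<integral>y. g y * partial_deriv b \<phi> y \<partial>lborel) = - (\<integral>y. (G y \<bullet> b) * \<phi> y \<partial>lborel)"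
    and N: "(\<integral>\<^sup>+x. ennreal (norm (G x) powr p) \<partial>lborel) = 0"
    and P: "(\<integral>\<^sup>+x. ennreal (g x powr p) \<partial>lborel) < top"
  shows "(\<integral>\<^sup>+x. ennreal (g x) \<partial>lborel) = 0"
proof -
  \<comment> \<open>Any single mollifier will do; the zero function serves to extract one from
    \<open>mollifier_sequence\<close>.\<close>
  have "integrable lborel (\<lambda>_::'a. 0 :: real)" by simp
  then obtain \<rho> \<rho>' \<delta> where "mollifier (\<rho> :: 'a \<Rightarrow> real) \<rho>' \<delta>"
    by (rule mollifier_sequence) blast
  then interpret mollifier \<rho> \<rho>' \<delta> .
  have "AE x in lborel. ennreal (norm (G x) powr p) = 0" using N by (subst (asm) nn_integral_0_iff_AE) auto
  then have G0: "AE x in lborel. G x = 0" by eventually_elim auto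
  have sG: "smear G x = 0" for x
  proof -
    have "smear G x = (\<integral>y. 0 \<partial>(lborel::'a measure))"
      unfolding smear_def using G0 by (intro integral_cong_AE) auto
    then show ?thesis by simp
  qed
  have grad: "smear G x = (\<integral>y. g y *\<^sub>R \<rho>' (x - y) \<partial>lborel)" for x
    using g gm G Gm weak by (rule smear_gradient)
  have "(smear g has_derivative (\<lambda>h. 0)) (at z within UNIV)" for z
    unfolding has_derivative_at_alt
  proof (intro conjI allI impI)
    fix e :: real assume e: "e > 0"
    define I where "I = (\<integral>y. indicator (cball z 2) y *\<^sub>R g y \<partial>lborel)"
    have I: "I \<ge> 0" unfolding I_def using g0 by (intro integral_nonneg_AE) auto
    have "e / (I + 1) > 0" using e I by simp
    from kernel_taylor[OF this] obtain r where r: "r > 0" "r \<le> 1"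
      "\<And>v w. norm w \<le> r \<Longrightarrow> \<bar>\<rho> (v + w) - \<rho> v - \<rho>' v \<bullet> w\<bar> \<le> e / (I + 1) * norm w" by blast
    show "\<exists>d>0. \<forall>y. norm (y - z) < d \<longrightarrow> norm (smear g y - smear g z - 0) \<le> e * norm (y - z)"
    proof (intro exI[of _ r] conjI allI impI r(1))
      fix y assume "norm (y - z) < r"
      then have "\<bar>smear g (z + (y - z)) - smear g z - smear G z \<bullet> (y - z)\<bar> \<le> e / (I + 1) * norm (y - z) * I"
        unfolding I_def by (intro smear_taylor[OF g gm g0 grad r[unfolded I_def]]) auto
      also have "\<dots> = e * norm (y - z) * (I / (I + 1))" by simp
      also have "\<dots> \<le> e * norm (y - z) * 1" using e I by (intro mult_left_mono) (auto simp: field_simps)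
      finally show "norm (smear g y - smear g z - 0) \<le> e * norm (y - z)" by (simp add: sG)
    qed
  qed simp
  then obtain c where c: "\<And>x. smear g x = c"
    using has_derivative_zero_constant[of "UNIV :: 'a set" "smear g"] by auto
  have c0: "c \<ge> 0" using smear_nonneg[of g 0, OF g0] c by simp
  have "(\<integral>\<^sup>+(x::'a). ennreal (c powr p) \<partial>lborel) \<le> (\<integral>\<^sup>+x. ennreal (g x powr p) \<partial>lborel)"
    using smear_powr_le[OF g gm g0 p] by (simp add: c)
  then have "(\<integral>\<^sup>+(x::'a). ennreal (c powr p) \<partial>lborel) < top" using P by (rule le_less_trans)
  then have "c = 0" using c0 by (auto simp: ennreal_mult_less_top)
  then show ?thesis using nn_integral_smear[OF g gm g0] by (simp add: c)
qed

section \<open>Borel representatives of Lebesgue measurable functions\<close>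

lemma locally_integrable_measurable:
  fixes f :: "'a::euclidean_space \<Rightarrow> 'b::euclidean_space"
  assumes "locally_integrable f"
  shows "f \<in> borel_measurable lebesgue"
proof (rule borel_measurable_LIMSEQ_metric)
  fix k :: nat
  have "set_integrable lebesgue (cball 0 (real k)) f"
    using assms by (auto simp: locally_integrable_def)
  then show "(\<lambda>x. indicator (cball 0 (real k)) x *\<^sub>R f x) \<in> borel_measurable lebesgue"
    unfolding set_integrable_def by auto
next
  fix x :: 'a
  obtain K :: nat where K: "norm x \<le> real K" using real_arch_simple by blast
  show "(\<lambda>k. indicator (cball 0 (real k)) x *\<^sub>R f x) \<longlonglongrightarrow> f x"
  proof (rule tendsto_eventually, rule eventually_sequentiallyI)
    fix k assume "K \<le> k"
    then have "norm x \<le> real k" using K by (meson of_nat_le_iff order_trans)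
    then show "indicator (cball 0 (real k)) x *\<^sub>R f x = f x" by simp
  qed
qed

lemma borel_representative:
  fixes f :: "'a::euclidean_space \<Rightarrow> 'b::euclidean_space"
  assumes [measurable]: "f \<in> borel_measurable lebesgue"
  obtains f' where "f' \<in> borel_measurable borel" "AE x in lborel. f x = f' x"
proof -
  have "\<exists>h. h \<in> borel_measurable borel \<and> (AE x in lborel. f x \<bullet> b = h x)" for b
    using completion_ex_borel_measurable_real[of "\<lambda>x. f x \<bullet> b" lborel] by auto
  then obtain h where h: "\<And>b. h b \<in> borel_measurable borel" "\<And>b. AE x in lborel. f x \<bullet> b = h b x" by metis
  show ?thesis
  proof (rule that)
    show "(\<lambda>x. \<Sum>b\<in>Basis. h b x *\<^sub>R b) \<in> borel_measurable borel" using h(1) by measurable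
    have "AE x in lborel. \<forall>b\<in>Basis. f x \<bullet> b = h b x" using h(2) by (intro AE_finite_allI) auto
    then show "AE x in lborel. f x = (\<Sum>b\<in>Basis. h b x *\<^sub>R b)"
    proof eventually_elim
      case (elim x)
      have "f x = (\<Sum>b\<in>Basis. (f x \<bullet> b) *\<^sub>R b)" by (rule euclidean_representation[symmetric])
      also have "\<dots> = (\<Sum>b\<in>Basis. h b x *\<^sub>R b)" using elim by (intro sum.cong) auto
      finally show ?case .
    qed
  qed
qed

lemma integral_lebesgue_eq_lborel:
  fixes f f' :: "'a::euclidean_space \<Rightarrow> 'b::euclidean_space"
  assumes "f \<in> borel_measurable lebesgue" "f' \<in> borel_measurable borel" "AE x in lborel. f x = f' x"
  shows "(\<integral>x. f x \<partial>lebesgue) = (\<integral>x. f' x \<partial>lborel)"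
proof -
  have [measurable]: "f' \<in> borel_measurable lebesgue" using assms(2) by (intro measurable_completion) simp
  have "(\<integral>x. f x \<partial>lebesgue) = (\<integral>x. f' x \<partial>lebesgue)"
    using assms by (intro integral_cong_AE) (auto simp: AE_completion_iff)
  also have "\<dots> = (\<integral>x. f' x \<partial>lborel)" using assms(2) by (intro integral_completion) simp
  finally show ?thesis .
qed

lemma locally_integrable_loc_int:
  fixes f f' :: "'a::euclidean_space \<Rightarrow> 'b::euclidean_space"
  assumes "locally_integrable f" "f' \<in> borel_measurable borel" "AE x in lborel. f x = f' x"
  shows "loc_int f'"
  unfolding loc_int_def
proof (intro allI)
  fix x :: 'a and r :: real
  have [measurable]: "f' \<in> borel_measurable borel" by (rule assms)
  have [measurable]: "f' \<in> borel_measurable lebesgue" using assms(2) by (intro measurable_completion) simp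
  have c: "cball x r \<in> sets lebesgue" by simp
  have i: "integrable lebesgue (\<lambda>y. indicator (cball x r) y *\<^sub>R f y)"
    using assms(1) by (auto simp: locally_integrable_def set_integrable_def)
  have "integrable lebesgue (\<lambda>y. indicator (cball x r) y *\<^sub>R f' y)"
  proof (rule integrable_cong_AE_imp[OF i])
    show "(\<lambda>y. indicator (cball x r) y *\<^sub>R f' y) \<in> borel_measurable lebesgue" using c by measurable
    have "AE y in lebesgue. f y = f' y" using assms(3) by (simp add: AE_completion_iff)
    then show "AE y in lebesgue. indicator (cball x r) y *\<^sub>R f y = indicator (cball x r) y *\<^sub>R f' y"
      by eventually_elim simp
  qed
  then show "integrable lborel (\<lambda>y. indicator (cball x r) y *\<^sub>R f' y)"
    by (subst (asm) integrable_completion) (use assms(2) in \<open>auto intro!: borel_measurable_scaleR borel_measurable_indicator\<close>)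
qed

lemma test_function_measurable:
  fixes \<phi> :: "'a::euclidean_space \<Rightarrow> real"
  assumes "test_function \<phi>"
  shows "\<phi> \<in> borel_measurable borel" "b \<in> Basis \<Longrightarrow> partial_deriv b \<phi> \<in> borel_measurable borel"
proof -
  have "C_k 0 \<phi>" "C_k (Suc 0) \<phi>" using assms unfolding test_function_def by blast+
  then show "\<phi> \<in> borel_measurable borel" "b \<in> Basis \<Longrightarrow> partial_deriv b \<phi> \<in> borel_measurable borel"
    by (auto intro!: borel_measurable_continuous_onI)
qed

theorem nash_inequality:
  fixes g :: "'a::euclidean_space \<Rightarrow> real" and G :: "'a \<Rightarrow> 'a" and p q :: real
  assumes p: "p > 1" and q: "q = p / (p - 1)" and Lp: "in_Lp p g"
    and pos: "AE x in lebesgue. g x > 0" and wg: "weak_gradient g G"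
  shows "ennreal_powr (\<integral>\<^sup>+ x. ennreal (g x powr p) \<partial>lebesgue) (1 + q / real DIM('a))
    \<le> ennreal (p powr p * inverse (gamma_const DIM('a) p))
      * ennreal_powr (\<integral>\<^sup>+ x. ennreal (g x) \<partial>lebesgue) (p * q / real DIM('a))
      * (\<integral>\<^sup>+ x. ennreal (norm (G x) powr p) \<partial>lebesgue)"
proof -
  have li: "locally_integrable g" "locally_integrable G" using wg by (auto simp: weak_gradient_def)
  have gm[measurable]: "g \<in> borel_measurable lebesgue" and Gm[measurable]: "G \<in> borel_measurable lebesgue"
    using li by (auto intro: locally_integrable_measurable)
  obtain g1 where g1[measurable]: "g1 \<in> borel_measurable borel" and g1eq: "AE x in lborel. g x = g1 x"
    using borel_representative[OF gm] by blast
  obtain G' where G'[measurable]: "G' \<in> borel_measurable borel" and G'eq: "AE x in lborel. G x = G' x"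
    using borel_representative[OF Gm] by blast
  \<comment> \<open>\<open>g\<close> is positive only almost everywhere, whereas the estimates for
    mollifications use nonnegativity at every point.\<close>
  define g' where "g' x = max 0 (g1 x)" for x
  have g'[measurable]: "g' \<in> borel_measurable borel" unfolding g'_def[abs_def] by measurable
  have pos': "AE x in lborel. g x > 0" using pos by (simp add: AE_completion_iff)
  have g'eq: "AE x in lborel. g x = g' x" using g1eq pos' by eventually_elim (simp add: g'_def)
  have g0: "g' x \<ge> 0" for x by (simp add: g'_def)
  have lg: "loc_int g'" and lG: "loc_int G'"
    using li g' G' g'eq G'eq by (auto intro: locally_integrable_loc_int)
  have weak: "(\<integral>y. g' y * partial_deriv b \<phi> y \<partial>lborel) = - (\<integral>y. (G' y \<bullet> b) * \<phi> y \<partial>lborel)"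
    if \<phi>: "test_function \<phi>" and b: "b \<in> Basis" for \<phi> b
  proof -
    note [measurable] = test_function_measurable(1)[OF \<phi>] test_function_measurable(2)[OF \<phi> b]
    have [measurable]: "\<phi> \<in> borel_measurable lebesgue" "partial_deriv b \<phi> \<in> borel_measurable lebesgue"
      by (auto intro!: measurable_completion)
    have "(\<integral>y. g' y * partial_deriv b \<phi> y \<partial>lborel) = (\<integral>y. g y * partial_deriv b \<phi> y \<partial>lebesgue)"
      using g'eq by (intro integral_lebesgue_eq_lborel[symmetric]) auto
    also have "\<dots> = - (\<integral>y. (G y \<bullet> b) * \<phi> y \<partial>lebesgue)"
      using wg \<phi> b by (auto simp: weak_gradient_def)
    also have "(\<integral>y. (G y \<bullet> b) * \<phi> y \<partial>lebesgue) = (\<integral>y. (G' y \<bullet> b) * \<phi> y \<partial>lborel)"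
      using G'eq by (intro integral_lebesgue_eq_lborel) auto
    finally show ?thesis .
  qed
  have eqs: "(\<integral>\<^sup>+ x. ennreal (g x powr p) \<partial>lebesgue) = (\<integral>\<^sup>+ x. ennreal (g' x powr p) \<partial>lborel)"
    "(\<integral>\<^sup>+ x. ennreal (g x) \<partial>lebesgue) = (\<integral>\<^sup>+ x. ennreal (g' x) \<partial>lborel)"
    "(\<integral>\<^sup>+ x. ennreal (norm (G x) powr p) \<partial>lebesgue) = (\<integral>\<^sup>+ x. ennreal (norm (G' x) powr p) \<partial>lborel)"
    unfolding nn_integral_completion using g'eq G'eq by (auto intro!: nn_integral_cong_AE)
  have "(\<integral>\<^sup>+ x. ennreal (g x powr p) \<partial>lebesgue) = (\<integral>\<^sup>+ x. ennreal (\<bar>g x\<bar> powr p) \<partial>lebesgue)"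
    unfolding nn_integral_completion using pos' by (intro nn_integral_cong_AE) auto
  then have "(\<integral>\<^sup>+ x. ennreal (g' x powr p) \<partial>lborel) < top" using Lp eqs(1) by (simp add: in_Lp_def)
  then obtain P where P: "(\<integral>\<^sup>+ x. ennreal (g' x powr p) \<partial>lborel) = ennreal P" "P \<ge> 0"
    by (cases "\<integral>\<^sup>+ x. ennreal (g' x powr p) \<partial>lborel") auto
  have q0: "q > 0" using p by (simp add: q)
  have gc: "gamma_const DIM('a) p > 0" using p by (intro gamma_const_pos) auto
  define C where "C = p powr p * inverse (gamma_const DIM('a) p)"
  have C: "C > 0" using gc p by (simp add: C_def)
  define m where "m = (\<integral>\<^sup>+ x. ennreal (g' x) \<partial>lborel)"
  define N where "N = (\<integral>\<^sup>+ x. ennreal (norm (G' x) powr p) \<partial>lborel)"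
  \<comment> \<open>Otherwise g' would be zero and positive almost everywhere, although the whole
    space is not a null set.\<close>
  have m0: "m \<noteq> 0"
  proof
    assume "m = 0"
    then have "AE x in lborel. ennreal (g' x) = 0" unfolding m_def by (subst (asm) nn_integral_0_iff_AE) auto
    then have "AE x in (lborel :: 'a measure). False" using g'eq pos'
      by eventually_elim (use g0 in auto)
    then show False by (simp add: AE_iff_null null_sets_def)
  qed
  \<comment> \<open>N = 0 would force m = 0; this uses that g lies in L^p.\<close>
  have N0: "N \<noteq> 0"
    using weak_gradient_zero_not_Lp[OF p lg g' g0 lG G' weak] P m0 by (auto simp: N_def m_def)
  have "ennreal_powr (ennreal P) (1 + q / DIM('a)) \<le> ennreal C * ennreal_powr m (p * q / DIM('a)) * N"
  \<comment> \<open>With one factor infinite and the others nonzero the right-hand side is infinite;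
    otherwise the estimate is one between real numbers.\<close>
  proof (cases "m = top \<or> N = top")
    case True
    have "ennreal_powr m (p * q / DIM('a)) \<noteq> 0"
    proof (cases m)
      case (real r)
      then have "r > 0" using m0 by (cases "r = 0") auto
      then show ?thesis using real by (simp add: ennreal_powr_def)
    qed (simp add: ennreal_powr_def)
    then have "ennreal C * ennreal_powr m (p * q / DIM('a)) * N = top"
      using True N0 C by (auto simp: ennreal_mult_eq_top_iff ennreal_powr_def)
    then show ?thesis by simp
  next
    case False
    then obtain m' N' where mN: "m = ennreal m'" "m' \<ge> 0" "N = ennreal N'" "N' \<ge> 0"
      by (cases m; cases N) auto
    have gi: "integrable lborel g'"
      using False g0 by (intro integrableI_nonneg) (auto simp: m_def less_top)
    have "m' = (\<integral>x. g' x \<partial>lborel)"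
      using nn_integral_eq_integral[OF gi] g0 mN by (simp add: m_def)
    then have "P powr (1 + q / DIM('a)) \<le> C * m' powr (p * q / DIM('a)) * N'"
      unfolding C_def using nash_integrable[OF p q gi g0 lG G' weak _ mN(4) P] mN(3) by (simp add: N_def)
    then have "ennreal (P powr (1 + q / DIM('a))) \<le> ennreal (C * m' powr (p * q / DIM('a)) * N')"
      by (rule ennreal_leI)
    then show ?thesis using C mN P by (simp add: ennreal_powr_def ennreal_mult)
  qed
  then show ?thesis unfolding eqs P(1) m_def N_def C_def .
qed

theorem theorem1p4:
  fixes g :: "real ^ 'n \<Rightarrow> real"
    and G :: "real ^ 'n \<Rightarrow> real ^ 'n"
    and n :: nat
    and p q :: real
  assumes "n = CARD('n)"
    and "p > 1"
    and "q = p / (p - 1)"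
    and "in_Lp p g"
    and "AE x in lebesgue. g x > 0"
    and "weak_gradient g G"
  shows "ennreal_powr (\<integral>\<^sup>+ x. ennreal (g x powr p) \<partial>lebesgue) (1 + q / real n)
    \<le> ennreal (p powr p * inverse (gamma_const n p))
      * ennreal_powr (\<integral>\<^sup>+ x. ennreal (g x) \<partial>lebesgue) (p * q / real n)
      * (\<integral>\<^sup>+ x. ennreal (norm (G x) powr p) \<partial>lebesgue)"
proof -
  have n: "DIM(real ^ 'n) = n" using assms(1) by simp
  show ?thesis using nash_inequality[OF assms(2-6)] unfolding n .
qed

end
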